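(* Fix integers $N,K\ge 1$ and real numbers $M>0$, $\alpha>0$. Let $\gamma_1,\dots,\gamma_N:[0,1]\to S_{M,K}$ be vineyards with values in $S_{M,K}$, i.e. maps that are continuous with respect to $W_2$. Then the map $$\mu_\gamma:[0,1]\to\mathcal{P}(S_{M,NK}),\qquad t\mapsto\mu_{(\gamma_1(t),\dots,\gamma_N(t))},$$ sending $t$ to the probabilistic Fréchet mean (with perturbation parameter $\alpha$) of $(\gamma_1(t),\dots,\gamma_N(t))$, is continuous with respect to $\mathbb{W}_2$.
   Context: **Diagrams.** $\|\cdot\|$ is the Euclidean norm on $\mathbb{R}^2$. $\Delta=\{(t,t):t\in\mathbb{R}\}$ is the diagonal and $\|x-\Delta\|=\min_{z\in\Delta}\|x-z\|$. A persistence diagram is a countable multiset of off-diagonal points in $\{(b,d)\in\mathbb{R}^2: d>b\}$ together with countably infinitely many copies of every point of $\Delta$. A matching $\phi:X\to Y$ of diagrams is a bijection. $W_2(X,Y)=\inf_{\phi}\big(\sum_{x\in X}\|x-\phi(x)\|^2\big)^{1/2}$ over all matchings. $S_{M,K}$ is the set of diagrams with at most $K$ off-diagonal points (counted with multiplicity), all of whose off-diagonal points $(x_1,x_2)$ satisfy $0\le x_1,x_2\le M$; it has the metric $W_2$. **Wasserstein distance on measures.** $\mathcal{P}(S_{M,NK})$ is the space of probability measures with finite second moment on $S_{M,NK}$, with metric $\mathbb{W}_2(\nu,\eta)=\big(\inf_\gamma\int W_2(U,V)^2\,d\gamma(U,V)\big)^{1/2}$, the infimum over couplings $\gamma$ of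 $\nu$ and $\eta$. **Selections and groupings.** Let $X=(X_1,\dots,X_N)$ be diagrams with finitely many off-diagonal points, which are labeled (so repeated points are distinguished). A selection is a choice, for each $i$, of either an off-diagonal point of $X_i$ or the symbol $\Delta$. The trivial selection for an off-diagonal $x\in X_i$ chooses $x$ for $X_i$ and $\Delta$ for all other diagrams. A grouping is a collection of selections such that every off-diagonal point of every diagram is in exactly one selection; groupings are identified up to reordering and up to adding or removing all-$\Delta$ selections. $\mathrm{mean}(s)$ is the point of the plane minimizing the sum of squared distances to the $N$ elements of $s$ (distance to an entry $\Delta$ is distance to the diagonal). $\mathrm{mean}_X(G)$ is the diagram whose off-diagonal points are the $\mathrm{mean}(s)$ for the (not all-$\Delta$) selections $s$ of $G$. A grouping $G$ is optimal for $X$ if $\mathrm{mean}_X(G)$ minimizes the Fréchet function $Z\mapsto\sum_{i=1}^N W_2(Z,X_i)^2$ over diagrams $Z$ with $W_2(Z,D_\emptyset)<\infty$, where $D_\emptyset$ is the diagram with no off-diagonal points. **The random grouping $\mathcal{H}_X$ and the PFM.** Fix $\alpha>0$. For an off-diagonal point $x$ let $r=\min\{\alpha,\|x-\Delta\|\}$ and let $\eta_x$ be the probability distribution on $\mathbb{R}^2\cup\{\Delta\}$ given by $\eta_x=\frac1{\pi\alpha^2}\mathbf{1}_{B(x,r)}+\frac{\alpha^2-r^2}{\alpha^2}\delta_\Delta$ (first term: density with respect to Lebesgue measure; second term: an atom at $\Delta$). Given $X\in(S_{M,K})^N$, draw independently $x'\sim\eta_x$ for each labeled off-diagonal point $x$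 of each $X_i$, and let $X_i'$ be the diagram whose off-diagonal points are those $x'\ne\Delta$ with $x\in X_i$. With probability one $X_1',\dots,X_N'$ have a unique optimal grouping; replacing each $x'$ in it by $x$ and adding the trivial selection for every $x$ with $x'=\Delta$ gives a grouping of $X$. This random grouping is $\mathcal{H}_X$. The probabilistic Fréchet mean (PFM) of $X$ is $\mu_X=\sum_G\mathbb{P}(\mathcal{H}_X=G)\,\delta_{\mathrm{mean}_X(G)}\in\mathcal{P}(S_{M,NK})$, the sum over all groupings $G$ of $X$. *)

theory Defs
  imports "HOL-Probability.Probability"
begin

section \<open>Extended nonnegative square root\<close>

definition esqrt :: "ennreal \<Rightarrow> ennreal" where
  "esqrt x = (if x = \<infinity> then \<infinity> else ennreal (sqrt (enn2real x)))"

section \<open>Persistence diagrams\<close>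

type_synonym point = "real \<times> real"

definition diagonal :: "point set" where
  "diagonal = {(t, t) |t. True}"

text \<open>A diagram is given by its multiplicity function.  Off-diagonal points lie above the
  diagonal; every diagonal point has multiplicity \<open>\<infinity>\<close> (countably many copies).\<close>

type_synonym diagram = "point \<Rightarrow> enat"

definition diagrams :: "diagram set" where
  "diagrams = {D. (\<forall>x\<in>diagonal. D x = \<infinity>) \<and>
                  (\<forall>b d. d < b \<longrightarrow> D (b, d) = 0) \<and>
                  countable {x. x \<notin> diagonal \<and> D x \<noteq> 0}}"

text \<open>The individual points of a diagram: the copies \<open>(x, 0), (x, 1), \<dots>\<close> of each \<open>x\<close>, as many
  as its multiplicity.  This also provides the labels that distinguish repeated points.\<close>

definition points :: "diagram \<Rightarrow> (point \<times> nat) set" where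
  "points D = {(x, k). enat k < D x}"

definition off_points :: "diagram \<Rightarrow> (point \<times> nat) set" where
  "off_points D = {(x, k) \<in> points D. x \<notin> diagonal}"

definition diagram_of_mset :: "point multiset \<Rightarrow> diagram" where
  "diagram_of_mset A = (\<lambda>x. if x \<in> diagonal then \<infinity> else enat (count A x))"

definition empty_diagram :: diagram where
  "empty_diagram = diagram_of_mset {#}"

definition matchings :: "diagram \<Rightarrow> diagram \<Rightarrow> (point \<times> nat \<Rightarrow> point \<times> nat) set" where
  "matchings X Y = {\<phi>. bij_betw \<phi> (points X) (points Y)}"

definition W2 :: "diagram \<Rightarrow> diagram \<Rightarrow> ennreal" where
  "W2 X Y = (INF \<phi>\<in>matchings X Y.
     esqrt (\<Sum>\<^sub>\<infinity>x\<in>points X. ennreal ((norm (fst x - fst (\<phi> x)))\<^sup>2)))"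

definition diagram_space :: "real \<Rightarrow> nat \<Rightarrow> diagram set" where
  "diagram_space M K = {D \<in> diagrams. finite (off_points D) \<and> card (off_points D) \<le> K \<and>
     (\<forall>((x1, x2), k) \<in> off_points D. 0 \<le> x1 \<and> x1 \<le> M \<and> 0 \<le> x2 \<and> x2 \<le> M)}"

text \<open>Continuity of a map from a subset of the line with respect to an extended-valued distance.\<close>

definition continuous_wrt :: "('b \<Rightarrow> 'b \<Rightarrow> ennreal) \<Rightarrow> real set \<Rightarrow> (real \<Rightarrow> 'b) \<Rightarrow> bool" where
  "continuous_wrt d T f \<longleftrightarrow> (\<forall>t\<in>T. ((\<lambda>s. d (f s) (f t)) \<longlongrightarrow> 0) (at t within T))"

definition vineyard :: "real \<Rightarrow> nat \<Rightarrow> (real \<Rightarrow> diagram) \<Rightarrow> bool" where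
  "vineyard M K \<gamma> \<longleftrightarrow> (\<forall>t\<in>{0..1}. \<gamma> t \<in> diagram_space M K) \<and> continuous_wrt W2 {0..1} \<gamma>"

section \<open>Measures on diagram space\<close>

definition borel_diagrams :: "real \<Rightarrow> nat \<Rightarrow> diagram measure" where
  "borel_diagrams M K = sigma (diagram_space M K)
     {U. U \<subseteq> diagram_space M K \<and>
         (\<forall>D\<in>U. \<exists>e>0. \<forall>E\<in>diagram_space M K. W2 D E < e \<longrightarrow> E \<in> U)}"

definition prob_diagrams :: "real \<Rightarrow> nat \<Rightarrow> diagram measure set" where
  "prob_diagrams M K = {\<nu>. prob_space \<nu> \<and> sets \<nu> = sets (borel_diagrams M K) \<and>
     (\<integral>\<^sup>+Z. (W2 Z empty_diagram)\<^sup>2 \<partial>\<nu>) < \<infinity>}"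

definition couplings :: "diagram measure \<Rightarrow> diagram measure \<Rightarrow> (diagram \<times> diagram) measure set" where
  "couplings \<nu> \<eta> = {\<rho>. sets \<rho> = sets (\<nu> \<Otimes>\<^sub>M \<eta>) \<and> distr \<rho> \<nu> fst = \<nu> \<and> distr \<rho> \<eta> snd = \<eta>}"

definition WW2 :: "diagram measure \<Rightarrow> diagram measure \<Rightarrow> ennreal" where
  "WW2 \<nu> \<eta> = esqrt (INF \<rho>\<in>couplings \<nu> \<eta>. \<integral>\<^sup>+(U, V). (W2 U V)\<^sup>2 \<partial>\<rho>)"

section \<open>Selections and groupings\<close>

text \<open>The labeled off-diagonal points of \<open>N\<close> diagrams are given by label sets \<open>L i\<close> and
  positions \<open>p i l\<close> for \<open>i < N\<close> and \<open>l \<in> L i\<close>.  In a selection, \<open>None\<close> stands for \<open>\<Delta>\<close>; entries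
  with index \<open>i \<ge> N\<close> are fixed to \<open>None\<close>.\<close>

type_synonym 'l selection = "nat \<Rightarrow> 'l option"

definition is_selection :: "nat \<Rightarrow> (nat \<Rightarrow> 'l set) \<Rightarrow> 'l selection \<Rightarrow> bool" where
  "is_selection N L s \<longleftrightarrow> (\<forall>i<N. s i \<in> insert None (Some ` L i)) \<and> (\<forall>i\<ge>N. s i = None)"

definition trivial_selection :: "nat \<Rightarrow> 'l \<Rightarrow> 'l selection" where
  "trivial_selection i l = (\<lambda>_. None)(i := Some l)"

text \<open>Each grouping is represented by its set of selections that are not all \<open>\<Delta>\<close>; such
  selections cannot be repeated, because every label is used exactly once.\<close>

definition is_grouping :: "nat \<Rightarrow> (nat \<Rightarrow> 'l set) \<Rightarrow> 'l selection set \<Rightarrow> bool" where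
  "is_grouping N L G \<longleftrightarrow> (\<forall>s\<in>G. is_selection N L s \<and> s \<noteq> (\<lambda>_. None)) \<and>
     (\<forall>i<N. \<forall>l\<in>L i. \<exists>!s. s \<in> G \<and> s i = Some l)"

definition selection_mean :: "nat \<Rightarrow> (nat \<Rightarrow> 'l \<Rightarrow> point) \<Rightarrow> 'l selection \<Rightarrow> point" where
  "selection_mean N p s = (THE z. is_arg_min
     (\<lambda>z. \<Sum>i<N. case s i of None \<Rightarrow> (infdist z diagonal)\<^sup>2 | Some l \<Rightarrow> (norm (z - p i l))\<^sup>2)
     (\<lambda>_. True) z)"

definition grouping_mean :: "nat \<Rightarrow> (nat \<Rightarrow> 'l \<Rightarrow> point) \<Rightarrow> 'l selection set \<Rightarrow> diagram" where
  "grouping_mean N p G = diagram_of_mset (image_mset (selection_mean N p) (mset_set G))"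

definition frechet :: "nat \<Rightarrow> (nat \<Rightarrow> diagram) \<Rightarrow> diagram \<Rightarrow> ennreal" where
  "frechet N X Z = (\<Sum>i<N. (W2 Z (X i))\<^sup>2)"

definition optimal_grouping ::
  "nat \<Rightarrow> (nat \<Rightarrow> 'l set) \<Rightarrow> (nat \<Rightarrow> 'l \<Rightarrow> point) \<Rightarrow> 'l selection set \<Rightarrow> bool" where
  "optimal_grouping N L p G \<longleftrightarrow> is_grouping N L G \<and>
     is_arg_min (frechet N (\<lambda>i. diagram_of_mset (image_mset (p i) (mset_set (L i)))))
       (\<lambda>Z. Z \<in> diagrams \<and> W2 Z empty_diagram < \<infinity>) (grouping_mean N p G)"

section \<open>The probabilistic Frechet mean\<close>

text \<open>The distribution \<open>\<eta>\<^sub>x\<close> on the plane together with the extra point \<open>\<Delta>\<close>, encoded as \<open>None\<close>.\<close>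

definition perturbation :: "real \<Rightarrow> point \<Rightarrow> point option measure" where
  "perturbation \<alpha> x = (let r = min \<alpha> (infdist x diagonal) in
     measure_of UNIV {A. Some -` A \<in> sets borel}
       (\<lambda>A. ennreal (1 / (pi * \<alpha>\<^sup>2)) * emeasure lborel (Some -` A \<inter> ball x r)
          + ennreal ((\<alpha>\<^sup>2 - r\<^sup>2) / \<alpha>\<^sup>2) * indicator A None))"

text \<open>A draw \<open>\<omega>\<close> assigns to each labeled point \<open>(i, l)\<close> of the diagrams \<open>X i\<close> its perturbation.\<close>

definition draws ::
  "real \<Rightarrow> nat \<Rightarrow> (nat \<Rightarrow> diagram) \<Rightarrow> (nat \<times> (point \<times> nat) \<Rightarrow> point option) measure" where
  "draws \<alpha> N X = PiM (SIGMA i:{..<N}. off_points (X i)) (\<lambda>(i, l). perturbation \<alpha> (fst l))"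

text \<open>A surviving point keeps its label; hence replacing each \<open>x'\<close> by \<open>x\<close> in a grouping leaves
  the selections of labels unchanged.\<close>

definition surviving ::
  "(nat \<Rightarrow> diagram) \<Rightarrow> (nat \<times> (point \<times> nat) \<Rightarrow> point option) \<Rightarrow> nat \<Rightarrow> (point \<times> nat) set" where
  "surviving X \<omega> i = {l \<in> off_points (X i). \<omega> (i, l) \<noteq> None}"

definition lift_grouping ::
  "nat \<Rightarrow> (nat \<Rightarrow> diagram) \<Rightarrow> (nat \<times> (point \<times> nat) \<Rightarrow> point option) \<Rightarrow>
   (point \<times> nat) selection set \<Rightarrow> (point \<times> nat) selection set" where
  "lift_grouping N X \<omega> G = G \<union>
     {trivial_selection i l |i l. i < N \<and> l \<in> off_points (X i) \<and> \<omega> (i, l) = None}"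

text \<open>The probability that the perturbed diagrams have a unique optimal grouping, and that this
  grouping induces the grouping \<open>G\<close> of \<open>X\<close>.  The event is restricted to draws whose surviving
  points all lie above the diagonal, which holds almost surely since \<open>r \<le> \<parallel>x - \<Delta>\<parallel>\<close>; otherwise the
  perturbed point sets are not diagrams.\<close>

definition grouping_prob ::
  "real \<Rightarrow> nat \<Rightarrow> (nat \<Rightarrow> diagram) \<Rightarrow> (point \<times> nat) selection set \<Rightarrow> real" where
  "grouping_prob \<alpha> N X G = measure (draws \<alpha> N X)
     {\<omega> \<in> space (draws \<alpha> N X).
        (\<forall>i<N. \<forall>l\<in>surviving X \<omega> i. fst (the (\<omega> (i, l))) < snd (the (\<omega> (i, l)))) \<and>
        (\<exists>G'. (\<forall>H. optimal_grouping N (surviving X \<omega>) (\<lambda>i l. the (\<omega> (i, l))) H \<longleftrightarrow> H = G') \<and>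
              lift_grouping N X \<omega> G' = G)}"

definition pfm :: "real \<Rightarrow> nat \<Rightarrow> real \<Rightarrow> nat \<Rightarrow> (nat \<Rightarrow> diagram) \<Rightarrow> diagram measure" where
  "pfm \<alpha> N M K X = measure_of (diagram_space M (N * K)) (sets (borel_diagrams M (N * K)))
     (\<lambda>A. \<Sum>G | is_grouping N (\<lambda>i. off_points (X i)) G.
        ennreal (grouping_prob \<alpha> N X G) * indicator A (grouping_mean N (\<lambda>i l. fst l) G))"

end

theory Submission
  imports Defs
begin

text \<open>In coordinates along and across the diagonal, the cost of a selection is explicit, and its mean
  has height \<open>(1/N)\<close> times the sum of the heights.  Matchings of a diagram \<open>Z\<close> with the given
  diagrams induce a grouping whose cost is at most the Frechet value of \<open>Z\<close>, so optimal groupings are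
  the minimizers of a finite problem; the heights of distinct selections and the costs of distinct groupings differ
  almost surely, because such a difference is a nonzero polynomial in the position of a single point;
  this makes the minimizer unique.  For continuity, a small distance between
  \<open>\<gamma> i s\<close> and \<open>\<gamma> i t\<close> matches every off-diagonal point of \<open>\<gamma> i t\<close> with a close point of
  \<open>\<gamma> i s\<close> and leaves only points near the diagonal, which are dropped with high probability.  The laws
  of the perturbations of close points are close in total variation.  Hence groupings correspond with
  nearly equal probabilities and nearly equal means, and coupling along this correspondence bounds the
  Wasserstein distance, because all distances within the bounded region are bounded.\<close>

section \<open>Coordinates along and across the diagonal\<close>

text \<open>The Frechet function is minimized over all diagrams at finite distance from the empty
  one. These may have infinitely many off-diagonal points, and \<open>W2\<close> is an infimum that
  is not shown to be attained there. Comparisons with an arbitrary \<open>Z\<close> therefore carry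
  a slack, which is harmless because there are only finitely many groupings. A second obstacle is
  that optimality of a grouping is a property of its mean diagram: a priori two groupings might
  share a mean, and a mean might be matched to the inputs more cheaply than by its own grouping.
  Least cost alone thus does not identify the grouping. The heights in a selection are divided by
  the fixed number N, whatever the size of the selection, so distinct height sums let each selection
  be read off from its mean. In the continuity estimate only one direction is compared: groupings at
  time t inject into those at time s. As both families of probabilities have total mass 1, a
  one-sided bound already controls the mass that a coupling cannot keep on this injection.\<close>

definition hgt :: "point \<Rightarrow> real" where "hgt x = snd x - fst x"

text \<open>Together with \<open>hgt\<close> this is a rotation by 45 degrees without its factor 1 /
  sqrt 2, which avoids square roots. The omitted factor is the origin of the halves in
  \<open>norm_diff_sq\<close> and in the squared distance to the diagonal.\<close>

definition adv :: "point \<Rightarrow> real" where "adv x = fst x + snd x"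

definition foot :: "point \<Rightarrow> point" where "foot x = (adv x / 2, adv x / 2)"

lemma mem_diagonal_iff: "x \<in> diagonal \<longleftrightarrow> hgt x = 0"
  by (cases x) (auto simp: diagonal_def hgt_def)

lemma diagonal_nonempty: "diagonal \<noteq> {}"
  by (auto simp: diagonal_def)

lemma foot_diagonal: "foot x \<in> diagonal"
  by (simp add: mem_diagonal_iff foot_def hgt_def)

lemma norm_diff_sq:
  fixes x y :: point
  shows "(norm (x - y))\<^sup>2 = ((adv x - adv y)\<^sup>2 + (hgt x - hgt y)\<^sup>2) / 2"
proof -
  have "(norm (x - y))\<^sup>2 = (fst x - fst y)\<^sup>2 + (snd x - snd y)\<^sup>2"
    by (simp add: norm_prod_def)
  also have "\<dots> = ((adv x - adv y)\<^sup>2 + (hgt x - hgt y)\<^sup>2) / 2"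
    by (simp add: adv_def hgt_def power2_eq_square field_simps)
  finally show ?thesis .
qed

lemma norm_foot_sq: "(norm (x - foot x))\<^sup>2 = (hgt x)\<^sup>2 / 2"
  by (simp add: norm_diff_sq foot_def adv_def[of "(_, _)"] hgt_def[of "(_, _)"])

lemma norm_diagonal_sq_ge: "y \<in> diagonal \<Longrightarrow> (hgt x)\<^sup>2 / 2 \<le> (norm (x - y))\<^sup>2"
  by (simp add: norm_diff_sq mem_diagonal_iff)

lemma infdist_diagonal: "infdist x diagonal = norm (x - foot x)"
proof (rule antisym)
  show "infdist x diagonal \<le> norm (x - foot x)"
    using infdist_le[OF foot_diagonal, of x x] by (simp add: dist_norm)
  have "norm (x - foot x) \<le> dist x y" if "y \<in> diagonal" for y
    using norm_diagonal_sq_ge[OF that, of x] unfolding norm_foot_sq[symmetric] dist_norm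
    by (rule power2_le_imp_le) simp
  then show "norm (x - foot x) \<le> infdist x diagonal"
    unfolding infdist_def using diagonal_nonempty
    by (auto intro!: cINF_greatest)
qed

lemma infdist_diagonal_sq: "(infdist x diagonal)\<^sup>2 = (hgt x)\<^sup>2 / 2"
  by (simp add: infdist_diagonal norm_foot_sq)

lemma infdist_diagonal_le_iff: "e \<ge> 0 \<Longrightarrow> infdist x diagonal \<le> e \<longleftrightarrow> (hgt x)\<^sup>2 / 2 \<le> e\<^sup>2"
  unfolding infdist_diagonal_sq[symmetric] by (rule power_mono_iff[symmetric]) (auto simp: infdist_nonneg)

text \<open>The sharp factor is sqrt 2; the cruder 2 keeps later constants rational.\<close>

lemma abs_hgt_diff_le: "\<bar>hgt x - hgt y\<bar> \<le> 2 * norm (x - y)"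
proof (rule power2_le_imp_le[OF _ mult_nonneg_nonneg])
  show "\<bar>hgt x - hgt y\<bar>\<^sup>2 \<le> (2 * norm (x - y))\<^sup>2"
    unfolding power_mult_distrib norm_diff_sq power2_abs by simp
qed auto

lemma abs_adv_diff_le: "\<bar>adv x - adv y\<bar> \<le> 2 * norm (x - y)"
proof (rule power2_le_imp_le[OF _ mult_nonneg_nonneg])
  show "\<bar>adv x - adv y\<bar>\<^sup>2 \<le> (2 * norm (x - y))\<^sup>2"
    unfolding power_mult_distrib norm_diff_sq power2_abs by simp
qed auto

section \<open>The mean of a selection\<close>

definition sel_sum :: "nat \<Rightarrow> (nat \<Rightarrow> 'l \<Rightarrow> point) \<Rightarrow> (point \<Rightarrow> real) \<Rightarrow> 'l selection \<Rightarrow> real" where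
  "sel_sum N p f s = (\<Sum>i<N. case s i of None \<Rightarrow> 0 | Some l \<Rightarrow> f (p i l))"

definition sel_card :: "nat \<Rightarrow> 'l selection \<Rightarrow> real" where
  "sel_card N s = (\<Sum>i<N. case s i of None \<Rightarrow> 0 | Some l \<Rightarrow> 1)"

text \<open>This is the objective function of \<open>selection_mean\<close>, with the squared
  distance to the diagonal already written as half the squared height.\<close>

definition sel_dist :: "nat \<Rightarrow> (nat \<Rightarrow> 'l \<Rightarrow> point) \<Rightarrow> 'l selection \<Rightarrow> point \<Rightarrow> real" where
  "sel_dist N p s z =
     (\<Sum>i<N. case s i of None \<Rightarrow> (hgt z)\<^sup>2 / 2 | Some l \<Rightarrow> (norm (z - p i l))\<^sup>2)"

text \<open>For the selection without points, \<open>sel_card\<close> is \<open>0\<close> and the quotient by it vanishes.\<close>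

definition sel_cost :: "nat \<Rightarrow> (nat \<Rightarrow> 'l \<Rightarrow> point) \<Rightarrow> 'l selection \<Rightarrow> real" where
  "sel_cost N p s =
     (sel_sum N p (\<lambda>x. (adv x)\<^sup>2) s - (sel_sum N p adv s)\<^sup>2 / sel_card N s
      + sel_sum N p (\<lambda>x. (hgt x)\<^sup>2) s - (sel_sum N p hgt s)\<^sup>2 / real N) / 2"

text \<open>A \<open>None\<close> entry pulls the height towards 0 but says nothing about the
  position along the diagonal. Hence the height is averaged over all N entries and
  \<open>adv\<close> only over the points present.\<close>

definition mean_pt :: "nat \<Rightarrow> (nat \<Rightarrow> 'l \<Rightarrow> point) \<Rightarrow> 'l selection \<Rightarrow> point" where
  "mean_pt N p s =
     (let a = sel_sum N p adv s / sel_card N s; h = sel_sum N p hgt s / real N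
      in ((a - h) / 2, (a + h) / 2))"

lemma adv_mean_pt: "adv (mean_pt N p s) = sel_sum N p adv s / sel_card N s"
  and hgt_mean_pt: "hgt (mean_pt N p s) = sel_sum N p hgt s / real N"
  by (simp_all add: mean_pt_def Let_def adv_def[of "(_, _)"] hgt_def[of "(_, _)"] field_simps)

lemma point_eqI: "adv x = adv y \<Longrightarrow> hgt x = hgt y \<Longrightarrow> x = y"
  by (cases x; cases y) (auto simp: adv_def hgt_def)

lemma sel_card_nonneg: "0 \<le> sel_card N s"
  by (auto simp: sel_card_def intro!: sum_nonneg split: option.splits)

lemma sel_card_pos: "i < N \<Longrightarrow> s i \<noteq> None \<Longrightarrow> 0 < sel_card N s"
  unfolding sel_card_def by (rule sum_pos2[of _ i]) (auto split: option.splits)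

lemma sel_sum_zero: "sel_card N s = 0 \<Longrightarrow> sel_sum N p f s = 0"
  unfolding sel_sum_def using sel_card_pos[of _ N s]
  by (intro sum.neutral ballI) (auto split: option.splits)

text \<open>Completing the square separately in \<open>adv\<close> and in \<open>hgt\<close>. The
  weights are the numbers of entries that constrain each coordinate: \<open>sel_card\<close> for
  \<open>adv\<close>, N for \<open>hgt\<close>. For the empty selection the \<open>adv\<close> sums
  vanish, so division by zero does no harm.\<close>

lemma sel_dist_eq:
  assumes "N \<ge> 1"
  shows "sel_dist N p s z = sel_cost N p s
    + (sel_card N s * (adv z - sel_sum N p adv s / sel_card N s)\<^sup>2
       + real N * (hgt z - sel_sum N p hgt s / real N)\<^sup>2) / 2"
proof -
  let ?k = "sel_card N s" and ?a = "sel_sum N p adv s" and ?h = "sel_sum N p hgt s"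
  let ?aa = "sel_sum N p (\<lambda>x. (adv x)\<^sup>2) s" and ?hh = "sel_sum N p (\<lambda>x. (hgt x)\<^sup>2) s"
  have "sel_dist N p s z = (\<Sum>i<N.
      ((case s i of None \<Rightarrow> 0 | Some l \<Rightarrow> 1) * (adv z)\<^sup>2
       - (case s i of None \<Rightarrow> 0 | Some l \<Rightarrow> adv (p i l)) * (2 * adv z)
       + (case s i of None \<Rightarrow> 0 | Some l \<Rightarrow> (adv (p i l))\<^sup>2)
       + (hgt z)\<^sup>2
       - (case s i of None \<Rightarrow> 0 | Some l \<Rightarrow> hgt (p i l)) * (2 * hgt z)
       + (case s i of None \<Rightarrow> 0 | Some l \<Rightarrow> (hgt (p i l))\<^sup>2)) / 2)"
    unfolding sel_dist_def
    by (intro sum.cong refl)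
       (auto simp: norm_diff_sq power2_diff split: option.splits)
  also have "\<dots> = (?k * (adv z)\<^sup>2 - ?a * (2 * adv z) + ?aa
      + real N * (hgt z)\<^sup>2 - ?h * (2 * hgt z) + ?hh) / 2"
    unfolding sel_sum_def sel_card_def
    by (simp add: sum_divide_distrib[symmetric] sum.distrib sum_subtractf sum_distrib_right)
  finally have *: "sel_dist N p s z = \<dots>" .
  have h: "real N * (hgt z - ?h / real N)\<^sup>2 = real N * (hgt z)\<^sup>2 - ?h * (2 * hgt z) + ?h\<^sup>2 / real N"
    using assms by (simp add: power2_eq_square field_simps)
  have a: "?k * (adv z - ?a / ?k)\<^sup>2 = ?k * (adv z)\<^sup>2 - ?a * (2 * adv z) + ?a\<^sup>2 / ?k"
    using sel_sum_zero[of N s p adv]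
    by (cases "?k = 0") (simp_all add: power2_eq_square field_simps)
  show ?thesis
    unfolding * a h sel_cost_def by (simp add: field_simps)
qed

lemma sel_dist_mean_pt: "N \<ge> 1 \<Longrightarrow> sel_dist N p s (mean_pt N p s) = sel_cost N p s"
  by (simp add: sel_dist_eq adv_mean_pt hgt_mean_pt)

text \<open>The \<open>adv\<close> square is dropped and the height square kept: it measures how far
  the height of \<open>z\<close> is from that of the mean, which later identifies the selections of
  an optimal grouping.\<close>

lemma sel_dist_ge:
  assumes "N \<ge> 1"
  shows "sel_cost N p s + real N / 2 * (hgt z - sel_sum N p hgt s / real N)\<^sup>2 \<le> sel_dist N p s z"
  using sel_card_nonneg[of N s] by (simp add: sel_dist_eq[OF assms] field_simps)

lemma sel_dist_nonneg: "0 \<le> sel_dist N p s z"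
  unfolding sel_dist_def by (intro sum_nonneg) (auto split: option.splits)

lemma sel_cost_nonneg: "N \<ge> 1 \<Longrightarrow> 0 \<le> sel_cost N p s"
  using sel_dist_nonneg[of N p s "mean_pt N p s"] by (simp add: sel_dist_mean_pt)

text \<open>Both squares in \<open>sel_dist_eq\<close> have positive weight once the selection
  contains a point, so the minimizer is unique and \<open>THE\<close> is meaningful. For the empty
  selection every point of the diagonal would be a minimizer.\<close>

lemma selection_mean_eq:
  assumes "N \<ge> 1" "i < N" "s i \<noteq> None"
  shows "selection_mean N p s = mean_pt N p s"
proof -
  have obj: "(\<lambda>z. \<Sum>i<N. case s i of None \<Rightarrow> (infdist z diagonal)\<^sup>2 | Some l \<Rightarrow> (norm (z - p i l))\<^sup>2)
      = sel_dist N p s"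
    by (rule ext) (simp only: sel_dist_def infdist_diagonal_sq)
  have k: "sel_card N s > 0" using assms(2,3) by (rule sel_card_pos)
  have N: "real N > 0" using assms(1) by simp
  have strict: "sel_cost N p s < sel_dist N p s z" if "z \<noteq> mean_pt N p s" for z
  proof -
    have "adv z \<noteq> adv (mean_pt N p s) \<or> hgt z \<noteq> hgt (mean_pt N p s)"
      using that point_eqI by blast
    then have "sel_card N s * (adv z - sel_sum N p adv s / sel_card N s)\<^sup>2 > 0
        \<or> real N * (hgt z - sel_sum N p hgt s / real N)\<^sup>2 > 0"
      using k N by (auto simp: adv_mean_pt hgt_mean_pt)
    moreover have "sel_card N s * (adv z - sel_sum N p adv s / sel_card N s)\<^sup>2 \<ge> 0"
      "real N * (hgt z - sel_sum N p hgt s / real N)\<^sup>2 \<ge> 0"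
      using k N by auto
    moreover have "c < c + (a + b) / 2" if "0 < a \<or> 0 < b" "0 \<le> a" "0 \<le> b" for a b c :: real
      using that by auto
    ultimately show ?thesis unfolding sel_dist_eq[OF assms(1)] by blast
  qed
  have min: "sel_cost N p s \<le> sel_dist N p s z" for z
    using strict[of z] by (cases "z = mean_pt N p s") (simp_all add: sel_dist_mean_pt[OF assms(1)])
  show ?thesis
    unfolding selection_mean_def obj
  proof (rule the_equality)
    show "is_arg_min (sel_dist N p s) (\<lambda>_. True) (mean_pt N p s)"
      using min by (auto simp: is_arg_min_def sel_dist_mean_pt[OF assms(1)] not_less)
    show "z = mean_pt N p s" if "is_arg_min (sel_dist N p s) (\<lambda>_. True) z" for z
      using that strict[of z] unfolding is_arg_min_def sel_dist_mean_pt[OF assms(1), of p s, symmetric]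
      by blast
  qed
qed

lemma sel_sum_cong:
  "(\<And>i l. i < N \<Longrightarrow> s i = Some l \<Longrightarrow> f (p i l) = g (q i l)) \<Longrightarrow> sel_sum N p f s = sel_sum N q g s"
  unfolding sel_sum_def by (intro sum.cong) (auto split: option.splits)

lemma sel_sum_diff_le:
  assumes "\<And>i l. i < N \<Longrightarrow> s i = Some l \<Longrightarrow> \<bar>f (p i l) - f (q i l)\<bar> \<le> e"
  shows "\<bar>sel_sum N p f s - sel_sum N q f s\<bar> \<le> sel_card N s * e"
proof -
  have "\<bar>sel_sum N p f s - sel_sum N q f s\<bar>
    \<le> (\<Sum>i<N. \<bar>(case s i of None \<Rightarrow> 0 | Some l \<Rightarrow> f (p i l)) - (case s i of None \<Rightarrow> 0 | Some l \<Rightarrow> f (q i l))\<bar>)"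
    unfolding sel_sum_def sum_subtractf[symmetric] by (rule sum_abs)
  also have "\<dots> \<le> (\<Sum>i<N. (case s i of None \<Rightarrow> 0 | Some l \<Rightarrow> 1) * e)"
    using assms by (intro sum_mono) (auto split: option.splits)
  finally show ?thesis by (simp add: sel_card_def sum_distrib_right)
qed

lemma sel_card_le: "sel_card N s \<le> real N"
proof -
  have "sel_card N s \<le> (\<Sum>i<N. 1)"
    unfolding sel_card_def by (intro sum_mono) (auto split: option.splits)
  then show ?thesis by simp
qed

text \<open>Each coordinate of the mean moves by at most 2 e: the \<open>adv\<close> sum has
  \<open>sel_card\<close> terms and is divided by \<open>sel_card\<close>, the \<open>hgt\<close>
  sum has at most N terms and is divided by N. Half the sum of the two squares is 4 e^2.\<close>

lemma mean_pt_diff_sq_le: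
  assumes "N \<ge> 1" "e \<ge> 0" "\<And>i l. i < N \<Longrightarrow> s i = Some l \<Longrightarrow> norm (p i l - q i l) \<le> e"
  shows "(norm (mean_pt N p s - mean_pt N q s))\<^sup>2 \<le> 4 * e\<^sup>2"
proof -
  have N: "real N > 0" using assms(1) by simp
  have "\<bar>sel_sum N p hgt s - sel_sum N q hgt s\<bar> \<le> sel_card N s * (2 * e)"
    using assms(3) by (intro sel_sum_diff_le order_trans[OF abs_hgt_diff_le]) auto
  also have "\<dots> \<le> real N * (2 * e)"
    using sel_card_le assms(2) by (intro mult_right_mono) auto
  finally have h: "\<bar>hgt (mean_pt N p s) - hgt (mean_pt N q s)\<bar> \<le> 2 * e"
    using N by (simp add: hgt_mean_pt diff_divide_distrib[symmetric] field_simps)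
  have "\<bar>sel_sum N p adv s - sel_sum N q adv s\<bar> \<le> sel_card N s * (2 * e)"
    using assms(3) by (intro sel_sum_diff_le order_trans[OF abs_adv_diff_le]) auto
  then have a: "\<bar>adv (mean_pt N p s) - adv (mean_pt N q s)\<bar> \<le> 2 * e"
    using sel_card_nonneg[of N s] assms(2)
    by (cases "sel_card N s = 0")
       (simp_all add: adv_mean_pt diff_divide_distrib[symmetric] field_simps)
  show ?thesis
    using power_mono[OF h, of 2] power_mono[OF a, of 2]
    by (simp add: norm_diff_sq power_mult_distrib)
qed

section \<open>Costs of matchings\<close>

lemma esqrt_mono: "x \<le> y \<Longrightarrow> esqrt x \<le> esqrt y"
  by (cases x; cases y) (auto simp: esqrt_def top_unique ennreal_leI)

lemma esqrt_power2: "(esqrt x)\<^sup>2 = x"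
  by (cases x) (auto simp: esqrt_def ennreal_power)

lemma esqrt_ennreal: "x \<ge> 0 \<Longrightarrow> esqrt (ennreal x) = ennreal (sqrt x)"
  by (simp add: esqrt_def)

text \<open>The sum under the root in \<open>W2\<close>. With values in \<open>ennreal\<close> it
  always exists, and working with squared distances avoids \<open>esqrt\<close>.\<close>

definition match_cost :: "(point \<times> nat \<Rightarrow> point \<times> nat) \<Rightarrow> (point \<times> nat) set \<Rightarrow> ennreal" where
  "match_cost \<phi> A = (\<Sum>\<^sub>\<infinity>x\<in>A. ennreal ((norm (fst x - fst (\<phi> x)))\<^sup>2))"

lemma ennreal_summable_on: "(f :: 'a \<Rightarrow> ennreal) summable_on A"
  by (rule nonneg_summable_on_complete) simp

lemma sum_le_match_cost:
  assumes "finite F" "F \<subseteq> A"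
  shows "(\<Sum>x\<in>F. ennreal ((norm (fst x - fst (\<phi> x)))\<^sup>2)) \<le> match_cost \<phi> A"
  unfolding match_cost_def
  unfolding infsum_finite[OF assms(1), symmetric]
  by (rule infsum_mono_neutral) (use assms in \<open>auto simp: ennreal_summable_on\<close>)

lemma W2_sq_le: "\<phi> \<in> matchings X Y \<Longrightarrow> (W2 X Y)\<^sup>2 \<le> match_cost \<phi> (points X)"
proof -
  assume "\<phi> \<in> matchings X Y"
  then have "W2 X Y \<le> esqrt (match_cost \<phi> (points X))"
    unfolding W2_def match_cost_def by (rule INF_lower)
  then have "(W2 X Y)\<^sup>2 \<le> (esqrt (match_cost \<phi> (points X)))\<^sup>2"
    by (rule power_mono) simp
  then show ?thesis by (simp add: esqrt_power2)
qed

lemma le_W2_sq: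
  assumes "\<And>\<phi>. \<phi> \<in> matchings X Y \<Longrightarrow> c \<le> match_cost \<phi> (points X)"
  shows "c \<le> (W2 X Y)\<^sup>2"
proof -
  have "esqrt c \<le> W2 X Y"
    unfolding W2_def
    using assms[THEN esqrt_mono] by (intro INF_greatest) (simp add: match_cost_def)
  then have "(esqrt c)\<^sup>2 \<le> (W2 X Y)\<^sup>2"
    by (rule power_mono) simp
  then show ?thesis by (simp add: esqrt_power2)
qed

lemma W2_sq_less_obtain:
  assumes "(W2 X Y)\<^sup>2 < c"
  obtains \<phi> where "\<phi> \<in> matchings X Y" "match_cost \<phi> (points X) < c"
  using le_W2_sq[of X Y c] assms by (meson not_le)

text \<open>A budget instead of an exact cost, so that matchings of disjoint pieces can be combined
  without naming the bijections.\<close>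

definition matchable :: "ennreal \<Rightarrow> (point \<times> nat) set \<Rightarrow> (point \<times> nat) set \<Rightarrow> bool" where
  "matchable c A B \<longleftrightarrow> (\<exists>\<phi>. bij_betw \<phi> A B \<and> match_cost \<phi> A \<le> c)"

lemma match_cost_cong: "(\<And>x. x \<in> A \<Longrightarrow> \<phi> x = \<psi> x) \<Longrightarrow> match_cost \<phi> A = match_cost \<psi> A"
  unfolding match_cost_def by (rule infsum_cong) simp

lemma matchable_Un:
  assumes "matchable c A B" "matchable d C D" "A \<inter> C = {}" "B \<inter> D = {}"
  shows "matchable (c + d) (A \<union> C) (B \<union> D)"
proof -
  obtain f g where f: "bij_betw f A B" "match_cost f A \<le> c"
    and g: "bij_betw g C D" "match_cost g C \<le> d"
    using assms(1,2) by (auto simp: matchable_def)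
  define h where "h x = (if x \<in> A then f x else g x)" for x
  have hf: "match_cost h A = match_cost f A"
    by (rule match_cost_cong) (simp add: h_def)
  have hg: "match_cost h C = match_cost g C"
    using assms(3) by (intro match_cost_cong) (auto simp: h_def)
  have "bij_betw h (A \<union> C) (B \<union> D)"
    unfolding h_def using f(1) g(1) assms(3,4) by (rule bij_betw_disjoint_Un)
  moreover have "match_cost h (A \<union> C) = match_cost h A + match_cost h C"
    unfolding match_cost_def
    by (rule infsum_Un_disjoint) (auto simp: ennreal_summable_on assms(3))
  ultimately show ?thesis
    unfolding matchable_def using f(2) g(2) hf hg by (auto intro!: exI[of _ h] add_mono)
qed

lemma matchable_indexed:
  assumes "finite R" "bij_betw f R A" "bij_betw g R B"
  shows "matchable (\<Sum>r\<in>R. ennreal ((norm (fst (f r) - fst (g r)))\<^sup>2)) A B"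
proof -
  let ?\<phi> = "g \<circ> inv_into R f"
  have "bij_betw ?\<phi> A B"
    using assms bij_betw_inv_into bij_betw_trans by blast
  moreover have "match_cost ?\<phi> A = (\<Sum>\<^sub>\<infinity>r\<in>R. ennreal ((norm (fst (f r) - fst (?\<phi> (f r))))\<^sup>2))"
    unfolding match_cost_def by (rule infsum_reindex_bij_betw[OF assms(2), symmetric])
  moreover have "\<dots> = (\<Sum>r\<in>R. ennreal ((norm (fst (f r) - fst (g r)))\<^sup>2))"
    using assms(1,2) by (simp add: bij_betw_inv_into_left)
  ultimately show ?thesis unfolding matchable_def by auto
qed

text \<open>Hilbert's hotel: removing finitely many copies of diagonal points changes nothing.\<close>

lemma matchable_diagonal:
  assumes "finite F" "finite F'"
  shows "matchable 0 (D \<times> UNIV - F) (D \<times> UNIV - F')"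
proof -
  have inf: "infinite {k :: nat. (x, k) \<notin> S}" if "finite S" for x :: point and S
  proof
    assume "finite {k. (x, k) \<notin> S}"
    moreover have "{k. (x, k) \<in> S} \<subseteq> snd ` S" by force
    then have "finite {k. (x, k) \<in> S}" using that finite_surj by blast
    moreover have "UNIV = {k. (x, k) \<notin> S} \<union> {k. (x, k) \<in> S}" by auto
    ultimately show False
      by (metis finite_UnI infinite_UNIV_nat)
  qed
  \<comment> \<open>Both sets are infinite sets of naturals, and their increasing enumerations match
    them. Copies are permuted only above the same point \<open>x\<close>, so the cost is 0.\<close>
  have "\<exists>f. bij_betw f {k. (x, k) \<notin> F} {k. (x, k) \<notin> F'}" for x :: point
    using bij_betw_trans[OF bij_betw_inv_into[OF bij_enumerate[OF inf[OF assms(1)]]]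
        bij_enumerate[OF inf[OF assms(2)]]] by blast
  then obtain f where f: "\<And>x. bij_betw (f x) {k. (x, k) \<notin> F} {k. (x, k) \<notin> F'}"
    by metis
  let ?\<phi> = "\<lambda>(x, k). (x, f x k)"
  have "bij_betw ?\<phi> (D \<times> UNIV - F) (D \<times> UNIV - F')"
    unfolding bij_betw_def
  proof
    show "inj_on ?\<phi> (D \<times> UNIV - F)"
      using f by (auto simp: inj_on_def bij_betw_def)
    show "?\<phi> ` (D \<times> UNIV - F) = D \<times> UNIV - F'"
    proof (intro equalityI subsetI)
      show "y \<in> D \<times> UNIV - F'" if "y \<in> ?\<phi> ` (D \<times> UNIV - F)" for y
        using that f by (fastforce simp: bij_betw_def)
      show "y \<in> ?\<phi> ` (D \<times> UNIV - F)" if y: "y \<in> D \<times> UNIV - F'" for y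
      proof -
        obtain x k where yx: "y = (x, k)" "x \<in> D" "(x, k) \<notin> F'" using y by auto
        then have "k \<in> f x ` {k. (x, k) \<notin> F}" using f[of x] by (simp add: bij_betw_def)
        then obtain j where "k = f x j" "(x, j) \<notin> F" by auto
        then have "y = ?\<phi> (x, j)" "(x, j) \<in> D \<times> UNIV - F" using yx by auto
        then show ?thesis by (rule image_eqI)
      qed
    qed
  qed
  moreover have "match_cost ?\<phi> (D \<times> UNIV - F) = 0"
    unfolding match_cost_def by (intro infsum_0) auto
  ultimately show ?thesis unfolding matchable_def by (intro exI[of _ ?\<phi>]) auto
qed

text \<open>Here \<open>X\<close> stands for the diagonal copies. Points of \<open>A2\<close> move
  onto the copies in \<open>F\<close>, points of \<open>B2\<close> are reached from the copies in
  \<open>G\<close>, and the remaining copies are rearranged at cost 0 although different ones were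
  used up on the two sides.\<close>

lemma matchable_exchange:
  assumes "matchable c1 A1 B1" "matchable c2 A2 F" "matchable c3 G B2" "matchable 0 (X - G) (X - F)"
    and disj: "A1 \<inter> A2 = {}" "B1 \<inter> B2 = {}" "F \<subseteq> X" "G \<subseteq> X"
      "(A1 \<union> A2) \<inter> X = {}" "(B1 \<union> B2) \<inter> X = {}"
  shows "matchable (c1 + c2 + c3) (A1 \<union> A2 \<union> X) (B1 \<union> B2 \<union> X)"
proof -
  have 1: "matchable (c1 + c2) (A1 \<union> A2) (B1 \<union> F)"
    using disj by (intro matchable_Un assms) auto
  have "B2 \<inter> (X - F) = {}" using disj by auto
  from matchable_Un[OF assms(3,4) _ this]
  have 2: "matchable c3 (G \<union> (X - G)) (B2 \<union> (X - F))" by simp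
  have "matchable (c1 + c2 + c3) (A1 \<union> A2 \<union> (G \<union> (X - G))) (B1 \<union> F \<union> (B2 \<union> (X - F)))"
    using disj by (intro matchable_Un 1 2) auto
  moreover have "G \<union> (X - G) = X" "B1 \<union> F \<union> (B2 \<union> (X - F)) = B1 \<union> B2 \<union> X" using disj by auto
  ultimately show ?thesis by simp
qed

section \<open>The distance of finite diagrams by partial matchings\<close>

text \<open>An indexing by an arbitrary finite set: a mean diagram can be indexed by its selections
  and an input diagram by its labels, so that multiplicities disappear from the cost
  estimates.\<close>

definition labels :: "diagram \<Rightarrow> 'a set \<Rightarrow> ('a \<Rightarrow> point \<times> nat) \<Rightarrow> ('a \<Rightarrow> point) \<Rightarrow> bool" where
  "labels D A \<alpha> p \<longleftrightarrow> finite A \<and> bij_betw \<alpha> A (off_points D) \<and> (\<forall>a\<in>A. fst (\<alpha> a) = p a) \<and>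
     (\<forall>x\<in>diagonal. D x = \<infinity>)"

definition pmatch :: "'a set \<Rightarrow> 'b set \<Rightarrow> ('a \<times> 'b) set set" where
  "pmatch A B = {R. R \<subseteq> A \<times> B \<and> inj_on fst R \<and> inj_on snd R}"

text \<open>The usual finite description of the distance of diagrams: a partial matching, where each
  leftover point pays its squared distance to the diagonal.\<close>

definition pm_cost :: "'a set \<Rightarrow> ('a \<Rightarrow> point) \<Rightarrow> 'b set \<Rightarrow> ('b \<Rightarrow> point) \<Rightarrow> ('a \<times> 'b) set \<Rightarrow> real" where
  "pm_cost A p B q R = (\<Sum>(a, b)\<in>R. (norm (p a - q b))\<^sup>2) + (\<Sum>a\<in>A - fst ` R. (hgt (p a))\<^sup>2 / 2)
     + (\<Sum>b\<in>B - snd ` R. (hgt (q b))\<^sup>2 / 2)"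

lemma finite_pmatch: "finite A \<Longrightarrow> finite B \<Longrightarrow> finite (pmatch A B)"
  by (rule finite_subset[of _ "Pow (A \<times> B)"]) (auto simp: pmatch_def)

lemma points_eq:
  assumes "\<forall>x\<in>diagonal. D x = \<infinity>"
  shows "points D = off_points D \<union> diagonal \<times> UNIV"
  using assms by (force simp: points_def off_points_def)

lemma off_points_Int_diagonal: "off_points D \<inter> (diagonal \<times> UNIV) = {}"
  by (auto simp: off_points_def)

lemma W2_sq_le_pm_cost:
  assumes D: "labels D A \<alpha> p" and E: "labels E B \<beta> q" and R: "R \<in> pmatch A B"
  shows "(W2 D E)\<^sup>2 \<le> ennreal (pm_cost A p B q R)"
proof -
  have fin: "finite A" "finite B" and \<alpha>: "bij_betw \<alpha> A (off_points D)" "\<And>a. a \<in> A \<Longrightarrow> fst (\<alpha> a) = p a"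
    and \<beta>: "bij_betw \<beta> B (off_points E)" "\<And>b. b \<in> B \<Longrightarrow> fst (\<beta> b) = q b"
    and diag: "\<forall>x\<in>diagonal. D x = \<infinity>" "\<forall>x\<in>diagonal. E x = \<infinity>"
    using D E by (auto simp: labels_def)
  have RAB: "R \<subseteq> A \<times> B" "inj_on fst R" "inj_on snd R" using R by (auto simp: pmatch_def)
  have finR: "finite R" using RAB(1) fin finite_subset by blast
  let ?A1 = "fst ` R" and ?B1 = "snd ` R"
  let ?A2 = "A - fst ` R" and ?B2 = "B - snd ` R"
  have sub: "?A1 \<subseteq> A" "?B1 \<subseteq> B" using RAB(1) by auto
  obtain n :: "'a \<Rightarrow> nat" where n: "inj_on n A" using fin(1) finite_imp_inj_to_nat_seg by blast
  obtain m :: "'b \<Rightarrow> nat" where m: "inj_on m B" using fin(2) finite_imp_inj_to_nat_seg by blast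
  \<comment> \<open>Each leftover point is sent to its foot on the diagonal. The injective
    numberings \<open>n\<close> and \<open>m\<close> give different copies to points with the same
    foot.\<close>
  define f where "f a = (foot (p a), n a)" for a
  define g where "g b = (foot (q b), m b)" for b
  have f: "bij_betw f ?A2 (f ` ?A2)" and g: "bij_betw g ?B2 (g ` ?B2)"
    using n m by (auto simp: bij_betw_def inj_on_def f_def g_def)
  have restr: "bij_betw \<alpha> S (\<alpha> ` S)" if "S \<subseteq> A" for S
    using \<alpha>(1) that by (meson bij_betw_subset)
  have restr': "bij_betw \<beta> S (\<beta> ` S)" if "S \<subseteq> B" for S
    using \<beta>(1) that by (meson bij_betw_subset)
  have c1: "matchable (\<Sum>r\<in>R. ennreal ((norm (p (fst r) - q (snd r)))\<^sup>2)) (\<alpha> ` ?A1) (\<beta> ` ?B1)"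
  proof -
    have bij: "bij_betw (\<alpha> \<circ> fst) R (\<alpha> ` ?A1)" "bij_betw (\<beta> \<circ> snd) R (\<beta> ` ?B1)"
      using RAB(2,3) restr[OF sub(1)] restr'[OF sub(2)]
      by (auto intro: bij_betw_trans simp: bij_betw_def comp_inj_on)
    have eq: "(\<Sum>r\<in>R. ennreal ((norm (fst ((\<alpha> \<circ> fst) r) - fst ((\<beta> \<circ> snd) r)))\<^sup>2))
        = (\<Sum>r\<in>R. ennreal ((norm (p (fst r) - q (snd r)))\<^sup>2))"
      using RAB(1) \<alpha>(2) \<beta>(2) by (intro sum.cong) auto
    show ?thesis
      using matchable_indexed[OF finR bij] unfolding eq .
  qed
  have c2: "matchable (\<Sum>a\<in>?A2. ennreal ((hgt (p a))\<^sup>2 / 2)) (\<alpha> ` ?A2) (f ` ?A2)"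
  proof -
    have "(\<Sum>a\<in>?A2. ennreal ((norm (fst (\<alpha> a) - fst (f a)))\<^sup>2)) = (\<Sum>a\<in>?A2. ennreal ((hgt (p a))\<^sup>2 / 2))"
      using \<alpha>(2) by (intro sum.cong) (auto simp: f_def norm_foot_sq)
    then show ?thesis
      using matchable_indexed[OF _ restr f] fin by simp
  qed
  have c3: "matchable (\<Sum>b\<in>?B2. ennreal ((hgt (q b))\<^sup>2 / 2)) (g ` ?B2) (\<beta> ` ?B2)"
  proof -
    have "(\<Sum>b\<in>?B2. ennreal ((norm (fst (g b) - fst (\<beta> b)))\<^sup>2)) = (\<Sum>b\<in>?B2. ennreal ((hgt (q b))\<^sup>2 / 2))"
      using \<beta>(2) by (intro sum.cong) (auto simp: g_def norm_foot_sq norm_minus_commute[of "foot _"])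
    then show ?thesis
      using matchable_indexed[OF _ g restr'] fin by simp
  qed
  have c4: "matchable 0 (diagonal \<times> UNIV - g ` ?B2) (diagonal \<times> UNIV - f ` ?A2)"
    using fin by (intro matchable_diagonal) auto
  have AB: "?A1 \<union> ?A2 = A" "?B1 \<union> ?B2 = B" using sub by blast+
  have sA: "\<alpha> ` ?A1 \<union> \<alpha> ` ?A2 = off_points D"
    using bij_betw_imp_surj_on[OF \<alpha>(1)] by (simp only: image_Un[symmetric] AB)
  have sB: "\<beta> ` ?B1 \<union> \<beta> ` ?B2 = off_points E"
    using bij_betw_imp_surj_on[OF \<beta>(1)] by (simp only: image_Un[symmetric] AB)
  have "\<alpha> ` ?A1 \<inter> \<alpha> ` ?A2 = \<alpha> ` (?A1 \<inter> ?A2)"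
    by (rule inj_on_image_Int[symmetric, OF bij_betw_imp_inj_on[OF \<alpha>(1)]]) (use sub in auto)
  then have dA: "\<alpha> ` ?A1 \<inter> \<alpha> ` ?A2 = {}" by (simp only: Diff_disjoint image_empty)
  have "\<beta> ` ?B1 \<inter> \<beta> ` ?B2 = \<beta> ` (?B1 \<inter> ?B2)"
    by (rule inj_on_image_Int[symmetric, OF bij_betw_imp_inj_on[OF \<beta>(1)]]) (use sub in auto)
  then have dB: "\<beta> ` ?B1 \<inter> \<beta> ` ?B2 = {}" by (simp only: Diff_disjoint image_empty)
  have gD: "g ` ?B2 \<subseteq> diagonal \<times> UNIV" and fD: "f ` ?A2 \<subseteq> diagonal \<times> UNIV"
    by (auto simp: f_def g_def foot_diagonal)
  note offD = off_points_Int_diagonal[of D] off_points_Int_diagonal[of E]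
  have "matchable ((\<Sum>r\<in>R. ennreal ((norm (p (fst r) - q (snd r)))\<^sup>2))
      + (\<Sum>a\<in>?A2. ennreal ((hgt (p a))\<^sup>2 / 2)) + (\<Sum>b\<in>?B2. ennreal ((hgt (q b))\<^sup>2 / 2)))
      (points D) (points E)"
    using matchable_exchange[OF c1 c2 c3 c4 dA dB fD gD] offD
    unfolding sA sB points_eq[OF diag(1)] points_eq[OF diag(2)] by simp
  also have "(\<Sum>r\<in>R. ennreal ((norm (p (fst r) - q (snd r)))\<^sup>2))
      + (\<Sum>a\<in>?A2. ennreal ((hgt (p a))\<^sup>2 / 2)) + (\<Sum>b\<in>?B2. ennreal ((hgt (q b))\<^sup>2 / 2))
      = ennreal (pm_cost A p B q R)"
    by (simp add: pm_cost_def sum_ennreal case_prod_beta ennreal_plus[symmetric] sum_nonneg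
        del: ennreal_plus)
  finally obtain \<phi> where \<phi>: "bij_betw \<phi> (points D) (points E)"
    "match_cost \<phi> (points D) \<le> ennreal (pm_cost A p B q R)"
    by (auto simp: matchable_def)
  then show ?thesis
    using W2_sq_le[of \<phi> D E] by (auto simp: matchings_def)
qed

text \<open>\<open>R\<close> keeps the pairs in which \<open>\<phi>\<close> joins two off-diagonal
  points. In every other pair that contains an off-diagonal point the partner lies on the diagonal,
  so the pair costs at least half the squared height. Pairs within the diagonal are discarded from
  the sum.\<close>

lemma pm_cost_le_match_cost:
  assumes D: "labels D A \<alpha> p" and E: "labels E B \<beta> q" and \<phi>: "\<phi> \<in> matchings D E"
  defines "R \<equiv> {(a, b) \<in> A \<times> B. \<phi> (\<alpha> a) = \<beta> b}"
  shows "R \<in> pmatch A B" "ennreal (pm_cost A p B q R) \<le> match_cost \<phi> (points D)"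
proof -
  have fin: "finite A" "finite B" and \<alpha>: "bij_betw \<alpha> A (off_points D)" "\<And>a. a \<in> A \<Longrightarrow> fst (\<alpha> a) = p a"
    and \<beta>: "bij_betw \<beta> B (off_points E)" "\<And>b. b \<in> B \<Longrightarrow> fst (\<beta> b) = q b"
    and diag: "\<forall>x\<in>diagonal. D x = \<infinity>" "\<forall>x\<in>diagonal. E x = \<infinity>"
    using D E by (auto simp: labels_def)
  have bij: "bij_betw \<phi> (points D) (points E)" using \<phi> by (simp add: matchings_def)
  have \<alpha>pt: "\<alpha> a \<in> points D" if "a \<in> A" for a
    using \<alpha>(1) that by (auto simp: points_eq[OF diag(1)] bij_betw_def)
  have \<beta>pt: "\<beta> b \<in> points E" if "b \<in> B" for b
    using \<beta>(1) that by (auto simp: points_eq[OF diag(2)] bij_betw_def)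
  have inj: "a = a'" if "a \<in> A" "a' \<in> A" "\<phi> (\<alpha> a) = \<phi> (\<alpha> a')" for a a'
    using that bij \<alpha>pt \<alpha>(1) by (auto simp: bij_betw_def inj_on_def)
  have inj': "b = b'" if "b \<in> B" "b' \<in> B" "\<beta> b = \<beta> b'" for b b'
    using that \<beta>(1) by (auto simp: bij_betw_def inj_on_def)
  show pm: "R \<in> pmatch A B"
    unfolding pmatch_def R_def using inj inj' by (auto simp: inj_on_def)
  have finR: "finite R" using fin by (auto simp: R_def intro: finite_subset[of _ "A \<times> B"])
  let ?w = "\<lambda>x. (norm (fst x - fst (\<phi> x)))\<^sup>2"
  let ?A2 = "A - fst ` R" and ?B2 = "B - snd ` R"
  define \<psi> where "\<psi> = inv_into (points D) \<phi>"
  have \<psi>: "\<psi> y \<in> points D" "\<phi> (\<psi> y) = y" if "y \<in> points E" for y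
    using that bij bij_betw_inv_into[OF bij] unfolding \<psi>_def
    by (auto simp: bij_betw_def bij_betw_inv_into_right f_inv_into_f inv_into_into)
  \<comment> \<open>Sources of the pairs that count: \<open>?T1\<close> holds the off-diagonal
    points of \<open>D\<close>, and \<open>?T2\<close> the diagonal points of \<open>D\<close> that
    are sent to off-diagonal points of \<open>E\<close>.\<close>
  let ?T1 = "\<alpha> ` A" and ?T2 = "(\<psi> \<circ> \<beta>) ` ?B2"
  have off2: "\<psi> (\<beta> b) \<notin> off_points D" if "b \<in> ?B2" for b
  proof
    assume "\<psi> (\<beta> b) \<in> off_points D"
    then obtain a where "a \<in> A" "\<psi> (\<beta> b) = \<alpha> a" using \<alpha>(1) by (auto simp: bij_betw_def)
    then have "(a, b) \<in> R" using that \<psi>(2)[OF \<beta>pt[of b]] by (auto simp: R_def)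
    then show False using that by force
  qed
  have off1: "\<phi> (\<alpha> a) \<notin> off_points E" if "a \<in> ?A2" for a
  proof
    assume "\<phi> (\<alpha> a) \<in> off_points E"
    then obtain b where "b \<in> B" "\<phi> (\<alpha> a) = \<beta> b" using \<beta>(1) by (auto simp: bij_betw_def)
    then have "(a, b) \<in> R" using that by (auto simp: R_def)
    then show False using that by force
  qed
  have d1: "fst (\<phi> (\<alpha> a)) \<in> diagonal" if "a \<in> ?A2" for a
    using off1[OF that] bij_betw_apply[OF bij \<alpha>pt[of a]] that by (auto simp: points_eq[OF diag(2)] mem_Times_iff)
  have d2: "fst (\<psi> (\<beta> b)) \<in> diagonal" if "b \<in> ?B2" for b
    using off2[OF that] \<psi>(1)[OF \<beta>pt[of b]] that by (auto simp: points_eq[OF diag(1)] mem_Times_iff)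
  have disj: "?T1 \<inter> ?T2 = {}" using off2 \<alpha>(1) by (auto simp: bij_betw_def)
  have injT2: "inj_on (\<psi> \<circ> \<beta>) ?B2"
  proof (rule inj_onI)
    fix b b' assume "b \<in> ?B2" "b' \<in> ?B2" "(\<psi> \<circ> \<beta>) b = (\<psi> \<circ> \<beta>) b'"
    then have "\<beta> b = \<beta> b'" using \<psi>(2) \<beta>pt by (metis DiffD1 comp_apply)
    then show "b = b'" using inj' \<open>b \<in> ?B2\<close> \<open>b' \<in> ?B2\<close> by blast
  qed
  have "pm_cost A p B q R \<le> (\<Sum>x\<in>?T1 \<union> ?T2. ?w x)"
  proof -
    have "(\<Sum>x\<in>?T1 \<union> ?T2. ?w x) = (\<Sum>x\<in>?T1. ?w x) + (\<Sum>x\<in>?T2. ?w x)"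
      using fin disj by (intro sum.union_disjoint) auto
    also have "(\<Sum>x\<in>?T1. ?w x) = (\<Sum>a\<in>A. ?w (\<alpha> a))"
      using \<alpha>(1) by (subst sum.reindex) (auto simp: bij_betw_def)
    also have "(\<Sum>a\<in>A. ?w (\<alpha> a)) = (\<Sum>a\<in>fst ` R. ?w (\<alpha> a)) + (\<Sum>a\<in>?A2. ?w (\<alpha> a))"
      using fin(1) by (subst sum.subset_diff[of "fst ` R"]) (auto simp: R_def)
    also have "(\<Sum>a\<in>fst ` R. ?w (\<alpha> a)) = (\<Sum>r\<in>R. ?w (\<alpha> (fst r)))"
      using pm by (subst sum.reindex) (auto simp: pmatch_def)
    also have "\<dots> = (\<Sum>(a, b)\<in>R. (norm (p a - q b))\<^sup>2)"
      using \<alpha>(2) \<beta>(2) by (intro sum.cong) (auto simp: R_def)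
    also have "(\<Sum>x\<in>?T2. ?w x) = (\<Sum>b\<in>?B2. ?w (\<psi> (\<beta> b)))"
      by (subst sum.reindex[OF injT2]) simp
    finally have eq: "(\<Sum>x\<in>?T1 \<union> ?T2. ?w x) = (\<Sum>(a, b)\<in>R. (norm (p a - q b))\<^sup>2)
      + (\<Sum>a\<in>?A2. ?w (\<alpha> a)) + (\<Sum>b\<in>?B2. ?w (\<psi> (\<beta> b)))" by simp
    have "(\<Sum>a\<in>?A2. (hgt (p a))\<^sup>2 / 2) \<le> (\<Sum>a\<in>?A2. ?w (\<alpha> a))"
      using norm_diagonal_sq_ge[OF d1] \<alpha>(2) by (intro sum_mono) auto
    moreover have "(\<Sum>b\<in>?B2. (hgt (q b))\<^sup>2 / 2) \<le> (\<Sum>b\<in>?B2. ?w (\<psi> (\<beta> b)))"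
      using norm_diagonal_sq_ge[OF d2] \<beta>(2) \<psi>(2)[OF \<beta>pt]
      by (intro sum_mono) (auto simp: norm_minus_commute)
    ultimately show ?thesis unfolding eq pm_cost_def by linarith
  qed
  then have "ennreal (pm_cost A p B q R) \<le> ennreal (\<Sum>x\<in>?T1 \<union> ?T2. ?w x)"
    by (rule ennreal_leI)
  also have "\<dots> = (\<Sum>x\<in>?T1 \<union> ?T2. ennreal (?w x))"
    by (rule sum_ennreal[symmetric]) simp
  also have "\<dots> \<le> match_cost \<phi> (points D)"
    using fin \<alpha>pt \<psi>(1) \<beta>pt by (intro sum_le_match_cost) (simp_all add: image_subset_iff)
  finally show "ennreal (pm_cost A p B q R) \<le> match_cost \<phi> (points D)" .
qed

text \<open>The infimum over bijections of infinite sets becomes one over a finite set of explicit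
  functions of the positions; this is what gives measurability later.\<close>

lemma W2_sq_labels:
  assumes "labels D A \<alpha> p" "labels E B \<beta> q"
  shows "(W2 D E)\<^sup>2 = (INF R\<in>pmatch A B. ennreal (pm_cost A p B q R))"
proof (rule antisym)
  show "(W2 D E)\<^sup>2 \<le> (INF R\<in>pmatch A B. ennreal (pm_cost A p B q R))"
    using W2_sq_le_pm_cost[OF assms] by (intro INF_greatest)
  show "(INF R\<in>pmatch A B. ennreal (pm_cost A p B q R)) \<le> (W2 D E)\<^sup>2"
    using pm_cost_le_match_cost[OF assms] by (intro le_W2_sq INF_lower2)
qed

lemma off_points_diagram_of_mset:
  "off_points (diagram_of_mset A) = {(x, k). x \<notin> diagonal \<and> k < count A x}"
  by (auto simp: off_points_def points_def diagram_of_mset_def)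

text \<open>Indices sharing a position are numbered consecutively from 0, which yields exactly the
  copies that the multiplicity provides.\<close>

lemma ex_labels_mset:
  assumes fin: "finite A" and off: "\<And>a. a \<in> A \<Longrightarrow> p a \<notin> diagonal"
  shows "\<exists>\<alpha>. labels (diagram_of_mset (image_mset p (mset_set A))) A \<alpha> p"
proof -
  have cnt: "count (image_mset p (mset_set A)) x = card {a \<in> A. p a = x}" for x
    using fin by (simp add: count_image_mset' ) (metis)
  have "\<exists>f. bij_betw f {a \<in> A. p a = x} {..<card {a \<in> A. p a = x}}" for x
    using fin ex_bij_betw_finite_nat[of "{a \<in> A. p a = x}"] by (auto simp: atLeast0LessThan)
  then obtain f where f: "\<And>x. bij_betw (f x) {a \<in> A. p a = x} {..<card {a \<in> A. p a = x}}"
    by metis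
  let ?\<alpha> = "\<lambda>a. (p a, f (p a) a)"
  have "bij_betw ?\<alpha> A {(x, k). x \<notin> diagonal \<and> k < card {a \<in> A. p a = x}}"
    unfolding bij_betw_def
  proof
    show "inj_on ?\<alpha> A"
    proof (rule inj_onI)
      fix a b assume "a \<in> A" "b \<in> A" "?\<alpha> a = ?\<alpha> b"
      then show "a = b" using f[of "p b"] by (auto simp: bij_betw_def inj_on_def)
    qed
    show "?\<alpha> ` A = {(x, k). x \<notin> diagonal \<and> k < card {a \<in> A. p a = x}}"
    proof (intro equalityI subsetI)
      show "y \<in> {(x, k). x \<notin> diagonal \<and> k < card {a \<in> A. p a = x}}" if "y \<in> ?\<alpha> ` A" for y
 
      proof -
        obtain a where "a \<in> A" "y = ?\<alpha> a" using \<open>y \<in> ?\<alpha> ` A\<close> by auto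
        moreover have "f (p a) a \<in> {..<card {b \<in> A. p b = p a}}"
          using bij_betw_apply[OF f, of a "p a"] \<open>a \<in> A\<close> by simp
        ultimately show ?thesis using off by simp
      qed
      show "y \<in> ?\<alpha> ` A" if "y \<in> {(x, k). x \<notin> diagonal \<and> k < card {a \<in> A. p a = x}}" for y
      proof -
        obtain x k where yk: "y = (x, k)" by (cases y)
        then have y: "y = (x, k)" "k < card {a \<in> A. p a = x}" using that by auto
        then have "k \<in> f x ` {a \<in> A. p a = x}" using f[of x] by (simp add: bij_betw_def)
        then show ?thesis using y by force
      qed
    qed
  qed
  then show ?thesis
    unfolding labels_def off_points_diagram_of_mset cnt
    by (intro exI[of _ ?\<alpha>]) (auto simp: fin diagram_of_mset_def)
qed

lemma labels_diagram_space:
  "D \<in> diagram_space M K \<Longrightarrow> labels D (off_points D) id fst"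
  by (auto simp: labels_def diagram_space_def diagrams_def bij_betw_def)

lemma labels_empty_diagram: "labels empty_diagram {} \<alpha> p"
  by (simp add: labels_def empty_diagram_def off_points_diagram_of_mset bij_betw_def) (simp add: diagram_of_mset_def)

text \<open>The empty partial matching sends every point to the diagonal.\<close>

lemma W2_sq_le_hgt:
  assumes "labels D A \<alpha> p" "labels E B \<beta> q"
  shows "(W2 D E)\<^sup>2 \<le> ennreal ((\<Sum>a\<in>A. (hgt (p a))\<^sup>2 / 2) + (\<Sum>b\<in>B. (hgt (q b))\<^sup>2 / 2))"
  using W2_sq_le_pm_cost[OF assms, of "{}"] by (simp add: pmatch_def pm_cost_def)

lemma W2_finite:
  assumes "labels D A \<alpha> p" "labels E B \<beta> q"
  shows "W2 D E < \<infinity>"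
proof -
  have "(W2 D E)\<^sup>2 < \<infinity>"
    using W2_sq_le_hgt[OF assms] by (rule le_less_trans) simp
  then show ?thesis
    by (cases "W2 D E = \<infinity>") (auto simp: less_top)
qed

section \<open>Groupings and the Frechet function\<close>

definition grouping_cost :: "nat \<Rightarrow> (nat \<Rightarrow> 'l \<Rightarrow> point) \<Rightarrow> 'l selection set \<Rightarrow> real" where
  "grouping_cost N p G = (\<Sum>s\<in>G. sel_cost N p s)"

lemma sel_sum_None: "sel_sum N p f (\<lambda>_. None) = 0"
  by (simp add: sel_sum_def)

lemma sel_cost_None: "sel_cost N p (\<lambda>_. None) = 0"
  by (simp add: sel_cost_def sel_sum_None)

lemma finite_selections:
  assumes "\<forall>i<N. finite (L i)"
  shows "finite {s. is_selection N L s}"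
proof (rule finite_subset)
  show "{s. is_selection N L s} \<subseteq> {s. s ` {..<N} \<subseteq> (\<Union>i<N. insert None (Some ` L i))
      \<and> s ` (- {..<N}) \<subseteq> {None}}"
    by (auto simp: is_selection_def image_subset_iff)
  have "finite {s. \<forall>x. (x \<in> {..<N} \<longrightarrow> s x \<in> (\<Union>i<N. insert None (Some ` L i))) \<and> (x \<notin> {..<N} \<longrightarrow> s x = None)}"
    using assms by (intro finite_set_of_finite_funs) auto
  then show "finite {s. s ` {..<N} \<subseteq> (\<Union>i<N. insert None (Some ` L i)) \<and> s ` (- {..<N}) \<subseteq> {None}}"
    by (rule finite_subset[rotated]) (auto simp: image_subset_iff)
qed

lemma finite_grouping:
  assumes "\<forall>i<N. finite (L i)" "is_grouping N L G"
  shows "finite G"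
  using assms(2) by (intro finite_subset[OF _ finite_selections[OF assms(1)]]) (auto simp: is_grouping_def)

lemma finite_groupings:
  assumes "\<forall>i<N. finite (L i)"
  shows "finite {G. is_grouping N L G}"
  by (rule finite_subset[of _ "Pow {s. is_selection N L s}"])
     (use finite_selections[OF assms] in \<open>auto simp: is_grouping_def\<close>)

lemma selection_obtain:
  assumes "is_selection N L s" "s \<noteq> (\<lambda>_. None)"
  obtains i l where "i < N" "s i = Some l" "l \<in> L i"
proof -
  obtain i where i: "s i \<noteq> None" using assms(2) by (meson ext)
  then have "i < N" using assms(1) by (auto simp: is_selection_def not_le[symmetric])
  then show ?thesis using assms(1) i that by (fastforce simp: is_selection_def)
qed

lemma selection_SomeD: "is_selection N L s \<Longrightarrow> s i = Some l \<Longrightarrow> i < N \<and> l \<in> L i"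
  by (cases "i < N") (force simp: is_selection_def)+

lemma grouping_obtain:
  assumes "is_grouping N L G" "s \<in> G"
  obtains i l where "i < N" "s i = Some l" "l \<in> L i"
  using assms selection_obtain[of N L s] by (auto simp: is_grouping_def)

lemma grouping_ex: "is_grouping N L G \<Longrightarrow> i < N \<Longrightarrow> l \<in> L i \<Longrightarrow> \<exists>s\<in>G. s i = Some l"
  unfolding is_grouping_def by blast

lemma grouping_unique:
  assumes "is_grouping N L G" "s \<in> G" "t \<in> G" "s i = Some l" "t i = Some l"
  shows "s = t"
proof -
  have "i < N" "l \<in> L i"
    using assms selection_SomeD[of N L s i l] by (auto simp: is_grouping_def)
  then show ?thesis using assms unfolding is_grouping_def by blast
qed

text \<open>A selection of \<open>H\<close> holds some label, the selection of \<open>G\<close> with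
  this label also lies in \<open>H\<close>, and labels are used once. In the uniqueness proof one
  inclusion is therefore enough.\<close>

lemma grouping_subset_eq:
  assumes "is_grouping N L G" "is_grouping N L H" "G \<subseteq> H"
  shows "G = H"
proof (intro equalityI assms(3) subsetI)
  fix s assume "s \<in> H"
  then obtain i l where il: "i < N" "s i = Some l" "l \<in> L i" using grouping_obtain assms(2) by metis
  then obtain t where "t \<in> G" "t i = Some l" using grouping_ex[OF assms(1)] by blast
  then show "s \<in> G" using grouping_unique[OF assms(2) \<open>s \<in> H\<close>] il assms(3) by auto
qed

lemma is_selection_trivial: "i < N \<Longrightarrow> l \<in> L i \<Longrightarrow> is_selection N L (trivial_selection i l)"
  by (auto simp: is_selection_def trivial_selection_def)

lemma trivial_selection_neq_None: "trivial_selection i l \<noteq> (\<lambda>_. None)"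
  by (auto simp: trivial_selection_def fun_eq_iff)

lemma trivial_selection_eq_Some: "trivial_selection i l j = Some k \<longleftrightarrow> j = i \<and> k = l"
  by (auto simp: trivial_selection_def)

lemma is_grouping_trivial: "is_grouping N L {trivial_selection i l |i l. i < N \<and> l \<in> L i}"
  unfolding is_grouping_def
  by (auto simp: is_selection_trivial trivial_selection_neq_None trivial_selection_eq_Some
      intro!: ex1I)

text \<open>A tuple of matchings of one diagram \<open>Z\<close> with the \<open>D i\<close> induces a grouping, in which every
  point of \<open>Z\<close> contributes the selection of its partners.\<close>

lemma ex_grouping_of_matchings:
  assumes N: "N \<ge> 1" and lab: "\<forall>i<N. labels (D i) (L i) (\<alpha> i) (p i)"
    and \<phi>: "\<And>i. i < N \<Longrightarrow> \<phi> i \<in> matchings Z (D i)"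
  shows "\<exists>H. is_grouping N L H \<and> (\<forall>z\<in>points Z. \<exists>s\<in>insert (\<lambda>_. None) H.
    ennreal (grouping_cost N p H + real N / 2 * (hgt (fst z) - sel_sum N p hgt s / real N)\<^sup>2)
      \<le> (\<Sum>i<N. match_cost (\<phi> i) (points Z)))"
proof -
  define S where "S z = (\<lambda>i. if i < N \<and> \<phi> i z \<in> off_points (D i)
    then Some (inv_into (L i) (\<alpha> i) (\<phi> i z)) else None)" for z
  have \<alpha>: "bij_betw (\<alpha> i) (L i) (off_points (D i))" "\<And>l. l \<in> L i \<Longrightarrow> fst (\<alpha> i l) = p i l"
    and fin: "finite (L i)" and pts: "points (D i) = off_points (D i) \<union> diagonal \<times> UNIV"
    if "i < N" for i
    using lab[rule_format, OF that] by (auto simp: labels_def points_eq)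
  have bij: "bij_betw (\<phi> i) (points Z) (points (D i))" if "i < N" for i
    using \<phi>[OF that] by (simp add: matchings_def)
  have S_Some: "S z i = Some l \<longleftrightarrow> i < N \<and> l \<in> L i \<and> \<phi> i z = \<alpha> i l" for z i l
    using \<alpha>(1)[of i] unfolding S_def bij_betw_def
    by (auto simp: f_inv_into_f inv_into_into)
  define Z' where "Z' = {z \<in> points Z. S z \<noteq> (\<lambda>_. None)}"
  define H where "H = S ` Z'"
  have injS: "z = z'" if "z \<in> points Z" "z' \<in> points Z" "S z i = Some l" "S z' i = Some l" for z z' i l
    using that bij[of i] by (auto simp: S_Some bij_betw_def inj_on_def)
  have "inj_on S Z'"
  proof (rule inj_onI)
    fix z z' assume z: "z \<in> Z'" "z' \<in> Z'" "S z = S z'"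
    then obtain i l where "S z i = Some l" by (auto simp: Z'_def fun_eq_iff)
    then show "z = z'" using injS[of z z' i l] z by (auto simp: Z'_def)
  qed
  have finZ: "finite Z'"
  proof (rule finite_subset)
    show "Z' \<subseteq> (\<Union>i<N. {z \<in> points Z. \<phi> i z \<in> off_points (D i)})"
      by (auto simp: Z'_def S_def fun_eq_iff split: if_splits)
    have "finite {z \<in> points Z. \<phi> i z \<in> off_points (D i)}" if "i < N" for i
    proof (rule finite_imageD)
      have "finite (off_points (D i))" using \<alpha>(1) fin that bij_betw_finite by blast
      then show "finite (\<phi> i ` {z \<in> points Z. \<phi> i z \<in> off_points (D i)})"
        by (rule finite_subset[rotated]) auto
      show "inj_on (\<phi> i) {z \<in> points Z. \<phi> i z \<in> off_points (D i)}"
        using bij[OF that] by (auto simp: bij_betw_def inj_on_def)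
    qed
    then show "finite (\<Union>i<N. {z \<in> points Z. \<phi> i z \<in> off_points (D i)})" by auto
  qed
  have H: "is_grouping N L H"
    unfolding is_grouping_def
  proof (intro conjI ballI allI impI)
    fix s assume "s \<in> H"
    then obtain z where z: "z \<in> Z'" "s = S z" by (auto simp: H_def)
    show "is_selection N L s"
      unfolding is_selection_def z(2)
    proof (intro conjI allI impI)
      show "S z i \<in> insert None (Some ` L i)" if "i < N" for i
        using S_Some[of z i] by (cases "S z i") auto
      show "S z i = None" if "i \<ge> N" for i using that by (simp add: S_def)
    qed
    show "s \<noteq> (\<lambda>_. None)" using z by (auto simp: Z'_def)
  next
    fix i l assume il: "i < N" "l \<in> L i"
    have "\<alpha> i l \<in> points (D i)" using \<alpha>(1)[OF il(1)] il(2) pts[OF il(1)] by (auto simp: bij_betw_def)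
    then have "\<alpha> i l \<in> \<phi> i ` points Z" using bij[OF il(1)] by (simp add: bij_betw_def)
    then obtain z where z: "z \<in> points Z" "\<phi> i z = \<alpha> i l" by (metis imageE)
    then have Sz: "S z i = Some l" using il by (simp add: S_Some)
    then have "z \<in> Z'" using z by (auto simp: Z'_def)
    show "\<exists>!s. s \<in> H \<and> s i = Some l"
    proof (rule ex1I[of _ "S z"])
      show "S z \<in> H \<and> S z i = Some l" using \<open>z \<in> Z'\<close> Sz by (auto simp: H_def)
      show "t = S z" if "t \<in> H \<and> t i = Some l" for t
        using that injS[OF z(1) _ Sz] by (auto simp: H_def Z'_def)
    qed
  qed
  have dist: "sel_dist N p (S z) (fst z) \<le> (\<Sum>i<N. (norm (fst z - fst (\<phi> i z)))\<^sup>2)"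
    if z: "z \<in> points Z" for z
    unfolding sel_dist_def
  proof (rule sum_mono)
    fix i assume "i \<in> {..<N}"
    then have i: "i < N" by simp
    show "(case S z i of None \<Rightarrow> (hgt (fst z))\<^sup>2 / 2 | Some l \<Rightarrow> (norm (fst z - p i l))\<^sup>2)
        \<le> (norm (fst z - fst (\<phi> i z)))\<^sup>2"
    proof (cases "S z i")
      case None
      then have "\<phi> i z \<notin> off_points (D i)" using i by (auto simp: S_def split: if_splits)
      then have "\<phi> i z \<in> diagonal \<times> UNIV"
        using bij_betw_apply[OF bij[OF i] z] unfolding pts[OF i] by blast
      then have "fst (\<phi> i z) \<in> diagonal" by auto
      from norm_diagonal_sq_ge[OF this] show ?thesis using None by simp
    next
      case (Some l)
      then have "l \<in> L i" "\<phi> i z = \<alpha> i l" by (simp_all add: S_Some)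
      then show ?thesis using Some \<alpha>(2)[OF i] by simp
    qed
  qed
  show ?thesis
  proof (intro exI[of _ H] conjI H ballI)
    fix z0 assume z0: "z0 \<in> points Z"
    let ?x = "real N / 2 * (hgt (fst z0) - sel_sum N p hgt (S z0) / real N)\<^sup>2"
    \<comment> \<open>The point \<open>z0\<close> may have the empty selection and then lies outside
      \<open>Z'\<close>. Its selection cost is 0, so adding it leaves the cost of \<open>H\<close>
      unchanged while its height defect can still be charged.\<close>
    let ?T = "insert z0 Z'"
    have T: "finite ?T" "?T \<subseteq> points Z" using finZ z0 by (auto simp: Z'_def)
    have "grouping_cost N p H = (\<Sum>z\<in>Z'. sel_cost N p (S z))"
      unfolding grouping_cost_def H_def by (rule sum.reindex_cong[OF \<open>inj_on S Z'\<close>]) auto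
    also have "\<dots> = (\<Sum>z\<in>?T. sel_cost N p (S z))"
      using T z0 by (intro sum.mono_neutral_left) (auto simp: Z'_def sel_cost_None)
    finally have "grouping_cost N p H + ?x = (\<Sum>z\<in>?T. sel_cost N p (S z) + (if z = z0 then ?x else 0))"
      using finZ by (simp add: sum.distrib sum.delta' del: sum.insert)
    also have "\<dots> \<le> (\<Sum>z\<in>?T. \<Sum>i<N. (norm (fst z - fst (\<phi> i z)))\<^sup>2)"
    proof (rule sum_mono)
      fix z assume z: "z \<in> ?T"
      have "sel_cost N p (S z) + (if z = z0 then ?x else 0)
        \<le> sel_cost N p (S z) + real N / 2 * (hgt (fst z) - sel_sum N p hgt (S z) / real N)\<^sup>2"
        by auto
      also note sel_dist_ge[OF N]
      also have "sel_dist N p (S z) (fst z) \<le> (\<Sum>i<N. (norm (fst z - fst (\<phi> i z)))\<^sup>2)"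
        using z T by (intro dist) auto
      finally show "sel_cost N p (S z) + (if z = z0 then ?x else 0)
        \<le> (\<Sum>i<N. (norm (fst z - fst (\<phi> i z)))\<^sup>2)" .
    qed
    also have "\<dots> = (\<Sum>i<N. \<Sum>z\<in>?T. (norm (fst z - fst (\<phi> i z)))\<^sup>2)" by (rule sum.swap)
    finally have "ennreal (grouping_cost N p H + ?x)
        \<le> ennreal (\<Sum>i<N. \<Sum>z\<in>?T. (norm (fst z - fst (\<phi> i z)))\<^sup>2)"
      by (rule ennreal_leI)
    also have "\<dots> = (\<Sum>i<N. \<Sum>z\<in>?T. ennreal ((norm (fst z - fst (\<phi> i z)))\<^sup>2))"
      by (simp add: sum_ennreal sum_nonneg del: sum.insert)
    also have "\<dots> \<le> (\<Sum>i<N. match_cost (\<phi> i) (points Z))"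
      using T by (intro sum_mono sum_le_match_cost)
    finally have "ennreal (grouping_cost N p H + ?x) \<le> (\<Sum>i<N. match_cost (\<phi> i) (points Z))" .
    moreover have "S z0 \<in> insert (\<lambda>_. None) H" using z0 by (auto simp: H_def Z'_def)
    ultimately show "\<exists>s\<in>insert (\<lambda>_. None) H.
      ennreal (grouping_cost N p H + real N / 2 * (hgt (fst z0) - sel_sum N p hgt s / real N)\<^sup>2)
      \<le> (\<Sum>i<N. match_cost (\<phi> i) (points Z))" by blast
  qed
qed

lemma ex_grouping_frechet:
  assumes N: "N \<ge> 1" and lab: "\<forall>i<N. labels (D i) (L i) (\<alpha> i) (p i)"
    and fin: "frechet N D Z < \<infinity>" and e: "e > 0"
  shows "\<exists>H. is_grouping N L H \<and> (\<forall>z\<in>points Z. \<exists>s\<in>insert (\<lambda>_. None) H.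
    ennreal (grouping_cost N p H + real N / 2 * (hgt (fst z) - sel_sum N p hgt s / real N)\<^sup>2)
      \<le> frechet N D Z + ennreal e)"
proof -
  have "\<exists>\<phi>\<in>matchings Z (D i). match_cost \<phi> (points Z) \<le> (W2 Z (D i))\<^sup>2 + ennreal (e / N)" if i: "i < N" for i
  proof -
    have "(W2 Z (D i))\<^sup>2 \<le> frechet N D Z"
      unfolding frechet_def using i by (intro member_le_sum) auto
    then have "(W2 Z (D i))\<^sup>2 < \<infinity>" using fin by (rule le_less_trans)
    moreover have "e / N > 0" using e N by simp
    moreover have "x < x + ennreal b" if "x < \<infinity>" "b > 0" for x b
      using that by (cases x) (auto simp: ennreal_plus[symmetric] ennreal_less_iff simp del: ennreal_plus)
    ultimately have "(W2 Z (D i))\<^sup>2 < (W2 Z (D i))\<^sup>2 + ennreal (e / N)" by blast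
    from W2_sq_less_obtain[OF this] show ?thesis by (metis less_imp_le)
  qed
  then obtain \<phi> where \<phi>: "\<And>i. i < N \<Longrightarrow> \<phi> i \<in> matchings Z (D i)"
    "\<And>i. i < N \<Longrightarrow> match_cost (\<phi> i) (points Z) \<le> (W2 Z (D i))\<^sup>2 + ennreal (e / N)"
    by metis
  have "(\<Sum>i<N. match_cost (\<phi> i) (points Z)) \<le> (\<Sum>i<N. (W2 Z (D i))\<^sup>2 + ennreal (e / N))"
    using \<phi>(2) by (intro sum_mono) simp
  also have "\<dots> = frechet N D Z + ennreal e"
    using N e by (simp add: frechet_def sum.distrib ennreal_of_nat_eq_real_of_nat ennreal_mult'[symmetric])
  finally have "(\<Sum>i<N. match_cost (\<phi> i) (points Z)) \<le> frechet N D Z + ennreal e" .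
  then show ?thesis
    using ex_grouping_of_matchings[of N D L \<alpha> p \<phi> Z, OF N lab \<phi>(1)] by (meson order_trans)
qed

section \<open>Mean diagrams of groupings and their Frechet values\<close>

definition above :: "nat \<Rightarrow> (nat \<Rightarrow> 'l set) \<Rightarrow> (nat \<Rightarrow> 'l \<Rightarrow> point) \<Rightarrow> bool" where
  "above N L p \<longleftrightarrow> (\<forall>i<N. \<forall>l\<in>L i. 0 < hgt (p i l))"

lemma hgt_mean_pt_pos:
  assumes "above N L p" "is_selection N L s" "s \<noteq> (\<lambda>_. None)"
  shows "0 < hgt (mean_pt N p s)"
proof -
  obtain i l where il: "i < N" "s i = Some l" "l \<in> L i" using assms(2,3) by (rule selection_obtain)
  have "0 < sel_sum N p hgt s"
    unfolding sel_sum_def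
  proof (rule sum_pos2[of _ i])
    show "0 < (case s i of None \<Rightarrow> 0 | Some l \<Rightarrow> hgt (p i l))" using assms(1) il by (auto simp: above_def)
    show "0 \<le> (case s i of None \<Rightarrow> 0 | Some l \<Rightarrow> hgt (p i l))" if "i \<in> {..<N}" for i
      using assms(1) that selection_SomeD[OF assms(2), of i]
      by (auto simp: above_def less_imp_le split: option.splits)
  qed (use il in auto)
  then show ?thesis using il by (simp add: hgt_mean_pt)
qed

lemma grouping_mean_eq:
  assumes "N \<ge> 1" "\<forall>i<N. finite (L i)" "is_grouping N L G"
  shows "grouping_mean N p G = diagram_of_mset (image_mset (mean_pt N p) (mset_set G))"
proof -
  have "selection_mean N p s = mean_pt N p s" if "s \<in> G" for s
    using grouping_obtain[OF assms(3) that] selection_mean_eq[OF assms(1)] by (metis option.distinct(1))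
  then have "image_mset (selection_mean N p) (mset_set G) = image_mset (mean_pt N p) (mset_set G)"
    using finite_grouping[OF assms(2,3)] by (intro image_mset_cong) auto
  then show ?thesis by (simp add: grouping_mean_def)
qed

lemma ex_labels_grouping_mean:
  assumes "N \<ge> 1" "\<forall>i<N. finite (L i)" "is_grouping N L G" "above N L p"
  shows "\<exists>\<mu>. labels (grouping_mean N p G) G \<mu> (mean_pt N p)"
proof -
  have "mean_pt N p s \<notin> diagonal" if "s \<in> G" for s
    using hgt_mean_pt_pos[OF assms(4), of s] assms(3) that
    by (auto simp: mem_diagonal_iff is_grouping_def)
  then show ?thesis
    using ex_labels_mset[OF finite_grouping[OF assms(2,3)], of "mean_pt N p"]
      grouping_mean_eq[OF assms(1-3), of p] by simp
qed

lemma grouping_mean_diagrams: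
  assumes "N \<ge> 1" "\<forall>i<N. finite (L i)" "is_grouping N L G" "above N L p"
  shows "grouping_mean N p G \<in> diagrams"
proof -
  have fin: "finite G" using finite_grouping[OF assms(2,3)] .
  have pos: "0 < hgt (mean_pt N p s)" if "s \<in> G" for s
    using hgt_mean_pt_pos[OF assms(4), of s] assms(3) that by (auto simp: is_grouping_def)
  have "{x. x \<notin> diagonal \<and> grouping_mean N p G x \<noteq> 0} \<subseteq> mean_pt N p ` G"
    using fin by (auto simp: grouping_mean_eq[OF assms(1-3)] diagram_of_mset_def zero_enat_def split: if_splits)
  then have "countable {x. x \<notin> diagonal \<and> grouping_mean N p G x \<noteq> 0}"
    using fin by (meson countable_finite finite_imageI finite_subset)
  moreover have "grouping_mean N p G (b, d) = 0" if "d < b" for b d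
  proof -
    have "(b, d) \<notin> mean_pt N p ` G"
    proof
      assume "(b, d) \<in> mean_pt N p ` G"
      then obtain s where "s \<in> G" "mean_pt N p s = (b, d)" by (metis imageE)
      then show False using pos[of s] that by (simp add: hgt_def)
    qed
    moreover have "(b, d) \<notin> diagonal" using that by (simp add: mem_diagonal_iff hgt_def)
    ultimately show ?thesis
      using fin by (simp add: grouping_mean_eq[OF assms(1-3)] diagram_of_mset_def zero_enat_def count_eq_zero_iff)
  qed
  ultimately show ?thesis
    by (simp add: diagrams_def) (simp add: grouping_mean_eq[OF assms(1-3)] diagram_of_mset_def)
qed

text \<open>The mean of \<open>s\<close> is matched with entry \<open>i\<close> of \<open>s\<close>,
  or with the diagonal if that entry is \<open>None\<close>; exchanging the sums over
  \<open>i\<close> and \<open>s\<close> gives the cost. It is only an inequality, as other matchings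
  of the mean diagram might be cheaper.\<close>

lemma frechet_grouping_mean_le:
  assumes N: "N \<ge> 1" and lab: "\<forall>i<N. labels (D i) (L i) (\<alpha> i) (p i)"
    and G: "is_grouping N L G" and ab: "above N L p"
  shows "frechet N D (grouping_mean N p G) \<le> ennreal (grouping_cost N p G)"
proof -
  have fin: "\<forall>i<N. finite (L i)" using lab by (auto simp: labels_def)
  have finG: "finite G" using finite_grouping[OF fin G] .
  obtain \<mu> where \<mu>: "labels (grouping_mean N p G) G \<mu> (mean_pt N p)"
    using ex_labels_grouping_mean[OF N fin G ab] by blast
  let ?m = "mean_pt N p"
  have "(W2 (grouping_mean N p G) (D i))\<^sup>2 \<le> ennreal
      (\<Sum>s\<in>G. case s i of None \<Rightarrow> (hgt (?m s))\<^sup>2 / 2 | Some l \<Rightarrow> (norm (?m s - p i l))\<^sup>2)" if i: "i < N" for i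
  proof -
    \<comment> \<open>Every label of \<open>L i\<close> occurs in some selection, so on this side
      nothing is left over; leftover means are those of selections with \<open>None\<close> at
      \<open>i\<close>.\<close>
    let ?R = "{(s, l). s \<in> G \<and> s i = Some l}"
    let ?G1 = "{s \<in> G. s i \<noteq> None}"
    have R_eq: "?R = (\<lambda>s. (s, the (s i))) ` ?G1" by force
    have "l \<in> L i" if "s \<in> G" "s i = Some l" for s l
      using selection_SomeD[of N L s i l] G that by (auto simp: is_grouping_def)
    then have "?R \<subseteq> G \<times> L i" by auto
    moreover have "inj_on fst ?R" "inj_on snd ?R"
      using grouping_unique[OF G] by (auto simp: inj_on_def)
    ultimately have pm: "?R \<in> pmatch G (L i)" by (simp add: pmatch_def)
    have f: "fst ` ?R = ?G1" by force
    have s: "snd ` ?R = L i"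
      using \<open>?R \<subseteq> G \<times> L i\<close> grouping_ex[OF G i] by force
    have "(\<Sum>(a, b)\<in>?R. (norm (?m a - p i b))\<^sup>2) = (\<Sum>s\<in>?G1. (norm (?m s - p i (the (s i))))\<^sup>2)"
      unfolding R_eq by (subst sum.reindex) (auto simp: inj_on_def)
    also have "\<dots> = (\<Sum>s\<in>?G1. case s i of None \<Rightarrow> (hgt (?m s))\<^sup>2 / 2 | Some l \<Rightarrow> (norm (?m s - p i l))\<^sup>2)"
      by (intro sum.cong) auto
    moreover have "(\<Sum>s\<in>G - ?G1. (hgt (?m s))\<^sup>2 / 2)
        = (\<Sum>s\<in>G - ?G1. case s i of None \<Rightarrow> (hgt (?m s))\<^sup>2 / 2 | Some l \<Rightarrow> (norm (?m s - p i l))\<^sup>2)"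
      by (intro sum.cong) auto
    ultimately have "pm_cost G ?m (L i) (p i) ?R
        = (\<Sum>s\<in>G. case s i of None \<Rightarrow> (hgt (?m s))\<^sup>2 / 2 | Some l \<Rightarrow> (norm (?m s - p i l))\<^sup>2)"
      unfolding pm_cost_def f s using finG
      by (simp add: sum.subset_diff[of ?G1 G])
    then show ?thesis using W2_sq_le_pm_cost[OF \<mu> lab[rule_format, OF i] pm] by simp
  qed
  then have "frechet N D (grouping_mean N p G) \<le> (\<Sum>i<N. ennreal
      (\<Sum>s\<in>G. case s i of None \<Rightarrow> (hgt (?m s))\<^sup>2 / 2 | Some l \<Rightarrow> (norm (?m s - p i l))\<^sup>2))"
    unfolding frechet_def by (intro sum_mono) simp
  also have "\<dots> = ennreal (\<Sum>i<N.
      (\<Sum>s\<in>G. case s i of None \<Rightarrow> (hgt (?m s))\<^sup>2 / 2 | Some l \<Rightarrow> (norm (?m s - p i l))\<^sup>2))"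
    by (rule sum_ennreal) (auto intro!: sum_nonneg split: option.splits)
  also have "(\<Sum>i<N. (\<Sum>s\<in>G. case s i of None \<Rightarrow> (hgt (?m s))\<^sup>2 / 2 | Some l \<Rightarrow> (norm (?m s - p i l))\<^sup>2))
      = (\<Sum>s\<in>G. sel_dist N p s (?m s))"
    unfolding sel_dist_def by (rule sum.swap)
  also have "\<dots> = grouping_cost N p G"
    by (simp add: grouping_cost_def sel_dist_mean_pt[OF N])
  finally show ?thesis .
qed

definition label_diagram :: "(nat \<Rightarrow> 'l set) \<Rightarrow> (nat \<Rightarrow> 'l \<Rightarrow> point) \<Rightarrow> nat \<Rightarrow> diagram" where
  "label_diagram L p = (\<lambda>i. diagram_of_mset (image_mset (p i) (mset_set (L i))))"

lemma ex_labels_label_diagram: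
  assumes "\<forall>i<N. finite (L i)" "above N L p"
  shows "\<exists>\<alpha>. \<forall>i<N. labels (label_diagram L p i) (L i) (\<alpha> i) (p i)"
proof -
  have "\<exists>\<alpha>. labels (label_diagram L p i) (L i) \<alpha> (p i)" if "i < N" for i
    unfolding label_diagram_def using assms that
    by (intro ex_labels_mset) (fastforce simp: above_def mem_diagonal_iff)+
  then show ?thesis by metis
qed

text \<open>Minimality among all diagrams is reduced to finitely many inequalities. Any better
  \<open>Z\<close> would induce a grouping whose cost, up to slack, is below the Frechet value of
  the mean of \<open>H\<close>; conversely costs dominate the Frechet values of means.\<close>

lemma optimal_grouping_iff:
  assumes N: "N \<ge> 1" and fin: "\<forall>i<N. finite (L i)" and ab: "above N L p"
  shows "optimal_grouping N L p H \<longleftrightarrow> is_grouping N L H \<and>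
    (\<forall>H'. is_grouping N L H' \<longrightarrow>
      frechet N (label_diagram L p) (grouping_mean N p H) \<le> ennreal (grouping_cost N p H'))"
proof -
  let ?F = "frechet N (label_diagram L p)"
  obtain \<alpha> where lab: "\<forall>i<N. labels (label_diagram L p i) (L i) (\<alpha> i) (p i)"
    using ex_labels_label_diagram[OF fin ab] by blast
  have adm: "grouping_mean N p G \<in> diagrams \<and> W2 (grouping_mean N p G) empty_diagram < \<infinity>"
    if "is_grouping N L G" for G
    using grouping_mean_diagrams[OF N fin that ab] ex_labels_grouping_mean[OF N fin that ab]
      W2_finite[OF _ labels_empty_diagram] by blast
  have 1: "\<exists>H'. is_grouping N L H' \<and> \<not> ?F (grouping_mean N p H) \<le> ennreal (grouping_cost N p H')"
    if H: "is_grouping N L H" and Z: "Z \<in> diagrams" "?F Z < ?F (grouping_mean N p H)" for Z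
  proof -
    have "?F (grouping_mean N p H) < \<infinity>"
      using frechet_grouping_mean_le[where D = "label_diagram L p", OF N lab H ab]
      unfolding infinity_ennreal_def by (rule le_less_trans[OF _ ennreal_less_top])
    then obtain b where b: "?F (grouping_mean N p H) = ennreal b" "b \<ge> 0"
      by (cases "?F (grouping_mean N p H)") auto
    then obtain a where a: "?F Z = ennreal a" "a \<ge> 0"
      using Z(2) by (cases "?F Z") auto
    have "a < b" using Z(2) a b by (simp add: ennreal_less_iff)
    \<comment> \<open>Slack of half the gap b - a keeps the cost of the induced grouping strictly
      below b.\<close>
    then obtain H' where H': "is_grouping N L H'" and le: "\<forall>z\<in>points Z. \<exists>s\<in>insert (\<lambda>_. None) H'.
        ennreal (grouping_cost N p H' + real N / 2 * (hgt (fst z) - sel_sum N p hgt s / real N)\<^sup>2)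
          \<le> ?F Z + ennreal ((b - a) / 2)"
      using ex_grouping_frechet[where D = "label_diagram L p" and Z = Z and e = "(b - a) / 2", OF N lab] a
      by auto
    \<comment> \<open>The bound for \<open>H'\<close> is stated pointwise in \<open>Z\<close>; the
      origin is a diagonal point and thus always available, and its height defect is then
      dropped.\<close>
    have "((0, 0), 0) \<in> points Z"
      using Z(1) by (auto simp: points_def diagrams_def mem_diagonal_iff hgt_def)
    with le obtain s where "ennreal (grouping_cost N p H' + real N / 2 * (hgt (0, 0) - sel_sum N p hgt s / real N)\<^sup>2)
          \<le> ?F Z + ennreal ((b - a) / 2)"
      by force
    moreover have "ennreal (grouping_cost N p H')
        \<le> ennreal (grouping_cost N p H' + real N / 2 * (hgt (0, 0) - sel_sum N p hgt s / real N)\<^sup>2)"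
      by (rule ennreal_leI) simp
    ultimately have "ennreal (grouping_cost N p H') \<le> ennreal a + ennreal ((b - a) / 2)"
      using a by simp
    also have "\<dots> = ennreal (a + (b - a) / 2)"
      using a \<open>a < b\<close> by (simp add: ennreal_plus)
    also have "\<dots> < ennreal b" using a \<open>a < b\<close> by (simp add: ennreal_less_iff field_simps)
    finally show ?thesis using H' b by (auto simp: not_le)
  qed
  have 2: "?F (grouping_mean N p H) \<le> ennreal (grouping_cost N p H')"
    if "is_arg_min ?F (\<lambda>Z. Z \<in> diagrams \<and> W2 Z empty_diagram < \<infinity>) (grouping_mean N p H)"
      "is_grouping N L H'" for H'
  proof -
    have "?F (grouping_mean N p H) \<le> ?F (grouping_mean N p H')"
      using that adm[OF that(2)] by (auto simp: is_arg_min_def not_less)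
    also have "\<dots> \<le> ennreal (grouping_cost N p H')"
      using frechet_grouping_mean_le[where D = "label_diagram L p", OF N lab that(2) ab] .
    finally show ?thesis .
  qed
  show ?thesis
    unfolding optimal_grouping_def label_diagram_def[symmetric]
    using 1 2 adm by (auto simp: is_arg_min_def)
qed

text \<open>Distinct costs isolate the cheapest grouping; distinct height sums recover a selection
  from its mean. The all-\<open>None\<close> selection is included among the \<open>s\<close> and
  \<open>t\<close>, so the height of a mean also tells a proper selection from the empty
  one.\<close>

definition generic :: "nat \<Rightarrow> (nat \<Rightarrow> 'l set) \<Rightarrow> (nat \<Rightarrow> 'l \<Rightarrow> point) \<Rightarrow> bool" where
  "generic N L p \<longleftrightarrow>
     (\<forall>s t. is_selection N L s \<and> is_selection N L t \<and> s \<noteq> t \<longrightarrow> sel_sum N p hgt s \<noteq> sel_sum N p hgt t) \<and>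
     (\<forall>G H. is_grouping N L G \<and> is_grouping N L H \<and> G \<noteq> H \<longrightarrow> grouping_cost N p G \<noteq> grouping_cost N p H)"

lemma finite_pos_lower_bound:
  assumes "finite A"
  shows "\<exists>e>0. \<forall>x\<in>A. x > 0 \<longrightarrow> e < (x :: real)"
proof -
  let ?B = "insert 1 {x \<in> A. x > 0}"
  have B: "finite ?B" "?B \<noteq> {}" using assms by auto
  have "Min ?B > 0" using Min_in[OF B] by auto
  moreover have "Min ?B / 2 < x" if "x \<in> A" "x > 0" for x
    using Min_le[OF B(1), of x] \<open>Min ?B > 0\<close> that by auto
  ultimately show ?thesis by (intro exI[of _ "Min ?B / 2"]) auto
qed

text \<open>The grouping \<open>H0\<close> of least cost is the only candidate. Matchings of the
  mean of an optimal \<open>H\<close> that are optimal up to e induce a grouping costing at most e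
  more than \<open>H0\<close>, which for small e is \<open>H0\<close> itself. The height term then
  forces each mean of \<open>H\<close> to have the height belonging to a selection of
  \<open>H0\<close> or to the empty one, and distinct height sums place the selection in
  \<open>H0\<close>.\<close>

lemma unique_optimal_grouping:
  assumes N: "N \<ge> 1" and fin: "\<forall>i<N. finite (L i)" and ab: "above N L p"
    and gen: "generic N L p"
  shows "\<exists>H0. \<forall>H. optimal_grouping N L p H \<longleftrightarrow> H = H0"
proof -
  let ?F = "frechet N (label_diagram L p)" and ?c = "grouping_cost N p"
  obtain \<alpha> where lab: "\<forall>i<N. labels (label_diagram L p i) (L i) (\<alpha> i) (p i)"
    using ex_labels_label_diagram[OF fin ab] by blast
  note le = frechet_grouping_mean_le[where D = "label_diagram L p", OF N lab _ ab]
  have "finite {G. is_grouping N L G}" using finite_groupings[of N L] fin by blast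
  moreover have "{G. is_grouping N L G} \<noteq> {}" using is_grouping_trivial by auto
  ultimately obtain H0 where H0: "is_grouping N L H0" "\<And>H. is_grouping N L H \<Longrightarrow> ?c H0 \<le> ?c H"
    using ex_is_arg_min_if_finite[of "{G. is_grouping N L G}" ?c] by (auto simp: is_arg_min_linorder)
  have "H = H0" if opt: "optimal_grouping N L p H" for H
  proof -
    have H: "is_grouping N L H" and FH: "?F (grouping_mean N p H) \<le> ennreal (?c H0)"
      using opt H0(1) unfolding optimal_grouping_iff[OF N fin ab] by auto
    obtain \<mu> where \<mu>: "labels (grouping_mean N p H) H \<mu> (mean_pt N p)"
      using ex_labels_grouping_mean[OF N fin H ab] by blast
    have c0: "?c H0 \<ge> 0" unfolding grouping_cost_def using sel_cost_nonneg[OF N] by (intro sum_nonneg)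
    have "h \<in> H0" if h: "h \<in> H" for h
    proof -
      let ?x = "\<lambda>s. real N / 2 * (hgt (mean_pt N p h) - sel_sum N p hgt s / real N)\<^sup>2"
      \<comment> \<open>The quantities that e must undercut when positive: the cost gaps to
        \<open>H0\<close>, and the height defects of \<open>h\<close> against the selections of
        \<open>H0\<close> and the empty one. There are finitely many.\<close>
      let ?A = "(\<lambda>H. ?c H - ?c H0) ` {G. is_grouping N L G} \<union> ?x ` insert (\<lambda>_. None) H0"
      have "finite ?A" using finite_groupings[OF fin] finite_grouping[OF fin H0(1)] by auto
      then obtain e where e: "e > 0" "\<And>x. x \<in> ?A \<Longrightarrow> x > 0 \<Longrightarrow> e < x"
        using finite_pos_lower_bound by metis
      have "?F (grouping_mean N p H) < \<infinity>" using FH unfolding infinity_ennreal_def by (rule le_less_trans[OF _ ennreal_less_top])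
      then obtain H' where H': "is_grouping N L H'"
        and *: "\<And>z. z \<in> points (grouping_mean N p H) \<Longrightarrow> \<exists>s\<in>insert (\<lambda>_. None) H'.
        ennreal (?c H' + real N / 2 * (hgt (fst z) - sel_sum N p hgt s / real N)\<^sup>2)
          \<le> ?F (grouping_mean N p H) + ennreal e"
        using ex_grouping_frechet[where D = "label_diagram L p", OF N lab _ e(1)] by blast
      have \<mu>h: "\<mu> h \<in> points (grouping_mean N p H)" "fst (\<mu> h) = mean_pt N p h"
        using \<mu> h by (auto simp: labels_def points_eq bij_betw_def)
      then obtain s where s: "s \<in> insert (\<lambda>_. None) H'"
        "ennreal (?c H' + ?x s) \<le> ?F (grouping_mean N p H) + ennreal e"
        using *[OF \<mu>h(1)] unfolding \<mu>h(2) by blast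
      note s(2)
      also have "?F (grouping_mean N p H) + ennreal e \<le> ennreal (?c H0) + ennreal e"
        using FH by (rule add_right_mono)
      also have "\<dots> = ennreal (?c H0 + e)" using c0 e(1) by (simp add: ennreal_plus)
      finally have le': "?c H' + ?x s \<le> ?c H0 + e"
        using c0 e(1) by (subst (asm) ennreal_le_iff) auto
      have x0: "?x s \<ge> 0" by simp
      have "H' = H0"
      proof (rule ccontr)
        assume "H' \<noteq> H0"
        then have "?c H' \<noteq> ?c H0" using gen H' H0(1) by (auto simp: generic_def)
        then have "?c H' - ?c H0 > 0" using H0(2)[OF H'] by simp
        moreover have "?c H' - ?c H0 \<in> ?A" using H' by (intro UnI1 imageI) simp
        ultimately have "e < ?c H' - ?c H0" using e(2) by blast
        then show False using le' x0 by linarith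
      qed
      then have s': "s \<in> insert (\<lambda>_. None) H0" "?x s \<le> e" using s(1) le' by simp_all
      have "?x s \<in> ?A" using s'(1) by (intro UnI2 imageI)
      then have "\<not> ?x s > 0" using e(2) s'(2) by (meson not_le)
      then have "?x s = 0" using x0 by linarith
      then have "hgt (mean_pt N p h) = sel_sum N p hgt s / real N" using N by simp
      then have "sel_sum N p hgt h = sel_sum N p hgt s" using N by (simp add: hgt_mean_pt)
      moreover have "is_selection N L h" "h \<noteq> (\<lambda>_. None)" using h H by (auto simp: is_grouping_def)
      moreover have "is_selection N L s" using s' H0(1) by (auto simp: is_grouping_def is_selection_def)
      ultimately have "h = s" using gen unfolding generic_def by blast
      then show "h \<in> H0" using s' \<open>h \<noteq> (\<lambda>_. None)\<close> by auto
    qed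
    then show "H = H0" using grouping_subset_eq[OF H H0(1)] by auto
  qed
  moreover have "optimal_grouping N L p H0"
    unfolding optimal_grouping_iff[OF N fin ab]
    using H0(1) order_trans[OF le[OF H0(1)] ennreal_leI[OF H0(2)]] by blast
  ultimately show ?thesis by blast
qed

section \<open>The perturbation of a point\<close>

abbreviation option_borel :: "point option measure" where
  "option_borel \<equiv> sigma UNIV {A. Some -` A \<in> sets borel}"

lemma sigma_algebra_option: "sigma_algebra UNIV {A. Some -` A \<in> sets (borel :: point measure)}"
  unfolding sigma_algebra_iff2
proof (intro conjI ballI allI impI)
  show "UNIV - A \<in> {A. Some -` A \<in> sets (borel :: point measure)}"
    if "A \<in> {A. Some -` A \<in> sets borel}" for A
    using that by (auto simp: vimage_Diff)
  show "\<Union> (range A) \<in> {A. Some -` A \<in> sets (borel :: point measure)}"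
    if "range A \<subseteq> {A. Some -` A \<in> sets borel}" for A :: "nat \<Rightarrow> point option set"
    using that by (auto simp: vimage_UN)
qed auto

lemma sets_option_borel: "sets option_borel = {A. Some -` A \<in> sets borel}"
  using sigma_algebra.sets_measure_of_eq[OF sigma_algebra_option] .

lemma space_option_borel: "space option_borel = UNIV"
  by (simp add: space_measure_of_conv)

lemma sets_perturbation [measurable_cong, simp]: "sets (perturbation \<alpha> x) = sets option_borel"
  unfolding perturbation_def Let_def sets_option_borel
  by (rule sigma_algebra.sets_measure_of_eq[OF sigma_algebra_option])

lemma space_perturbation [simp]: "space (perturbation \<alpha> x) = UNIV"
  using sets_eq_imp_space_eq[OF sets_perturbation] by (simp add: space_measure_of_conv)

lemma measurable_Some [measurable]: "Some \<in> borel \<rightarrow>\<^sub>M option_borel"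
  by (rule measurableI) (auto simp: sets_option_borel)

lemma measurable_the [measurable]: "the \<in> option_borel \<rightarrow>\<^sub>M borel"
  by (rule measurableI) (auto simp: sets_option_borel space_option_borel vimage_comp comp_def)

lemma pred_eq_None [measurable]: "Measurable.pred option_borel (\<lambda>z. z = None)"
proof -
  have "{z \<in> space option_borel. z = None} = {None}" by (auto simp: space_option_borel)
  moreover have "Some -` {None} = ({} :: point set)" by auto
  ultimately show ?thesis
    unfolding pred_def by (simp add: sets_option_borel)
qed

lemma pred_option [measurable (raw)]:
  assumes "f \<in> M \<rightarrow>\<^sub>M option_borel"
  shows "Measurable.pred M (\<lambda>z. f z = None)"
  using measurable_compose[OF assms pred_eq_None] .

abbreviation radius :: "real \<Rightarrow> point \<Rightarrow> real" where
  "radius \<alpha> x \<equiv> min \<alpha> (infdist x diagonal)"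

text \<open>Realizes the perturbation by one uniform draw \<open>z\<close> from the disk of radius
  \<alpha>: inside radius r it translates the point, in the remaining annulus it drops it. The
  annulus has relative area (\<alpha>^2 - r^2) / \<alpha>^2, the mass of the atom.\<close>

definition shift :: "real \<Rightarrow> point \<Rightarrow> point \<Rightarrow> point option" where
  "shift r x z = (if norm z < r then Some (x + z) else None)"

lemma measurable_shift [measurable]: "shift r x \<in> borel \<rightarrow>\<^sub>M option_borel"
  unfolding shift_def by measurable

lemma measurable_ball_plane [measurable]: "ball (c :: point) r \<in> sets borel"
  by simp

lemma emeasure_ball_plane:
  "0 \<le> r \<Longrightarrow> emeasure lborel (ball (c :: point) r) = ennreal (pi * r\<^sup>2)"
  by (simp add: emeasure_ball unit_ball_vol_2 power2_eq_square)

lemma nn_integral_shift: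
  assumes \<alpha>: "\<alpha> > 0" and r: "0 \<le> r" "r \<le> \<alpha>" and f [measurable]: "f \<in> borel_measurable option_borel"
  shows "(\<integral>\<^sup>+z. f (shift r x z) \<partial>uniform_measure lborel (ball 0 \<alpha>))
    = ennreal (1 / (pi * \<alpha>\<^sup>2)) * (\<integral>\<^sup>+y. f (Some y) * indicator (ball x r) y \<partial>lborel)
      + ennreal ((\<alpha>\<^sup>2 - r\<^sup>2) / \<alpha>\<^sup>2) * f None"
proof -
  have [measurable]: "(\<lambda>y. f (Some y)) \<in> borel_measurable borel"
    using measurable_compose[OF measurable_Some f] .
  have [measurable]: "(\<lambda>z. f (Some (x + z))) \<in> borel_measurable borel"
    by measurable
  have sub: "ball (0 :: point) r \<subseteq> ball 0 \<alpha>" using r by auto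
  have "(\<integral>\<^sup>+z. f (shift r x z) * indicator (ball 0 \<alpha>) z \<partial>lborel)
    = (\<integral>\<^sup>+z. f (Some (x + z)) * indicator (ball 0 r) z + f None * indicator (ball 0 \<alpha> - ball 0 r) z \<partial>lborel)"
    using sub r by (intro nn_integral_cong) (auto simp: shift_def split: split_indicator)
  also have "\<dots> = (\<integral>\<^sup>+z. f (Some (x + z)) * indicator (ball 0 r) z \<partial>lborel)
      + f None * emeasure lborel (ball (0 :: point) \<alpha> - ball 0 r)"
    by (subst nn_integral_add) (measurable, simp add: nn_integral_cmult_indicator[of "ball 0 \<alpha> - ball 0 r" lborel])
  also have "(\<integral>\<^sup>+z. f (Some (x + z)) * indicator (ball 0 r) z \<partial>lborel)
      = (\<integral>\<^sup>+z. f (Some (x + z)) * indicator (ball x r) (x + z) \<partial>lborel)"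
    by (intro nn_integral_cong) (auto simp: dist_norm split: split_indicator)
  also have "\<dots> = (\<integral>\<^sup>+y. f (Some y) * indicator (ball x r) y \<partial>distr lborel borel ((+) x))"
    by (subst nn_integral_distr) auto
  also have "\<dots> = (\<integral>\<^sup>+y. f (Some y) * indicator (ball x r) y \<partial>lborel)"
    by (simp add: lborel_distr_plus)
  also have "emeasure lborel (ball (0 :: point) \<alpha> - ball 0 r) = ennreal (pi * \<alpha>\<^sup>2) - ennreal (pi * r\<^sup>2)"
    using sub r \<alpha> by (subst emeasure_Diff) (auto simp: emeasure_ball_plane)
  also have "\<dots> = ennreal (pi * (\<alpha>\<^sup>2 - r\<^sup>2))"
    using r by (subst ennreal_minus) (auto simp: algebra_simps)
  finally have *: "(\<integral>\<^sup>+z. f (shift r x z) * indicator (ball 0 \<alpha>) z \<partial>lborel)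
    = (\<integral>\<^sup>+y. f (Some y) * indicator (ball x r) y \<partial>lborel) + f None * ennreal (pi * (\<alpha>\<^sup>2 - r\<^sup>2))" .
  have c: "a / ennreal (pi * \<alpha>\<^sup>2) = ennreal (1 / (pi * \<alpha>\<^sup>2)) * a" for a
    using \<alpha> by (simp add: divide_ennreal_def inverse_ennreal mult.commute inverse_eq_divide)
  have d: "ennreal (1 / (pi * \<alpha>\<^sup>2)) * ennreal (pi * (\<alpha>\<^sup>2 - r\<^sup>2)) = ennreal ((\<alpha>\<^sup>2 - r\<^sup>2) / \<alpha>\<^sup>2)"
    using \<alpha> r by (simp add: ennreal_mult[symmetric] power_mono)
  have "(\<integral>\<^sup>+z. f (shift r x z) \<partial>uniform_measure lborel (ball 0 \<alpha>))
      = (\<integral>\<^sup>+z. f (shift r x z) * indicator (ball 0 \<alpha>) z \<partial>lborel) / ennreal (pi * \<alpha>\<^sup>2)"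
    using \<alpha> by (subst nn_integral_uniform_measure) (auto simp: emeasure_ball_plane)
  also have "\<dots> = ennreal (1 / (pi * \<alpha>\<^sup>2)) * (\<integral>\<^sup>+y. f (Some y) * indicator (ball x r) y \<partial>lborel)
      + ennreal (1 / (pi * \<alpha>\<^sup>2)) * ennreal (pi * (\<alpha>\<^sup>2 - r\<^sup>2)) * f None"
    unfolding * c by (simp add: distrib_left mult_ac)
  finally show ?thesis unfolding d .
qed

lemma radius_nonneg: "\<alpha> > 0 \<Longrightarrow> 0 \<le> radius \<alpha> x"
  by (simp add: infdist_nonneg)

lemma radius_le: "radius \<alpha> x \<le> \<alpha>"
  by simp

text \<open>\<open>measure_of\<close> yields the zero measure unless its function is countably
  additive. Agreement with an image measure supplies additivity, and the total mass 1 follows at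
  once.\<close>

lemma perturbation_eq_distr:
  assumes "\<alpha> > 0"
  shows "perturbation \<alpha> x
    = distr (uniform_measure lborel (ball 0 \<alpha>)) option_borel (shift (radius \<alpha> x) x)"
    (is "_ = ?D")
proof -
  have meas: "shift (radius \<alpha> x) x \<in> uniform_measure lborel (ball 0 \<alpha>) \<rightarrow>\<^sub>M option_borel"
    by measurable
  have "emeasure ?D A = ennreal (1 / (pi * \<alpha>\<^sup>2)) * emeasure lborel (Some -` A \<inter> ball x (radius \<alpha> x))
      + ennreal ((\<alpha>\<^sup>2 - (radius \<alpha> x)\<^sup>2) / \<alpha>\<^sup>2) * indicator A None" if A: "A \<in> sets option_borel" for A
  proof -
    have [measurable]: "Some -` A \<in> sets borel" using A by (simp add: sets_option_borel)
    have "emeasure ?D A = (\<integral>\<^sup>+z. indicator A z \<partial>?D)"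
      using A by (subst nn_integral_indicator) simp_all
    also have "\<dots> = (\<integral>\<^sup>+z. indicator A (shift (radius \<alpha> x) x z) \<partial>uniform_measure lborel (ball 0 \<alpha>))"
      using A by (intro nn_integral_distr meas borel_measurable_indicator) simp
    also have "\<dots> = ennreal (1 / (pi * \<alpha>\<^sup>2))
        * (\<integral>\<^sup>+y. indicator A (Some y) * indicator (ball x (radius \<alpha> x)) y \<partial>lborel)
      + ennreal ((\<alpha>\<^sup>2 - (radius \<alpha> x)\<^sup>2) / \<alpha>\<^sup>2) * indicator A None"
      using A by (intro nn_integral_shift radius_nonneg radius_le assms borel_measurable_indicator)
    also have "(\<integral>\<^sup>+y. indicator A (Some y) * indicator (ball x (radius \<alpha> x)) y \<partial>lborel)
        = (\<integral>\<^sup>+y. indicator (Some -` A \<inter> ball x (radius \<alpha> x)) y \<partial>lborel)"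
      by (intro nn_integral_cong) (auto split: split_indicator)
    also have "\<dots> = emeasure lborel (Some -` A \<inter> ball x (radius \<alpha> x))"
      by (intro nn_integral_indicator) simp
    finally show ?thesis .
  qed
  then have "perturbation \<alpha> x = measure_of UNIV {A. Some -` A \<in> sets borel} (emeasure ?D)"
    unfolding perturbation_def Let_def
    by (intro measure_of_eq) (auto simp: sigma_algebra.sigma_sets_eq[OF sigma_algebra_option] sets_option_borel)
  also have "\<dots> = ?D"
    using measure_of_of_measure[of ?D] by (simp add: space_option_borel sets_option_borel)
  finally show ?thesis .
qed

lemma prob_space_perturbation:
  assumes "\<alpha> > 0"
  shows "prob_space (perturbation \<alpha> x)"
  unfolding perturbation_eq_distr[OF assms]
proof (rule prob_space.prob_space_distr)
  show "prob_space (uniform_measure lborel (ball (0 :: point) \<alpha>))"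
    using assms by (intro prob_space_uniform_measure) (auto simp: emeasure_ball_plane)
qed measurable

lemma nn_integral_perturbation:
  assumes "\<alpha> > 0" and f: "f \<in> borel_measurable option_borel"
  shows "(\<integral>\<^sup>+z. f z \<partial>perturbation \<alpha> x)
    = ennreal (1 / (pi * \<alpha>\<^sup>2)) * (\<integral>\<^sup>+y. f (Some y) * indicator (ball x (radius \<alpha> x)) y \<partial>lborel)
      + ennreal ((\<alpha>\<^sup>2 - (radius \<alpha> x)\<^sup>2) / \<alpha>\<^sup>2) * f None"
  unfolding perturbation_eq_distr[OF assms(1)]
  by (subst nn_integral_distr) (use f in \<open>auto intro!: nn_integral_shift radius_nonneg radius_le assms simp del: min_less_iff_conj min.bounded_iff\<close>)

lemma sets_not_None: "{z. z \<noteq> None} \<in> sets option_borel"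
proof -
  have "Some -` {z. z \<noteq> None} = (UNIV :: point set)" by auto
  then show ?thesis by (simp add: sets_option_borel)
qed

text \<open>Survival means hitting the disk of radius r inside that of radius \<alpha>, a ratio of
  areas. This makes points near the diagonal negligible.\<close>

lemma emeasure_perturbation_Some:
  assumes "\<alpha> > 0"
  shows "emeasure (perturbation \<alpha> x) {z. z \<noteq> None} \<le> ennreal ((infdist x diagonal)\<^sup>2 / \<alpha>\<^sup>2)"
proof -
  let ?r = "radius \<alpha> x"
  note m = sets_not_None
  have "emeasure (perturbation \<alpha> x) {z. z \<noteq> None} = (\<integral>\<^sup>+z. indicator {z. z \<noteq> None} z \<partial>perturbation \<alpha> x)"
    using m by (subst nn_integral_indicator) simp_all
  also have "\<dots> = ennreal (1 / (pi * \<alpha>\<^sup>2)) * (\<integral>\<^sup>+y. indicator (ball x ?r) y \<partial>lborel)"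
    using m by (subst nn_integral_perturbation[OF assms]) (auto intro!: borel_measurable_indicator)
  also have "\<dots> = ennreal (1 / (pi * \<alpha>\<^sup>2)) * ennreal (pi * ?r\<^sup>2)"
    using radius_nonneg[OF assms] by (simp add: emeasure_ball_plane del: min_less_iff_conj)
  also have "\<dots> = ennreal (?r\<^sup>2 / \<alpha>\<^sup>2)"
    by (simp add: ennreal_mult'[symmetric])
  also have "\<dots> \<le> ennreal ((infdist x diagonal)\<^sup>2 / \<alpha>\<^sup>2)"
    using radius_nonneg[OF assms, of x] by (intro ennreal_leI divide_right_mono power_mono) auto
  finally show ?thesis .
qed

text \<open>Apart from the atom the law has a density supported in a ball around \<open>x\<close>,
  so Lebesgue null sets do not matter. The ball in the premise contains this support for every
  \<alpha>.\<close>

lemma AE_perturbation: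
  assumes \<alpha>: "\<alpha> > 0" and P [measurable]: "Measurable.pred option_borel P"
    and "P None" and AE: "AE y in lborel. y \<in> ball x (infdist x diagonal) \<longrightarrow> P (Some y)"
  shows "AE z in perturbation \<alpha> x. P z"
proof -
  let ?A = "{z \<in> space option_borel. \<not> P z}"
  have A: "?A \<in> sets option_borel" by measurable
  have "emeasure (perturbation \<alpha> x) ?A = (\<integral>\<^sup>+z. indicator ?A z \<partial>perturbation \<alpha> x)"
    using A by (subst nn_integral_indicator) simp_all
  also have "\<dots> = ennreal (1 / (pi * \<alpha>\<^sup>2)) * (\<integral>\<^sup>+y. indicator ?A (Some y) * indicator (ball x (radius \<alpha> x)) y \<partial>lborel)"
    using A \<open>P None\<close> by (subst nn_integral_perturbation[OF \<alpha>]) (auto intro!: borel_measurable_indicator)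
  also have "(\<integral>\<^sup>+y. indicator ?A (Some y) * indicator (ball x (radius \<alpha> x)) y \<partial>lborel) = (\<integral>\<^sup>+(y::point). 0 \<partial>lborel)"
    using AE by (intro nn_integral_cong_AE) (auto elim!: eventually_mono split: split_indicator)
  finally have "emeasure (perturbation \<alpha> x) ?A = 0" by simp
  moreover have "{z \<in> space (perturbation \<alpha> x). \<not> P z} = ?A" by (simp add: space_option_borel)
  ultimately show ?thesis using A by (subst AE_iff_measurable[of ?A]) auto
qed

text \<open>The ball around \<open>x\<close> of radius r - 2 e lies in the ball around
  \<open>y\<close>: one e pays for the distance of the centres, the other for the difference of the
  radii. What remains is an annulus of area at most 4 pi e r. If r is at most 2 e, the whole ball is
  small enough.\<close>

lemma emeasure_ball_diff_le:
  fixes x y :: point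
  assumes "0 \<le> r" "r \<le> \<alpha>" "0 \<le> r'" "norm (x - y) \<le> e" "r \<le> r' + e"
  shows "emeasure lborel (ball x r - ball y r') \<le> ennreal (4 * pi * e * \<alpha>)"
proof -
  have e: "e \<ge> 0" using assms(4) norm_ge_zero order_trans by blast
  show ?thesis
  proof (cases "r \<le> 2 * e")
    case True
    have "emeasure lborel (ball x r - ball y r') \<le> emeasure lborel (ball x r)"
      by (intro emeasure_mono) auto
    also have "\<dots> = ennreal (pi * r\<^sup>2)" using assms by (intro emeasure_ball_plane)
    also have "\<dots> \<le> ennreal (4 * pi * e * \<alpha>)"
    proof (intro ennreal_leI)
      have "r * r \<le> (2 * e) * \<alpha>" using True assms e by (intro mult_mono) auto
      also have "\<dots> \<le> 4 * e * \<alpha>" using assms e by (intro mult_right_mono) auto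
      finally show "pi * r\<^sup>2 \<le> 4 * pi * e * \<alpha>" by (simp add: power2_eq_square)
    qed
    finally show ?thesis .
  next
    case False
    have sub: "ball x (r - 2 * e) \<subseteq> ball y r'"
    proof
      fix z assume "z \<in> ball x (r - 2 * e)"
      moreover have "dist y z \<le> dist y x + dist x z" by (rule dist_triangle)
      moreover have "dist y x \<le> e" using assms(4) by (simp add: dist_norm norm_minus_commute)
      ultimately show "z \<in> ball y r'" using assms(5) by auto
    qed
    have "emeasure lborel (ball x r - ball y r') \<le> emeasure lborel (ball x r - ball x (r - 2 * e))"
      using sub by (intro emeasure_mono) auto
    also have "\<dots> = ennreal (pi * r\<^sup>2) - ennreal (pi * (r - 2 * e)\<^sup>2)"
      using False e assms by (subst emeasure_Diff) (auto simp: emeasure_ball_plane subset_ball)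
    also have "\<dots> = ennreal (pi * r\<^sup>2 - pi * (r - 2 * e)\<^sup>2)"
      by (rule ennreal_minus) simp
    also have "\<dots> \<le> ennreal (4 * pi * e * \<alpha>)"
    proof (intro ennreal_leI)
      have "r\<^sup>2 - (r - 2 * e)\<^sup>2 \<le> 4 * e * r" by (simp add: power2_eq_square algebra_simps)
      also have "\<dots> \<le> 4 * e * \<alpha>" using e assms by (intro mult_left_mono) auto
      finally have "pi * (r\<^sup>2 - (r - 2 * e)\<^sup>2) \<le> pi * (4 * e * \<alpha>)" by (intro mult_left_mono) auto
      then show "pi * r\<^sup>2 - pi * (r - 2 * e)\<^sup>2 \<le> 4 * pi * e * \<alpha>" by (simp add: algebra_simps)
    qed
    finally show ?thesis .
  qed
qed

text \<open>Closeness in total variation, phrased with test functions bounded by 1 so that it passes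
  to products. The constant is 4 + 2: the area bound divided by pi \<alpha>^2 gives 4 e / \<alpha>,
  and the atoms differ by at most (s^2 - r^2) / \<alpha>^2, hence by 2 e / \<alpha>.\<close>

lemma nn_integral_perturbation_close:
  assumes \<alpha>: "\<alpha> > 0" and f [measurable]: "f \<in> borel_measurable option_borel" and f1: "\<And>z. f z \<le> 1"
    and e: "norm (x - y) \<le> e"
  shows "(\<integral>\<^sup>+z. f z \<partial>perturbation \<alpha> x) \<le> (\<integral>\<^sup>+z. f z \<partial>perturbation \<alpha> y) + ennreal (6 * e / \<alpha>)"
proof -
  let ?r = "radius \<alpha> x" and ?s = "radius \<alpha> y"
  have [measurable]: "(\<lambda>y. f (Some y)) \<in> borel_measurable borel"
    using measurable_compose[OF measurable_Some f] .
  have e0: "e \<ge> 0" using e norm_ge_zero order_trans by blast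
  have rs: "0 \<le> ?r" "?r \<le> \<alpha>" "0 \<le> ?s" "?s \<le> \<alpha>" using radius_nonneg[OF \<alpha>] by auto
  have le: "?r \<le> ?s + e" "?s \<le> ?r + e"
    using infdist_triangle[of x diagonal y] infdist_triangle[of y diagonal x] e e0
    by (auto simp: dist_norm norm_minus_commute)
  let ?I = "\<lambda>B. \<integral>\<^sup>+z. f (Some z) * indicator B z \<partial>lborel"
  have "?I (ball x ?r) \<le> (\<integral>\<^sup>+z. f (Some z) * indicator (ball y ?s) z + indicator (ball x ?r - ball y ?s) z \<partial>lborel)"
    using f1 by (intro nn_integral_mono) (auto split: split_indicator)
  also have "\<dots> = ?I (ball y ?s) + emeasure lborel (ball x ?r - ball y ?s)"
    by (subst nn_integral_add) auto
  also have "\<dots> \<le> ?I (ball y ?s) + ennreal (4 * pi * e * \<alpha>)"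
    using rs e le by (intro add_left_mono emeasure_ball_diff_le)
  finally have "ennreal (1 / (pi * \<alpha>\<^sup>2)) * ?I (ball x ?r)
      \<le> ennreal (1 / (pi * \<alpha>\<^sup>2)) * (?I (ball y ?s) + ennreal (4 * pi * e * \<alpha>))"
    by (rule mult_left_mono) simp
  also have "\<dots> = ennreal (1 / (pi * \<alpha>\<^sup>2)) * ?I (ball y ?s) + ennreal (4 * e / \<alpha>)"
  proof -
    have "ennreal (1 / (pi * \<alpha>\<^sup>2)) * ennreal (4 * pi * e * \<alpha>) = ennreal (1 / (pi * \<alpha>\<^sup>2) * (4 * pi * e * \<alpha>))"
      using \<alpha> e0 by (intro ennreal_mult[symmetric]) auto
    also have "1 / (pi * \<alpha>\<^sup>2) * (4 * pi * e * \<alpha>) = 4 * e / \<alpha>"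
      using \<alpha> by (simp add: power2_eq_square)
    finally show ?thesis by (simp add: distrib_left)
  qed
  finally have 1: "ennreal (1 / (pi * \<alpha>\<^sup>2)) * ?I (ball x ?r)
      \<le> ennreal (1 / (pi * \<alpha>\<^sup>2)) * ?I (ball y ?s) + ennreal (4 * e / \<alpha>)" .
  have "ennreal ((\<alpha>\<^sup>2 - ?r\<^sup>2) / \<alpha>\<^sup>2) \<le> ennreal ((\<alpha>\<^sup>2 - ?s\<^sup>2) / \<alpha>\<^sup>2 + 2 * e / \<alpha>)"
  proof (rule ennreal_leI)
    have "?s\<^sup>2 - ?r\<^sup>2 = (?s - ?r) * (?s + ?r)" by (simp add: power2_eq_square algebra_simps)
    also have "\<dots> \<le> e * (2 * \<alpha>)"
    proof (cases "?s \<le> ?r")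
      case True
      then have "(?s - ?r) * (?s + ?r) \<le> 0" using rs by (intro mult_nonpos_nonneg) auto
      also have "0 \<le> e * (2 * \<alpha>)" using e0 \<alpha> by simp
      finally show ?thesis .
    next
      case False
      then show ?thesis using rs le e0 by (intro mult_mono) auto
    qed
    finally have "(\<alpha>\<^sup>2 - ?r\<^sup>2) / \<alpha>\<^sup>2 \<le> (\<alpha>\<^sup>2 - ?s\<^sup>2 + e * (2 * \<alpha>)) / \<alpha>\<^sup>2"
      by (intro divide_right_mono) auto
    also have "\<dots> = (\<alpha>\<^sup>2 - ?s\<^sup>2) / \<alpha>\<^sup>2 + 2 * e / \<alpha>"
      using \<alpha> by (simp add: add_divide_distrib power2_eq_square)
    finally show "(\<alpha>\<^sup>2 - ?r\<^sup>2) / \<alpha>\<^sup>2 \<le> (\<alpha>\<^sup>2 - ?s\<^sup>2) / \<alpha>\<^sup>2 + 2 * e / \<alpha>" .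
  qed
  also have "\<dots> = ennreal ((\<alpha>\<^sup>2 - ?s\<^sup>2) / \<alpha>\<^sup>2) + ennreal (2 * e / \<alpha>)"
    using rs \<alpha> e0 by (intro ennreal_plus) (auto simp: power_mono)
  finally have "ennreal ((\<alpha>\<^sup>2 - ?r\<^sup>2) / \<alpha>\<^sup>2) * f None
      \<le> (ennreal ((\<alpha>\<^sup>2 - ?s\<^sup>2) / \<alpha>\<^sup>2) + ennreal (2 * e / \<alpha>)) * f None"
    by (rule mult_right_mono) simp
  also have "\<dots> \<le> ennreal ((\<alpha>\<^sup>2 - ?s\<^sup>2) / \<alpha>\<^sup>2) * f None + ennreal (2 * e / \<alpha>)"
    using mult_left_mono[OF f1, of "ennreal (2 * e / \<alpha>)" None] by (simp add: distrib_right add_left_mono)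
  finally have 2: "ennreal ((\<alpha>\<^sup>2 - ?r\<^sup>2) / \<alpha>\<^sup>2) * f None
      \<le> ennreal ((\<alpha>\<^sup>2 - ?s\<^sup>2) / \<alpha>\<^sup>2) * f None + ennreal (2 * e / \<alpha>)" .
  have "ennreal (4 * e / \<alpha>) + ennreal (2 * e / \<alpha>) = ennreal (6 * e / \<alpha>)"
    using \<alpha> e0 by (subst ennreal_plus[symmetric]) (auto simp: add_divide_distrib[symmetric])
  moreover have "a + c \<le> b + d + (u + v)" if "a \<le> b + u" "c \<le> d + v" for a b c d u v :: ennreal
    using add_mono[OF that] by (simp add: add_ac)
  from this[OF 1 2] have "ennreal (1 / (pi * \<alpha>\<^sup>2)) * ?I (ball x ?r) + ennreal ((\<alpha>\<^sup>2 - ?r\<^sup>2) / \<alpha>\<^sup>2) * f None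
    \<le> ennreal (1 / (pi * \<alpha>\<^sup>2)) * ?I (ball y ?s) + ennreal ((\<alpha>\<^sup>2 - ?s\<^sup>2) / \<alpha>\<^sup>2) * f None
      + (ennreal (4 * e / \<alpha>) + ennreal (2 * e / \<alpha>))" .
  ultimately show ?thesis
    unfolding nn_integral_perturbation[OF \<alpha> f] by simp
qed

section \<open>Finite products of probability measures\<close>

text \<open>The factors are exchanged one at a time. Integrating out one coordinate against
  \<open>M' i\<close> leaves a function bounded by 1 in the others, to which the induction
  hypothesis applies, so the errors add up.\<close>

lemma nn_integral_PiM_close:
  fixes M M' :: "'i \<Rightarrow> 'a measure"
  assumes prob: "\<And>i. prob_space (M i)" "\<And>i. prob_space (M' i)"
    and sets: "\<And>i. sets (M' i) = sets (M i)"
    and close: "\<And>i f. i \<in> J \<Longrightarrow> f \<in> borel_measurable (M i) \<Longrightarrow> (\<And>z. f z \<le> 1) \<Longrightarrow>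
      (\<integral>\<^sup>+z. f z \<partial>M i) \<le> (\<integral>\<^sup>+z. f z \<partial>M' i) + \<delta> i"
    and "finite J" "f \<in> borel_measurable (PiM J M)" "\<And>x. f x \<le> 1"
  shows "(\<integral>\<^sup>+x. f x \<partial>PiM J M) \<le> (\<integral>\<^sup>+x. f x \<partial>PiM J M') + sum \<delta> J"
  using assms(5,4,6,7)
proof (induction J arbitrary: f rule: finite_induct)
  case empty
  then show ?case by (simp add: PiM_empty nn_integral_count_space_finite)
next
  case (insert i J)
  interpret M: product_sigma_finite M
    using prob(1) by (auto simp: product_sigma_finite_def intro: prob_space_imp_sigma_finite)
  interpret M': product_sigma_finite M'
    using prob(2) by (auto simp: product_sigma_finite_def intro: prob_space_imp_sigma_finite)
  interpret MJ: prob_space "PiM J M" by (rule prob_space_PiM[OF prob(1)])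
  interpret Mi': prob_space "M' i" by (rule prob(2))
  have sets_J: "sets (PiM J M') = sets (PiM J M)" for J
    using sets by (intro sets_PiM_cong) auto
  note f [measurable] = insert.prems(2)
  have f' [measurable]: "f \<in> borel_measurable (PiM (insert i J) M')"
    using f measurable_cong_sets[OF sets_J refl] by blast
  have [measurable_cong]: "sets (M' i) = sets (M i)" by (rule sets)
  let ?g = "\<lambda>x. \<integral>\<^sup>+y. f (x(i := y)) \<partial>M' i"
  have g: "?g \<in> borel_measurable (PiM J M)"
    by measurable
  have g1: "?g x \<le> 1" for x
  proof -
    have "?g x \<le> (\<integral>\<^sup>+y. 1 \<partial>M' i)" by (intro nn_integral_mono insert.prems)
    then show ?thesis by (simp add: Mi'.emeasure_space_1)
  qed
  have "(\<integral>\<^sup>+x. f x \<partial>PiM (insert i J) M) = (\<integral>\<^sup>+x. (\<integral>\<^sup>+y. f (x(i := y)) \<partial>M i) \<partial>PiM J M)"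
    using insert by (intro M.product_nn_integral_insert) auto
  also have "\<dots> \<le> (\<integral>\<^sup>+x. ?g x + \<delta> i \<partial>PiM J M)"
    using insert.prems by (intro nn_integral_mono insert.prems(1)) auto
  also have "\<dots> = (\<integral>\<^sup>+x. ?g x \<partial>PiM J M) + \<delta> i"
    using g by (subst nn_integral_add) (auto simp: MJ.emeasure_space_1)
  also have "\<dots> \<le> (\<integral>\<^sup>+x. ?g x \<partial>PiM J M') + sum \<delta> J + \<delta> i"
    by (intro add_right_mono insert.IH[OF _ g g1]) (rule insert.prems(1), auto)
  also have "(\<integral>\<^sup>+x. ?g x \<partial>PiM J M') = (\<integral>\<^sup>+x. f x \<partial>PiM (insert i J) M')"
    using insert f' by (intro M'.product_nn_integral_insert[symmetric]) auto
  finally show ?case using insert.hyps by (simp add: add_ac)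
qed

text \<open>Fubini with coordinate \<open>j\<close> integrated first: almost sure statements can be
  proved by moving a single point.\<close>

lemma AE_PiM_coordinate:
  fixes M :: "'i \<Rightarrow> 'a measure"
  assumes prob: "\<And>i. prob_space (M i)" and J: "finite J" "j \<in> J"
    and P [measurable]: "Measurable.pred (PiM J M) P"
    and AE: "\<And>x. x \<in> space (PiM (J - {j}) M) \<Longrightarrow> (AE z in M j. P (x(j := z)))"
  shows "AE x in PiM J M. P x"
proof -
  interpret M: product_sigma_finite M
    using prob by (auto simp: product_sigma_finite_def intro: prob_space_imp_sigma_finite)
  let ?A = "{x \<in> space (PiM J M). \<not> P x}"
  have ins: "insert j (J - {j}) = J" using J by auto
  have "emeasure (PiM J M) ?A = (\<integral>\<^sup>+x. indicator ?A x \<partial>PiM (insert j (J - {j})) M)"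
    unfolding ins by (rule nn_integral_indicator[symmetric]) measurable
  also have "\<dots> = (\<integral>\<^sup>+x. (\<integral>\<^sup>+z. indicator ?A (x(j := z)) \<partial>M j) \<partial>PiM (J - {j}) M)"
  proof (rule M.product_nn_integral_insert)
    show "indicator ?A \<in> borel_measurable (PiM (insert j (J - {j})) M)"
      unfolding ins by measurable
  qed (use J in auto)
  also have "\<dots> = (\<integral>\<^sup>+x. 0 \<partial>PiM (J - {j}) M)"
  proof (rule nn_integral_cong)
    fix x assume x: "x \<in> space (PiM (J - {j}) M)"
    have "(\<integral>\<^sup>+z. indicator ?A (x(j := z)) \<partial>M j) = (\<integral>\<^sup>+z. 0 \<partial>M j)"
      using AE[OF x] by (intro nn_integral_cong_AE) (auto elim!: eventually_mono)
    then show "(\<integral>\<^sup>+z. indicator ?A (x(j := z)) \<partial>M j) = 0" by simp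
  qed
  finally have "emeasure (PiM J M) ?A = 0" by simp
  then show ?thesis by (subst AE_iff_measurable[of ?A]) auto
qed

section \<open>Relabeling\<close>

text \<open>Labels contain positions, so nearby diagrams have different labels, and groupings must
  be carried along injections \<open>e i\<close> of the label sets.\<close>

definition relabel :: "(nat \<Rightarrow> 'l \<Rightarrow> 'm) \<Rightarrow> 'l selection \<Rightarrow> 'm selection" where
  "relabel e s = (\<lambda>i. map_option (e i) (s i))"

lemma relabel_eq_None_iff: "relabel e s = (\<lambda>_. None) \<longleftrightarrow> s = (\<lambda>_. None)"
  by (auto simp: relabel_def fun_eq_iff)

lemma relabel_Some: "relabel e s i = Some m \<longleftrightarrow> (\<exists>l. s i = Some l \<and> m = e i l)"
  by (auto simp: relabel_def)

lemma is_selection_relabel: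
  "is_selection N L s \<Longrightarrow> is_selection N (\<lambda>i. e i ` L i) (relabel e s)"
  by (fastforce simp: is_selection_def relabel_def)

lemma relabel_inj:
  assumes e: "\<forall>i<N. inj_on (e i) (L i)" and s: "is_selection N L s" "is_selection N L t"
    and eq: "relabel e s = relabel e t"
  shows "s = t"
proof
  fix i
  have "map_option (e i) (s i) = map_option (e i) (t i)"
    using fun_cong[OF eq, of i] by (simp add: relabel_def)
  then show "s i = t i"
    using selection_SomeD[OF s(1), of i] selection_SomeD[OF s(2), of i] e
    by (cases "s i"; cases "t i") (auto simp: inj_on_def)
qed

lemma ex_relabel:
  assumes e: "\<forall>i<N. L' i = e i ` L i" and t: "is_selection N L' t"
  shows "\<exists>s. is_selection N L s \<and> relabel e s = t"
proof -
  have "\<exists>m. (i < N \<longrightarrow> m \<in> insert None (Some ` L i)) \<and> (i \<ge> N \<longrightarrow> m = None) \<and> map_option (e i) m = t i" for i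
  proof (cases "t i")
    case None
    then show ?thesis by (intro exI[of _ None]) auto
  next
    case (Some m)
    then have "i < N" "m \<in> e i ` L i" using selection_SomeD[OF t Some] e by auto
    then obtain l where "l \<in> L i" "m = e i l" by blast
    then show ?thesis using Some \<open>i < N\<close> by (intro exI[of _ "Some l"]) auto
  qed
  then obtain s where "\<And>i. (i < N \<longrightarrow> s i \<in> insert None (Some ` L i)) \<and> (i \<ge> N \<longrightarrow> s i = None) \<and> map_option (e i) (s i) = t i"
    by metis
  then show ?thesis by (intro exI[of _ s]) (auto simp: is_selection_def relabel_def fun_eq_iff)
qed

lemma is_grouping_cong:
  assumes "\<forall>i<N. L i = L' i"
  shows "is_grouping N L G \<longleftrightarrow> is_grouping N L' G"
  unfolding is_grouping_def is_selection_def using assms by simp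

lemma is_grouping_relabel:
  assumes e: "\<forall>i<N. inj_on (e i) (L i)" "\<forall>i<N. L' i = e i ` L i" and sel: "\<forall>s\<in>G. is_selection N L s"
  shows "is_grouping N L' (relabel e ` G) \<longleftrightarrow> is_grouping N L G"
proof -
  have 1: "is_selection N L' (relabel e s)" if "is_selection N L s" for s
    using is_selection_relabel[OF that, of e] e(2) by (simp add: is_selection_def)
  have 2: "s i = Some l" if "relabel e s i = Some (e i l)" "s \<in> G" "i < N" "l \<in> L i" for s i l
    using that e(1) sel selection_SomeD[of N L s i] by (auto simp: relabel_Some inj_on_def)
  have 3: "relabel e s i = Some (e i l)" if "s i = Some l" for s i l
    using that by (simp add: relabel_def)
  have inj: "s = t" if "relabel e s = relabel e t" "s \<in> G" "t \<in> G" for s t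
    using relabel_inj[OF e(1), of s t] that sel by blast
  have "(\<exists>!s. s \<in> relabel e ` G \<and> s i = Some (e i l)) \<longleftrightarrow> (\<exists>!s. s \<in> G \<and> s i = Some l)"
    if "i < N" "l \<in> L i" for i l
  proof
    assume *: "\<exists>!s. s \<in> relabel e ` G \<and> s i = Some (e i l)"
    then obtain s where s: "s \<in> G" "relabel e s i = Some (e i l)" by blast
    show "\<exists>!s. s \<in> G \<and> s i = Some l"
    proof (rule ex1I[of _ s])
      show "s \<in> G \<and> s i = Some l" using s 2 that by blast
      show "t = s" if "t \<in> G \<and> t i = Some l" for t
        using that * s 3 inj by blast
    qed
  next
    assume *: "\<exists>!s. s \<in> G \<and> s i = Some l"
    then obtain s where s: "s \<in> G" "s i = Some l" by blast
    show "\<exists>!s. s \<in> relabel e ` G \<and> s i = Some (e i l)"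
    proof (rule ex1I[of _ "relabel e s"])
      show "relabel e s \<in> relabel e ` G \<and> relabel e s i = Some (e i l)" using s 3 by blast
      show "t = relabel e s" if t: "t \<in> relabel e ` G \<and> t i = Some (e i l)" for t
      proof -
        obtain t' where "t' \<in> G" "t = relabel e t'" using t by blast
        then show ?thesis using * s 2[of t' i l] t \<open>i < N\<close> \<open>l \<in> L i\<close> by auto
      qed
    qed
  qed
  then have A: "(\<forall>i<N. \<forall>l\<in>L' i. \<exists>!s. s \<in> relabel e ` G \<and> s i = Some l)
      \<longleftrightarrow> (\<forall>i<N. \<forall>l\<in>L i. \<exists>!s. s \<in> G \<and> s i = Some l)"
    using e(2) by simp
  have B: "(\<forall>s\<in>relabel e ` G. is_selection N L' s \<and> s \<noteq> (\<lambda>_. None))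
      \<longleftrightarrow> (\<forall>s\<in>G. is_selection N L s \<and> s \<noteq> (\<lambda>_. None))"
    using sel 1 by (auto simp: relabel_eq_None_iff)
  show ?thesis unfolding is_grouping_def by (simp only: A B)
qed

lemma ex_grouping_relabel:
  assumes e: "\<forall>i<N. inj_on (e i) (L i)" "\<forall>i<N. L' i = e i ` L i" and G: "is_grouping N L' G'"
  shows "\<exists>G. is_grouping N L G \<and> G' = relabel e ` G"
proof -
  let ?G = "{s. is_selection N L s \<and> relabel e s \<in> G'}"
  have "G' = relabel e ` ?G"
  proof (intro equalityI subsetI)
    fix t assume t: "t \<in> G'"
    then have "is_selection N L' t" using G by (auto simp: is_grouping_def)
    then obtain s where "is_selection N L s" "relabel e s = t" using ex_relabel[OF e(2)] by blast
    then show "t \<in> relabel e ` ?G" using t by blast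
  qed auto
  then show ?thesis using is_grouping_relabel[OF e, of ?G] G by auto
qed

lemma selection_mean_relabel:
  assumes "is_selection N L s" "\<forall>i<N. \<forall>l\<in>L i. q i (e i l) = p i l"
  shows "selection_mean N q (relabel e s) = selection_mean N p s"
proof -
  have "(case relabel e s i of None \<Rightarrow> (infdist z diagonal)\<^sup>2 | Some l \<Rightarrow> (norm (z - q i l))\<^sup>2)
      = (case s i of None \<Rightarrow> (infdist z diagonal)\<^sup>2 | Some l \<Rightarrow> (norm (z - p i l))\<^sup>2)" if "i < N" for i z
    using assms(2) selection_SomeD[OF assms(1), of i] that by (auto simp: relabel_def split: option.splits)
  then have "(\<lambda>z. \<Sum>i<N. case relabel e s i of None \<Rightarrow> (infdist z diagonal)\<^sup>2 | Some l \<Rightarrow> (norm (z - q i l))\<^sup>2)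
      = (\<lambda>z. \<Sum>i<N. case s i of None \<Rightarrow> (infdist z diagonal)\<^sup>2 | Some l \<Rightarrow> (norm (z - p i l))\<^sup>2)"
    by (intro ext sum.cong) auto
  then show ?thesis unfolding selection_mean_def by simp
qed

lemma grouping_mean_relabel:
  assumes e: "\<forall>i<N. inj_on (e i) (L i)" and sel: "\<forall>s\<in>G. is_selection N L s"
    and pq: "\<forall>i<N. \<forall>l\<in>L i. q i (e i l) = p i l"
  shows "grouping_mean N q (relabel e ` G) = grouping_mean N p G"
proof -
  have inj: "inj_on (relabel e) G"
    using relabel_inj[OF e] sel by (auto intro!: inj_onI)
  have "image_mset (selection_mean N q) (mset_set (relabel e ` G))
      = image_mset (selection_mean N q \<circ> relabel e) (mset_set G)"
    using image_mset_mset_set[OF inj] by (metis multiset.map_comp)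
  also have "\<dots> = image_mset (selection_mean N p) (mset_set G)"
  proof (cases "finite G")
    case True
    then show ?thesis using selection_mean_relabel[where q = q and e = e and p = p and L = L] pq sel by (intro image_mset_cong) auto
  qed simp
  finally show ?thesis by (simp add: grouping_mean_def)
qed

lemma label_diagram_relabel:
  assumes "inj_on (e i) (L i)" "L' i = e i ` L i" "\<forall>l\<in>L i. q i (e i l) = p i l"
  shows "label_diagram L' q i = label_diagram L p i"
proof -
  have "image_mset (q i) (mset_set (e i ` L i)) = image_mset (q i \<circ> e i) (mset_set (L i))"
    using image_mset_mset_set[OF assms(1)] by (metis multiset.map_comp)
  also have "\<dots> = image_mset (p i) (mset_set (L i))"
  proof (cases "finite (L i)")
    case True
    then show ?thesis using assms(3) by (intro image_mset_cong) auto
  qed simp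
  finally show ?thesis by (simp add: label_diagram_def assms(2))
qed

text \<open>Input and mean diagrams depend only on multisets of positions, which the relabeling
  preserves; hence the Frechet functions and their minimizers coincide.\<close>

lemma optimal_grouping_relabel:
  assumes e: "\<forall>i<N. inj_on (e i) (L i)" "\<forall>i<N. L' i = e i ` L i"
    and pq: "\<forall>i<N. \<forall>l\<in>L i. q i (e i l) = p i l" and sel: "\<forall>s\<in>G. is_selection N L s"
  shows "optimal_grouping N L' q (relabel e ` G) \<longleftrightarrow> optimal_grouping N L p G"
proof -
  have "frechet N (label_diagram L' q) = frechet N (label_diagram L p)"
    unfolding frechet_def
    by (intro ext sum.cong) (use e pq label_diagram_relabel[of e _ L L' q p] in auto)
  then show ?thesis
    unfolding optimal_grouping_def label_diagram_def[symmetric]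
    using is_grouping_relabel[OF e sel] grouping_mean_relabel[OF e(1) sel pq] by simp
qed

section \<open>The grouping induced by a draw\<close>

definition pos :: "(nat \<times> 'l \<Rightarrow> point option) \<Rightarrow> nat \<Rightarrow> 'l \<Rightarrow> point" where
  "pos w = (\<lambda>i l. the (w (i, l)))"

definition survivors :: "(nat \<Rightarrow> 'l set) \<Rightarrow> (nat \<times> 'l \<Rightarrow> point option) \<Rightarrow> nat \<Rightarrow> 'l set" where
  "survivors L w = (\<lambda>i. {l \<in> L i. w (i, l) \<noteq> None})"

definition dropped :: "nat \<Rightarrow> (nat \<Rightarrow> 'l set) \<Rightarrow> (nat \<times> 'l \<Rightarrow> point option) \<Rightarrow> 'l selection set" where
  "dropped N L w = {trivial_selection i l |i l. i < N \<and> l \<in> L i \<and> w (i, l) = None}"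

text \<open>The event of \<open>grouping_prob\<close> for arbitrary label sets, which allows
  comparing draws for two families of diagrams.\<close>

definition induces :: "nat \<Rightarrow> (nat \<Rightarrow> 'l set) \<Rightarrow> (nat \<times> 'l \<Rightarrow> point option) \<Rightarrow> 'l selection set \<Rightarrow> bool" where
  "induces N L w G \<longleftrightarrow> above N (survivors L w) (pos w) \<and>
     (\<exists>G'. (\<forall>H. optimal_grouping N (survivors L w) (pos w) H \<longleftrightarrow> H = G') \<and> G' \<union> dropped N L w = G)"

lemma grouping_prob_eq:
  "grouping_prob \<alpha> N X G = measure (draws \<alpha> N X)
     {w \<in> space (draws \<alpha> N X). induces N (\<lambda>i. off_points (X i)) w G}"
proof -
  have "surviving X w = survivors (\<lambda>i. off_points (X i)) w" for w
    by (simp add: surviving_def survivors_def fun_eq_iff)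
  then show ?thesis
    unfolding grouping_prob_def induces_def above_def hgt_def pos_def lift_grouping_def dropped_def
    by simp
qed

lemma induces_unique: "induces N L w G \<Longrightarrow> induces N L w H \<Longrightarrow> G = H"
  unfolding induces_def by metis

lemma is_selection_mono:
  "is_selection N L s \<Longrightarrow> (\<And>i. i < N \<Longrightarrow> L i \<subseteq> L' i) \<Longrightarrow> is_selection N L' s"
  by (fastforce simp: is_selection_def)

lemma is_grouping_lift:
  assumes "is_grouping N (survivors L w) G"
  shows "is_grouping N L (G \<union> dropped N L w)"
  unfolding is_grouping_def
proof (intro conjI ballI allI impI)
  fix s assume "s \<in> G \<union> dropped N L w"
  moreover have "is_selection N L s" if "is_selection N (survivors L w) s"
    using that by (rule is_selection_mono) (simp add: survivors_def)
  ultimately show "is_selection N L s" "s \<noteq> (\<lambda>_. None)"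
    using assms
    by (auto simp: is_grouping_def dropped_def is_selection_trivial trivial_selection_neq_None
        trivial_selection_neq_None[symmetric])
next
  fix i l assume il: "i < N" "l \<in> L i"
  show "\<exists>!s. s \<in> G \<union> dropped N L w \<and> s i = Some l"
  proof (cases "w (i, l) = None")
    case True
    show ?thesis
    proof (rule ex1I[of _ "trivial_selection i l"])
      show "trivial_selection i l \<in> G \<union> dropped N L w \<and> trivial_selection i l i = Some l"
        using il True by (auto simp: dropped_def trivial_selection_eq_Some)
      show "s = trivial_selection i l" if s: "s \<in> G \<union> dropped N L w \<and> s i = Some l" for s
      proof (cases "s \<in> G")
        case True
        then have "l \<in> survivors L w i"
          using assms s selection_SomeD[of N "survivors L w" s i l] by (auto simp: is_grouping_def)
        then show ?thesis using \<open>w (i, l) = None\<close> by (simp add: survivors_def)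
      next
        case False
        then show ?thesis using s by (auto simp: dropped_def trivial_selection_eq_Some)
      qed
    qed
  next
    case False
    then have l: "l \<in> survivors L w i" using il by (simp add: survivors_def)
    then obtain s where s: "s \<in> G" "s i = Some l" using grouping_ex[OF assms il(1)] by blast
    show ?thesis
    proof (rule ex1I[of _ s])
      show "s \<in> G \<union> dropped N L w \<and> s i = Some l" using s by simp
      show "t = s" if t: "t \<in> G \<union> dropped N L w \<and> t i = Some l" for t
        using t False grouping_unique[OF assms _ s(1) _ s(2)]
        by (auto simp: dropped_def trivial_selection_eq_Some)
    qed
  qed
qed

lemma induces_grouping: "induces N L w G \<Longrightarrow> is_grouping N L G"
  unfolding induces_def using is_grouping_lift by (metis optimal_grouping_def)

lemma ex_induces:
  assumes "N \<ge> 1" "\<forall>i<N. finite (L i)" "above N (survivors L w) (pos w)" "generic N (survivors L w) (pos w)"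
  shows "\<exists>G. induces N L w G"
proof -
  have "\<forall>i<N. finite (survivors L w i)" using assms(2) by (auto simp: survivors_def)
  from unique_optimal_grouping[OF assms(1) this assms(3,4)] show ?thesis
    unfolding induces_def using assms(3) by blast
qed

section \<open>Measurability of the induced grouping\<close>

lemma measurable_hgt [measurable]: "hgt \<in> borel_measurable borel"
  unfolding hgt_def by (intro borel_measurable_continuous_onI continuous_intros)

lemma measurable_adv [measurable]: "adv \<in> borel_measurable borel"
  unfolding adv_def by (intro borel_measurable_continuous_onI continuous_intros)

abbreviation option_draws :: "'i set \<Rightarrow> ('i \<Rightarrow> point option) measure" where
  "option_draws J \<equiv> PiM J (\<lambda>_. option_borel)"

lemma pred_eq_real:
  assumes "f \<in> borel_measurable M" "g \<in> borel_measurable M"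
  shows "Measurable.pred M (\<lambda>w. (f w :: real) = g w)"
  unfolding pred_def using assms by (rule borel_measurable_eq)

lemma measurable_pos:
  "(i, l) \<in> J \<Longrightarrow> (\<lambda>w. pos w i l) \<in> borel_measurable (option_draws J)"
  unfolding pos_def
  using measurable_compose[OF measurable_component_singleton[of "(i, l)" J "\<lambda>_. option_borel"] measurable_the] .

lemma measurable_sel_sum:
  assumes "f \<in> borel_measurable borel" "\<And>i l. i < N \<Longrightarrow> s i = Some l \<Longrightarrow> (i, l) \<in> J"
  shows "(\<lambda>w. sel_sum N (pos w) f s) \<in> borel_measurable (option_draws J)"
  unfolding sel_sum_def
proof (intro borel_measurable_sum)
  fix i assume "i \<in> {..<N}"
  then show "(\<lambda>w. case s i of None \<Rightarrow> 0 | Some l \<Rightarrow> f (pos w i l)) \<in> borel_measurable (option_draws J)"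
    using assms(2)[of i] measurable_compose[OF measurable_pos assms(1), of i _ J]
    by (cases "s i") auto
qed

lemma measurable_sel_cost:
  assumes "\<And>i l. i < N \<Longrightarrow> s i = Some l \<Longrightarrow> (i, l) \<in> J"
  shows "(\<lambda>w. sel_cost N (pos w) s) \<in> borel_measurable (option_draws J)"
proof -
  note [measurable] = measurable_sel_sum[OF _ assms]
  show ?thesis unfolding sel_cost_def by measurable
qed

lemma measurable_mean_pt:
  assumes "\<And>i l. i < N \<Longrightarrow> s i = Some l \<Longrightarrow> (i, l) \<in> J"
  shows "(\<lambda>w. mean_pt N (pos w) s) \<in> borel_measurable (option_draws J)"
proof -
  note [measurable] = measurable_sel_sum[OF _ assms]
  show ?thesis unfolding mean_pt_def Let_def by measurable
qed

lemma measurable_grouping_cost: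
  assumes "\<And>s i l. s \<in> G \<Longrightarrow> i < N \<Longrightarrow> s i = Some l \<Longrightarrow> (i, l) \<in> J"
  shows "(\<lambda>w. grouping_cost N (pos w) G) \<in> borel_measurable (option_draws J)"
  unfolding grouping_cost_def using assms by (intro borel_measurable_sum measurable_sel_cost)

lemma measurable_pm_cost:
  fixes p :: "'w \<Rightarrow> 'a \<Rightarrow> point" and q :: "'w \<Rightarrow> 'b \<Rightarrow> point"
  assumes p: "\<And>a. a \<in> A \<Longrightarrow> (\<lambda>w. p w a) \<in> borel_measurable M"
    and q: "\<And>b. b \<in> B \<Longrightarrow> (\<lambda>w. q w b) \<in> borel_measurable M" and R: "R \<in> pmatch A B"
  shows "(\<lambda>w. pm_cost A (p w) B (q w) R) \<in> borel_measurable M"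
proof -
  have "(\<lambda>w. \<Sum>(a, b)\<in>R. (norm (p w a - q w b))\<^sup>2) \<in> borel_measurable M"
  proof (intro borel_measurable_sum)
    fix r assume "r \<in> R"
    then obtain a b where r: "r = (a, b)" "a \<in> A" "b \<in> B" using R by (auto simp: pmatch_def)
    note [measurable] = p[OF r(2)] q[OF r(3)]
    show "(\<lambda>w. case r of (a, b) \<Rightarrow> (norm (p w a - q w b))\<^sup>2) \<in> borel_measurable M"
      unfolding r(1) prod.case by measurable
  qed
  moreover have "(\<lambda>w. \<Sum>a\<in>A - fst ` R. (hgt (p w a))\<^sup>2 / 2) \<in> borel_measurable M"
    using measurable_compose[OF p measurable_hgt]
    by (intro borel_measurable_sum borel_measurable_divide borel_measurable_power) auto
  moreover have "(\<lambda>w. \<Sum>b\<in>B - snd ` R. (hgt (q w b))\<^sup>2 / 2) \<in> borel_measurable M"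
    using measurable_compose[OF q measurable_hgt]
    by (intro borel_measurable_sum borel_measurable_divide borel_measurable_power) auto
  ultimately show ?thesis unfolding pm_cost_def by measurable
qed

text \<open>Spaces of draws are not complete, so optimality is expressed by finitely many measurable functions.\<close>

definition mean_frechet :: "nat \<Rightarrow> (nat \<Rightarrow> 'l set) \<Rightarrow> (nat \<Rightarrow> 'l \<Rightarrow> point) \<Rightarrow> 'l selection set \<Rightarrow> ennreal" where
  "mean_frechet N L p G =
     (\<Sum>i<N. INF R\<in>pmatch G (L i). ennreal (pm_cost G (mean_pt N p) (L i) (p i) R))"

lemma frechet_grouping_mean:
  assumes "N \<ge> 1" "\<forall>i<N. finite (L i)" "above N L p" "is_grouping N L G"
  shows "frechet N (label_diagram L p) (grouping_mean N p G) = mean_frechet N L p G"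
proof -
  obtain \<alpha> where "\<forall>i<N. labels (label_diagram L p i) (L i) (\<alpha> i) (p i)"
    using ex_labels_label_diagram[OF assms(2,3)] by blast
  moreover obtain \<mu> where "labels (grouping_mean N p G) G \<mu> (mean_pt N p)"
    using ex_labels_grouping_mean[OF assms(1,2,4,3)] by blast
  ultimately show ?thesis
    unfolding frechet_def mean_frechet_def by (intro sum.cong refl W2_sq_labels) auto
qed

lemma measurable_mean_frechet:
  assumes "\<And>i. i < N \<Longrightarrow> finite (L i)" "finite G" "\<And>i l. i < N \<Longrightarrow> l \<in> L i \<Longrightarrow> (i, l) \<in> J"
    "\<And>s. s \<in> G \<Longrightarrow> is_selection N L s"
  shows "(\<lambda>w. mean_frechet N L (pos w) G) \<in> borel_measurable (option_draws J)"
  unfolding mean_frechet_def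
proof (intro borel_measurable_sum borel_measurable_INF)
  fix i assume i: "i \<in> {..<N}"
  show "countable (pmatch G (L i))" using assms(1,2) i finite_pmatch by (blast intro: countable_finite)
  fix R assume R: "R \<in> pmatch G (L i)"
  have "(\<lambda>w. pm_cost G (mean_pt N (pos w)) (L i) (pos w i) R) \<in> borel_measurable (option_draws J)"
  proof (rule measurable_pm_cost[OF _ _ R])
    show "(\<lambda>w. mean_pt N (pos w) s) \<in> borel_measurable (option_draws J)" if "s \<in> G" for s
      using assms(3) selection_SomeD[OF assms(4)[OF that]] by (intro measurable_mean_pt) blast
    show "(\<lambda>w. pos w i l) \<in> borel_measurable (option_draws J)" if "l \<in> L i" for l
      using assms(3) i that by (intro measurable_pos) auto
  qed
  then show "(\<lambda>w. ennreal (pm_cost G (mean_pt N (pos w)) (L i) (pos w i) R)) \<in> borel_measurable (option_draws J)"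
    by measurable
qed

lemma optimal_grouping_cong:
  assumes "\<forall>i<N. L i = L' i"
  shows "optimal_grouping N L p H \<longleftrightarrow> optimal_grouping N L' p H"
proof -
  have "frechet N (label_diagram L p) = frechet N (label_diagram L' p)"
    unfolding frechet_def label_diagram_def using assms by (intro ext sum.cong) auto
  then show ?thesis
    unfolding optimal_grouping_def label_diagram_def[symmetric] using is_grouping_cong[OF assms] by simp
qed

lemma above_cong: "\<forall>i<N. L i = L' i \<Longrightarrow> above N L p \<longleftrightarrow> above N L' p"
  by (simp add: above_def)

definition fibre :: "(nat \<times> 'l) set \<Rightarrow> nat \<Rightarrow> 'l set" where
  "fibre T i = {l. (i, l) \<in> T}"

definition best_mean :: "nat \<Rightarrow> (nat \<Rightarrow> 'l set) \<Rightarrow> (nat \<Rightarrow> 'l \<Rightarrow> point) \<Rightarrow> 'l selection set \<Rightarrow> bool" where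
  "best_mean N L p G \<longleftrightarrow>
     (\<forall>H\<in>{H. is_grouping N L H}. mean_frechet N L p G \<le> ennreal (grouping_cost N p H))"

lemma optimal_grouping_iff_best_mean:
  assumes "N \<ge> 1" "\<forall>i<N. finite (L i)" "above N L p"
  shows "optimal_grouping N L p H \<longleftrightarrow> is_grouping N L H \<and> best_mean N L p H"
  unfolding optimal_grouping_iff[OF assms] best_mean_def
  using frechet_grouping_mean[OF assms] by auto

text \<open>The label sets of the survivors vary with the draw. Splitting by the set of surviving
  indices makes them constant on each piece, and there only finitely many groupings and inequalities
  between measurable functions are involved.\<close>

lemma measurable_induces:
  assumes N: "N \<ge> 1" and fin: "\<forall>i<N. finite (L i)"
  defines "J \<equiv> SIGMA i:{..<N}. L i"
  shows "Measurable.pred (option_draws J) (\<lambda>w. induces N L w G)"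
proof -
  have finJ: "finite J" using fin by (auto simp: J_def)
  let ?drop = "\<lambda>T. {trivial_selection i l |i l. i < N \<and> l \<in> L i \<and> (i, l) \<notin> T}"
  \<comment> \<open>\<open>T\<close> is the set of surviving indices. Quantifiers range over finite
    sets of groupings. Replacing optimality by \<open>best_mean\<close> is legitimate only for
    points above the diagonal, which the second conjunct provides.\<close>
  let ?Q = "\<lambda>T w. (\<forall>j\<in>J. w j = None \<longleftrightarrow> j \<notin> T) \<and> (\<forall>j\<in>T. 0 < hgt (pos w (fst j) (snd j))) \<and>
    (\<exists>G'\<in>{G'. is_grouping N (fibre T) G'}. (\<forall>H\<in>{H. is_grouping N (fibre T) H}.
       best_mean N (fibre T) (pos w) H \<longleftrightarrow> H = G') \<and> G' \<union> ?drop T = G)"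
  have iff: "induces N L w G \<longleftrightarrow> (\<exists>T\<in>Pow J. ?Q T w)" for w
  proof -
    have T: "induces N L w G \<longleftrightarrow> ?Q T w" if T: "T \<subseteq> J" "\<forall>j\<in>J. w j = None \<longleftrightarrow> j \<notin> T" for T
    proof -
      have wT: "w (i, l) = None \<longleftrightarrow> (i, l) \<notin> T" if "i < N" "l \<in> L i" for i l
        using T(2) that by (simp add: J_def)
      have S: "\<forall>i<N. survivors L w i = fibre T i"
      proof (intro allI impI set_eqI)
        fix i l assume "i < N"
        then show "l \<in> survivors L w i \<longleftrightarrow> l \<in> fibre T i"
          using wT[of i l] T(1) by (cases "l \<in> L i") (auto simp: survivors_def fibre_def J_def)
      qed
      have D: "dropped N L w = ?drop T"
        using wT unfolding dropped_def by blast
      have A: "above N (fibre T) (pos w) \<longleftrightarrow> (\<forall>j\<in>T. 0 < hgt (pos w (fst j) (snd j)))"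
        using T(1) by (fastforce simp: above_def fibre_def J_def)
      have F: "\<forall>i<N. finite (fibre T i)"
        using fin T(1) by (auto simp: fibre_def J_def intro: finite_subset)
      have "induces N L w G \<longleftrightarrow> above N (fibre T) (pos w) \<and>
          (\<exists>G'. (\<forall>H. optimal_grouping N (fibre T) (pos w) H \<longleftrightarrow> H = G') \<and> G' \<union> ?drop T = G)"
        unfolding induces_def D above_cong[OF S] optimal_grouping_cong[OF S] ..
      also have "\<dots> \<longleftrightarrow> above N (fibre T) (pos w) \<and> (\<exists>G'. (\<forall>H. is_grouping N (fibre T) H \<and>
          best_mean N (fibre T) (pos w) H \<longleftrightarrow> H = G') \<and> G' \<union> ?drop T = G)"
        using optimal_grouping_iff_best_mean[OF N F] by (intro conj_cong refl) simp
      also have "\<dots> \<longleftrightarrow> above N (fibre T) (pos w) \<and> (\<exists>G'\<in>{G'. is_grouping N (fibre T) G'}.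
          (\<forall>H\<in>{H. is_grouping N (fibre T) H}. best_mean N (fibre T) (pos w) H \<longleftrightarrow> H = G') \<and> G' \<union> ?drop T = G)"
        by blast
      finally show ?thesis unfolding A using T(2) by blast
    qed
    let ?T = "{j \<in> J. w j \<noteq> None}"
    show ?thesis
    proof
      assume ind: "induces N L w G"
      have sub: "?T \<subseteq> J" and dom: "\<forall>j\<in>J. w j = None \<longleftrightarrow> j \<notin> ?T" by blast+
      have "?Q ?T w" by (rule iffD1[OF T[OF sub dom] ind])
      then show "\<exists>T\<in>Pow J. ?Q T w" by (rule bexI[where x = ?T]) (use sub in blast)
    next
      assume "\<exists>T\<in>Pow J. ?Q T w"
      then obtain T where "T \<subseteq> J" "?Q T w" by blast
      then show "induces N L w G" using T[of T] by blast
    qed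
  qed
  have "Measurable.pred (option_draws J) (?Q T)" if T: "T \<in> Pow J" for T
  proof -
    have TJ: "T \<subseteq> J" using T by simp
    have finT: "finite T" using TJ finJ finite_subset by blast
    have F: "\<forall>i<N. finite (fibre T i)"
      using fin TJ by (auto simp: fibre_def J_def intro: finite_subset)
    have lab: "(i, l) \<in> J" if "is_grouping N (fibre T) H" "s \<in> H" "s i = Some l" for H s i l
      using that selection_SomeD[of N "fibre T" s i l] TJ by (auto simp: is_grouping_def fibre_def)
    have fg: "finite {H. is_grouping N (fibre T) H}" using finite_groupings F by blast
    have 1: "Measurable.pred (option_draws J) (\<lambda>w. w j = None)" if "j \<in> J" for j
      using that by (intro pred_option measurable_component_singleton)
    have 2: "Measurable.pred (option_draws J) (\<lambda>w. 0 < hgt (pos w (fst j) (snd j)))" if "j \<in> T" for j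
    proof -
      have "(\<lambda>w. hgt (pos w (fst j) (snd j))) \<in> borel_measurable (option_draws J)"
        using that TJ by (intro measurable_compose[OF measurable_pos measurable_hgt]) auto
      then show ?thesis by measurable
    qed
    have 3: "Measurable.pred (option_draws J) (\<lambda>w. best_mean N (fibre T) (pos w) H)"
      if H: "is_grouping N (fibre T) H" for H
      unfolding best_mean_def
    proof (intro pred_intros_finite fg)
      fix H' assume H': "H' \<in> {H. is_grouping N (fibre T) H}"
      have mf: "(\<lambda>w. mean_frechet N (fibre T) (pos w) H) \<in> borel_measurable (option_draws J)"
      proof (rule measurable_mean_frechet)
        show "finite H" using finite_grouping[OF F H] .
      qed (use F TJ H in \<open>auto simp: fibre_def is_grouping_def\<close>)
      have mc: "(\<lambda>w. grouping_cost N (pos w) H') \<in> borel_measurable (option_draws J)"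
        using H' lab by (intro measurable_grouping_cost) blast
      show "Measurable.pred (option_draws J)
          (\<lambda>w. mean_frechet N (fibre T) (pos w) H \<le> ennreal (grouping_cost N (pos w) H'))"
        unfolding pred_def by (intro borel_measurable_le mf measurable_compose[OF mc measurable_ennreal])
    qed
    show ?thesis
      by (intro pred_intros_logic pred_intros_finite finJ finT fg 1 2 3) auto
  qed
  then have "Measurable.pred (option_draws J) (\<lambda>w. \<exists>T\<in>Pow J. ?Q T w)"
    using finJ by (intro pred_intros_finite) auto
  then show ?thesis unfolding iff .
qed

section \<open>Almost sure genericity\<close>

text \<open>For fixed first coordinate u this is a polynomial in the second. It vanishes identically
  only if a = 0, b = - c and u = d / (2 c), thus for at most one u; otherwise it has finitely many
  roots. Fubini for null sets concludes.\<close>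

lemma null_quadratic:
  assumes "c \<noteq> (0 :: real)"
  shows "AE y in lborel. a * (adv y)\<^sup>2 + b * adv y + d + c * hgt y \<noteq> 0"
proof -
  let ?P = "\<lambda>y :: point. a * (adv y)\<^sup>2 + b * adv y + d + c * hgt y \<noteq> 0"
  have "AE u in lborel. AE v in lborel. ?P (u, v)"
    using AE_lborel_singleton[of "d / (2 * c)"]
  proof (rule eventually_mono)
    fix u :: real assume u: "u \<noteq> d / (2 * c)"
    let ?p = "[:a * u\<^sup>2 + b * u + d - c * u, 2 * a * u + b + c, a:]"
    have eq: "poly ?p v = a * (adv (u, v))\<^sup>2 + b * adv (u, v) + d + c * hgt (u, v)" for v
      by (simp add: adv_def hgt_def power2_eq_square algebra_simps)
    have "?p \<noteq> 0"
    proof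
      assume "?p = 0"
      then have "a = 0" "b = - c" "b * u + d - c * u = 0" by auto
      then have "u = d / (2 * c)" using assms by (simp add: field_simps)
      then show False using u by simp
    qed
    then have "finite {v. poly ?p v = 0}" by (rule poly_roots_finite)
    then have "{v. poly ?p v = 0} \<in> null_sets lborel" by (rule finite_imp_null_set_lborel)
    from AE_not_in[OF this] show "AE v in lborel. ?P (u, v)" by (simp only: eq mem_Collect_eq)
  qed
  moreover have "{y \<in> space (lborel \<Otimes>\<^sub>M lborel). ?P y} \<in> sets (lborel \<Otimes>\<^sub>M lborel)"
    unfolding lborel_prod by measurable
  ultimately have "AE y in lborel \<Otimes>\<^sub>M lborel. ?P y"
    by (intro lborel_pair.AE_pair_measure) auto
  then show ?thesis unfolding lborel_prod .
qed

abbreviation draw_measure :: "real \<Rightarrow> ('i \<Rightarrow> point) \<Rightarrow> 'i set \<Rightarrow> ('i \<Rightarrow> point option) measure" where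
  "draw_measure \<alpha> c J \<equiv> PiM J (\<lambda>j. perturbation \<alpha> (c j))"

lemma sets_draw_measure: "sets (draw_measure \<alpha> c J) = sets (option_draws J)"
  by (intro sets_PiM_cong) auto

text \<open>Moving one point of a draw: the case that it is dropped has to be checked outright,
  since \<open>None\<close> is an atom, while for its positions Lebesgue almost every one
  suffices.\<close>

lemma AE_draw_coordinate:
  assumes \<alpha>: "\<alpha> > 0" and J: "finite J" "j \<in> J"
    and P: "Measurable.pred (option_draws J) P"
    and None: "\<And>x. P (x(j := None))" and Some: "\<And>x. AE y in lborel. P (x(j := Some y))"
  shows "AE w in draw_measure \<alpha> c J. P w"
proof (rule AE_PiM_coordinate[OF prob_space_perturbation[OF \<alpha>] J])
  show P': "Measurable.pred (draw_measure \<alpha> c J) P"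
    using P measurable_cong_sets[OF sets_draw_measure refl] by blast
  fix x assume x: "x \<in> space (draw_measure \<alpha> c (J - {j}))"
  have "(\<lambda>z. x(j := z)) \<in> perturbation \<alpha> (c j) \<rightarrow>\<^sub>M draw_measure \<alpha> c (insert j (J - {j}))"
    using x by (intro measurable_component_update) auto
  moreover have "insert j (J - {j}) = J" using J by auto
  ultimately have "(\<lambda>z. x(j := z)) \<in> perturbation \<alpha> (c j) \<rightarrow>\<^sub>M draw_measure \<alpha> c J" by simp
  from measurable_compose[OF this P'] have "Measurable.pred option_borel (\<lambda>z. P (x(j := z)))"
    using measurable_cong_sets[OF sets_perturbation refl] by blast
  then show "AE z in perturbation \<alpha> (c j). P (x(j := z))"
    using None Some[of x] by (intro AE_perturbation[OF \<alpha>]) (auto elim: eventually_mono)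
qed

lemma sel_sum_update_other:
  "s i \<noteq> Some l \<Longrightarrow> sel_sum N (pos (x((i, l) := z))) f s = sel_sum N (pos x) f s"
  by (rule sel_sum_cong) (auto simp: pos_def)

lemma sel_cost_update_other:
  "s i \<noteq> Some l \<Longrightarrow> sel_cost N (pos (x((i, l) := z))) s = sel_cost N (pos x) s"
  by (simp add: sel_cost_def sel_sum_update_other)

lemma sel_sum_update:
  assumes "i < N" "s i = Some l"
  shows "sel_sum N (pos (x((i, l) := Some y))) f s = f y + sel_sum N (pos x) f (s(i := None))"
proof -
  let ?p = "pos (x((i, l) := Some y))"
  have "sel_sum N ?p f s = f y + (\<Sum>k\<in>{..<N} - {i}. case s k of None \<Rightarrow> 0 | Some m \<Rightarrow> f (?p k m))"
    unfolding sel_sum_def using assms by (subst sum.remove[of _ i]) (auto simp: pos_def)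
  also have "(\<Sum>k\<in>{..<N} - {i}. case s k of None \<Rightarrow> 0 | Some m \<Rightarrow> f (?p k m))
      = (\<Sum>k\<in>{..<N} - {i}. case (s(i := None)) k of None \<Rightarrow> 0 | Some m \<Rightarrow> f (pos x k m))"
    by (intro sum.cong) (auto simp: pos_def split: option.splits)
  also have "\<dots> = sel_sum N (pos x) f (s(i := None))"
    unfolding sel_sum_def using assms by (subst (2) sum.remove[of _ i]) auto
  finally show ?thesis .
qed

text \<open>The label (i, l) occurs in \<open>s\<close> but not in \<open>t\<close>. Moving its
  point y changes only the first sum, so the difference is hgt y plus a constant.\<close>

lemma AE_sel_sum_neq:
  assumes \<alpha>: "\<alpha> > 0" and J: "finite J" "(i, l) \<in> J" and i: "i < N" "s i = Some l" "t i \<noteq> Some l"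
    and lab: "\<And>k m. k < N \<Longrightarrow> s k = Some m \<Longrightarrow> (k, m) \<in> J" "\<And>k m. k < N \<Longrightarrow> t k = Some m \<Longrightarrow> (k, m) \<in> J"
  shows "AE w in draw_measure \<alpha> c J. w (i, l) \<noteq> None \<longrightarrow> sel_sum N (pos w) hgt s \<noteq> sel_sum N (pos w) hgt t"
proof (rule AE_draw_coordinate[OF \<alpha> J])
  have ms: "(\<lambda>w. sel_sum N (pos w) hgt s) \<in> borel_measurable (option_draws J)"
    using lab(1) by (intro measurable_sel_sum measurable_hgt)
  have mt: "(\<lambda>w. sel_sum N (pos w) hgt t) \<in> borel_measurable (option_draws J)"
    using lab(2) by (intro measurable_sel_sum measurable_hgt)
  have mn: "Measurable.pred (option_draws J) (\<lambda>w. w (i, l) = None)"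
    using J(2) by (intro pred_option measurable_component_singleton)
  show "Measurable.pred (option_draws J)
      (\<lambda>w. w (i, l) \<noteq> None \<longrightarrow> sel_sum N (pos w) hgt s \<noteq> sel_sum N (pos w) hgt t)"
    by (intro pred_intros_logic mn pred_eq_real ms mt)
  fix x :: "nat \<times> 'a \<Rightarrow> point option"
  show "AE y in lborel. (x((i, l) := Some y)) (i, l) \<noteq> None \<longrightarrow>
      sel_sum N (pos (x((i, l) := Some y))) hgt s \<noteq> sel_sum N (pos (x((i, l) := Some y))) hgt t"
    using null_quadratic[of 1 0 0 "sel_sum N (pos x) hgt (s(i := None)) - sel_sum N (pos x) hgt t"]
    by (rule eventually_mono[OF _ ]) (auto simp: sel_sum_update[where s = s, OF i(1,2)] sel_sum_update_other[where s = t, OF i(3)])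
qed simp

text \<open>\<open>s\<close> and \<open>t\<close> are the selections of \<open>G\<close> and
  \<open>H\<close> that contain (i, l). As its point y moves, the squares of hgt y cancel, because
  heights are always divided by N. What is left is quadratic in adv y and linear in hgt y, with
  slope a multiple of the difference of the other heights in \<open>t\<close> and \<open>s\<close>.
  Distinct height sums make this slope nonzero, which is why they are treated first.\<close>

lemma AE_grouping_cost_neq:
  assumes N: "N \<ge> 1" and \<alpha>: "\<alpha> > 0" and J: "finite J" "(i, l) \<in> J" and i: "i < N" "s i = Some l" "t i = Some l"
    and fin: "finite G" "finite H"
    and s: "s \<in> G" "\<And>r. r \<in> G \<Longrightarrow> r i = Some l \<Longrightarrow> r = s"
    and t: "t \<in> H" "\<And>r. r \<in> H \<Longrightarrow> r i = Some l \<Longrightarrow> r = t"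
    and lab: "\<And>r k m. r \<in> G \<union> H \<Longrightarrow> k < N \<Longrightarrow> r k = Some m \<Longrightarrow> (k, m) \<in> J"
  shows "AE w in draw_measure \<alpha> c J. w (i, l) \<noteq> None \<and> sel_sum N (pos w) hgt s \<noteq> sel_sum N (pos w) hgt t
    \<longrightarrow> grouping_cost N (pos w) G \<noteq> grouping_cost N (pos w) H"
proof (rule AE_draw_coordinate[OF \<alpha> J])
  have ms: "(\<lambda>w. sel_sum N (pos w) hgt s) \<in> borel_measurable (option_draws J)"
    using lab[of s] s(1) by (intro measurable_sel_sum measurable_hgt) auto
  have mt: "(\<lambda>w. sel_sum N (pos w) hgt t) \<in> borel_measurable (option_draws J)"
    using lab[of t] t(1) by (intro measurable_sel_sum measurable_hgt) auto
  have mG: "(\<lambda>w. grouping_cost N (pos w) G) \<in> borel_measurable (option_draws J)"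
    using lab by (intro measurable_grouping_cost) blast
  have mH: "(\<lambda>w. grouping_cost N (pos w) H) \<in> borel_measurable (option_draws J)"
    using lab by (intro measurable_grouping_cost) blast
  have mn: "Measurable.pred (option_draws J) (\<lambda>w. w (i, l) = None)"
    using J(2) by (intro pred_option measurable_component_singleton)
  show "Measurable.pred (option_draws J)
      (\<lambda>w. w (i, l) \<noteq> None \<and> sel_sum N (pos w) hgt s \<noteq> sel_sum N (pos w) hgt t
        \<longrightarrow> grouping_cost N (pos w) G \<noteq> grouping_cost N (pos w) H)"
    by (intro pred_intros_logic mn pred_eq_real ms mt mG mH)
  fix x :: "nat \<times> 'a \<Rightarrow> point option"
  let ?x = "\<lambda>y. x((i, l) := Some y)"
  let ?S = "\<lambda>f r. sel_sum N (pos x) f (r(i := None))"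
  let ?CG = "\<Sum>r\<in>G - {s}. sel_cost N (pos x) r" and ?CH = "\<Sum>r\<in>H - {t}. sel_cost N (pos x) r"
  \<comment> \<open>Reciprocals are named so that \<open>identity\<close> is a polynomial identity,
    indifferent to vanishing denominators.\<close>
  define u v n where "u = 1 / sel_card N s" and "v = 1 / sel_card N t" and "n = 1 / real N"
  have dv: "x / sel_card N s = x * u" "x / sel_card N t = x * v" "x / real N = x * n" for x
    by (simp_all add: u_def v_def n_def)
  let ?a = "(v - u) / 2" and ?b = "?S adv t * v - ?S adv s * u" and ?c = "(?S hgt t - ?S hgt s) * n"
  let ?d = "?CG - ?CH
    + (?S (\<lambda>x. (adv x)\<^sup>2) s - (?S adv s)\<^sup>2 * u + ?S (\<lambda>x. (hgt x)\<^sup>2) s - (?S hgt s)\<^sup>2 * n) / 2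
    - (?S (\<lambda>x. (adv x)\<^sup>2) t - (?S adv t)\<^sup>2 * v + ?S (\<lambda>x. (hgt x)\<^sup>2) t - (?S hgt t)\<^sup>2 * n) / 2"
  have G: "grouping_cost N (pos (?x y)) G = sel_cost N (pos (?x y)) s + ?CG" for y
  proof -
    have "(\<Sum>r\<in>G - {s}. sel_cost N (pos (?x y)) r) = ?CG"
      using s(2) by (intro sum.cong refl sel_cost_update_other) auto
    then show ?thesis unfolding grouping_cost_def using fin s by (simp add: sum.remove)
  qed
  have H: "grouping_cost N (pos (?x y)) H = sel_cost N (pos (?x y)) t + ?CH" for y
  proof -
    have "(\<Sum>r\<in>H - {t}. sel_cost N (pos (?x y)) r) = ?CH"
      using t(2) by (intro sum.cong refl sel_cost_update_other) auto
    then show ?thesis unfolding grouping_cost_def using fin t by (simp add: sum.remove)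
  qed
  have identity: "(a\<^sup>2 + S1 - (a + S2)\<^sup>2 * u + (h\<^sup>2 + S3) - (h + S4)\<^sup>2 * n) / 2 + C
      - ((a\<^sup>2 + T1 - (a + T2)\<^sup>2 * v + (h\<^sup>2 + T3) - (h + T4)\<^sup>2 * n) / 2 + C')
    = (v - u) / 2 * a\<^sup>2 + (T2 * v - S2 * u) * a
      + (C - C' + (S1 - S2\<^sup>2 * u + S3 - S4\<^sup>2 * n) / 2 - (T1 - T2\<^sup>2 * v + T3 - T4\<^sup>2 * n) / 2)
      + (T4 - S4) * n * h" for a h S1 S2 S3 S4 T1 T2 T3 T4 C C'
    by (simp add: power2_eq_square field_simps)
  have diff: "grouping_cost N (pos (?x y)) G - grouping_cost N (pos (?x y)) H
      = ?a * (adv y)\<^sup>2 + ?b * adv y + ?d + ?c * hgt y" for y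
    unfolding G H sel_cost_def sel_sum_update[where s = s, OF i(1,2)] sel_sum_update[where s = t, OF i(1,3)] dv
    by (rule identity)
  show "AE y in lborel. (?x y) (i, l) \<noteq> None \<and> sel_sum N (pos (?x y)) hgt s \<noteq> sel_sum N (pos (?x y)) hgt t
      \<longrightarrow> grouping_cost N (pos (?x y)) G \<noteq> grouping_cost N (pos (?x y)) H"
  \<comment> \<open>Both selections contain y, so equal remaining heights mean equal height sums,
    and the implication is vacuous.\<close>
  proof (cases "?S hgt s = ?S hgt t")
    case True
    then show ?thesis
      by (simp add: sel_sum_update[where s = s, OF i(1,2)] sel_sum_update[where s = t, OF i(1,3)])
  next
    case False
    then have "?c \<noteq> 0" using N by (simp add: n_def)
    from null_quadratic[OF this, of ?a ?b ?d] show ?thesis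
    proof (rule eventually_mono)
      fix y assume "?a * (adv y)\<^sup>2 + ?b * adv y + ?d + ?c * hgt y \<noteq> 0"
      then show "(?x y) (i, l) \<noteq> None \<and> sel_sum N (pos (?x y)) hgt s \<noteq> sel_sum N (pos (?x y)) hgt t
          \<longrightarrow> grouping_cost N (pos (?x y)) G \<noteq> grouping_cost N (pos (?x y)) H"
        unfolding diff[symmetric] by simp
    qed
  qed
qed simp

lemma AE_generic:
  assumes N: "N \<ge> 1" and \<alpha>: "\<alpha> > 0" and fin: "\<forall>i<N. finite (L i)"
  shows "AE w in draw_measure \<alpha> c (SIGMA i:{..<N}. L i). generic N (survivors L w) (pos w)"
proof -
  let ?J = "SIGMA i:{..<N}. L i" and ?S = "survivors L"
  let ?D = "draw_measure \<alpha> c ?J" and ?sum = "\<lambda>w. sel_sum N (pos w) hgt" and ?cost = "\<lambda>w. grouping_cost N (pos w)"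
  let ?Sel = "{s. is_selection N L s}"
  \<comment> \<open>The survivors depend on the draw, but the null sets must be chosen beforehand. A
    grouping of survivors need not cover all of \<open>L\<close>; only the property that no label is
    used twice is kept, and the family stays finite.\<close>
  let ?Gr = "{G. G \<subseteq> ?Sel \<and> (\<forall>s\<in>G. \<forall>t\<in>G. \<forall>i l. s i = Some l \<longrightarrow> t i = Some l \<longrightarrow> s = t)}"
  have J: "finite ?J" using fin by auto
  have finS: "finite ?Sel" using finite_selections fin by blast
  have finG: "finite ?Gr" by (rule finite_subset[of _ "Pow ?Sel"]) (use finS in auto)
  have lab: "(i, l) \<in> ?J" if "s \<in> ?Sel" "s i = Some l" for s i l
    using selection_SomeD[of N L s i l] that by auto
  have 1: "AE w in ?D. \<forall>s\<in>?Sel. \<forall>t\<in>?Sel. \<forall>j\<in>?J.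
      s (fst j) = Some (snd j) \<and> t (fst j) \<noteq> Some (snd j) \<longrightarrow> w j \<noteq> None \<longrightarrow>
      ?sum w s \<noteq> ?sum w t"
  proof (intro AE_finite_allI J finS)
    fix s t j assume *: "s \<in> ?Sel" "t \<in> ?Sel" "j \<in> ?J"
    show "AE w in ?D. s (fst j) = Some (snd j) \<and> t (fst j) \<noteq> Some (snd j) \<longrightarrow> w j \<noteq> None \<longrightarrow>
      ?sum w s \<noteq> ?sum w t"
    proof (cases "s (fst j) = Some (snd j) \<and> t (fst j) \<noteq> Some (snd j)")
      case True
      have "AE w in ?D. w (fst j, snd j) \<noteq> None \<longrightarrow>
          ?sum w s \<noteq> ?sum w t"
        by (rule AE_sel_sum_neq[OF \<alpha> J]) (use True * lab in auto)
      then show ?thesis by (simp add: True)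
    qed auto
  qed
  have 2: "AE w in ?D. \<forall>G\<in>?Gr. \<forall>H\<in>?Gr. \<forall>s\<in>?Sel. \<forall>t\<in>?Sel. \<forall>j\<in>?J.
      s \<in> G \<and> t \<in> H \<and> s (fst j) = Some (snd j) \<and> t (fst j) = Some (snd j) \<longrightarrow>
      w j \<noteq> None \<and> ?sum w s \<noteq> ?sum w t \<longrightarrow>
      ?cost w G \<noteq> ?cost w H"
  proof (intro AE_finite_allI J finS finG)
    fix G H s t j assume *: "G \<in> ?Gr" "H \<in> ?Gr" "s \<in> ?Sel" "t \<in> ?Sel" "j \<in> ?J"
    show "AE w in ?D.
      s \<in> G \<and> t \<in> H \<and> s (fst j) = Some (snd j) \<and> t (fst j) = Some (snd j) \<longrightarrow>
      w j \<noteq> None \<and> ?sum w s \<noteq> ?sum w t \<longrightarrow>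
      ?cost w G \<noteq> ?cost w H"
    proof (cases "s \<in> G \<and> t \<in> H \<and> s (fst j) = Some (snd j) \<and> t (fst j) = Some (snd j)")
      case True
      have "finite G" "finite H" using * finS finite_subset by blast+
      have "AE w in ?D.
          w (fst j, snd j) \<noteq> None \<and> ?sum w s \<noteq> ?sum w t \<longrightarrow>
          ?cost w G \<noteq> ?cost w H"
      proof (rule AE_grouping_cost_neq[OF N \<alpha> J _ _ _ _ \<open>finite G\<close> \<open>finite H\<close>])
        show "r = s" if "r \<in> G" "r (fst j) = Some (snd j)" for r using that True * by blast
        show "r = t" if "r \<in> H" "r (fst j) = Some (snd j)" for r using that True * by blast
        show "(k, m) \<in> ?J" if "r \<in> G \<union> H" "k < N" "r k = Some m" for r k m
          using that * lab[of r k m] by blast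
      qed (use True * in auto)
      then show ?thesis by (simp add: True)
    qed auto
  qed
  show ?thesis
    using 1 2
  proof eventually_elim
    case (elim w)
    have sel: "s \<in> ?Sel" if "is_selection N (?S w) s" for s
      using is_selection_mono[OF that, of L] by (simp add: survivors_def)
    have surv: "(i, l) \<in> ?J" "w (i, l) \<noteq> None" if "is_selection N (?S w) s" "s i = Some l" for s i l
      using selection_SomeD[OF that] by (auto simp: survivors_def)
    have ne: "?sum w s \<noteq> ?sum w t"
      if st: "is_selection N (?S w) s" "is_selection N (?S w) t" "s i = Some l" "t i \<noteq> Some l" for s t i l
      using elim(1)[rule_format, OF sel[OF st(1)] sel[OF st(2)] surv(1)[OF st(1,3)]] st(3,4) surv(2)[OF st(1,3)]
      by simp
    have sums: "?sum w s \<noteq> ?sum w t"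
      if st: "is_selection N (?S w) s" "is_selection N (?S w) t" "s \<noteq> t" for s t
    proof -
      obtain i where i: "s i \<noteq> t i" using st(3) by (meson ext)
      show ?thesis
      proof (cases "s i")
        case (Some l)
        then show ?thesis using ne[OF st(1,2) Some] i by auto
      next
        case None
        then obtain l where "t i = Some l" using i by (cases "t i") auto
        then show ?thesis using ne[OF st(2,1)] None by force
      qed
    qed
    have costs: "?cost w G \<noteq> ?cost w H"
      if GH: "is_grouping N (?S w) G" "is_grouping N (?S w) H" "G \<noteq> H" for G H
    proof -
      have Gr: "G \<in> ?Gr" if "is_grouping N (?S w) G" for G
      proof -
        have "G \<subseteq> ?Sel" using that sel by (auto simp: is_grouping_def)
        then show ?thesis using grouping_unique[OF that] by blast
      qed
      obtain s where s: "s \<in> G" "s \<notin> H" using grouping_subset_eq[OF GH(1,2)] GH(3) by blast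
      obtain i l where il: "i < N" "s i = Some l" "l \<in> ?S w i" using grouping_obtain[OF GH(1) s(1)] .
      obtain t where t: "t \<in> H" "t i = Some l" using grouping_ex[OF GH(2) il(1,3)] by blast
      have S: "is_selection N (?S w) s" "is_selection N (?S w) t"
        using GH s t by (auto simp: is_grouping_def)
      have "s \<noteq> t" using s t by auto
      then show ?thesis
        using elim(2)[rule_format, OF Gr[OF GH(1)] Gr[OF GH(2)] sel[OF S(1)] sel[OF S(2)] surv(1)[OF S(1) il(2)]]
          s t il surv(2)[OF S(1) il(2)] sums[OF S] by simp
    qed
    show ?case
      unfolding generic_def
    proof (intro conjI allI impI)
      fix s t assume "is_selection N (?S w) s \<and> is_selection N (?S w) t \<and> s \<noteq> t"
      then show "?sum w s \<noteq> ?sum w t" by (intro sums) auto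
    next
      fix G H assume "is_grouping N (?S w) G \<and> is_grouping N (?S w) H \<and> G \<noteq> H"
      then show "?cost w G \<noteq> ?cost w H" by (intro costs) auto
    qed
  qed
qed

lemma AE_above:
  assumes \<alpha>: "\<alpha> > 0" and fin: "\<forall>i<N. finite (L i)"
    and c: "\<forall>i<N. \<forall>l\<in>L i. 0 < hgt (c (i, l))"
  shows "AE w in draw_measure \<alpha> c (SIGMA i:{..<N}. L i). above N (survivors L w) (pos w)"
proof -
  let ?J = "SIGMA i:{..<N}. L i"
  have "AE w in draw_measure \<alpha> c ?J. \<forall>j\<in>?J. w j \<noteq> None \<longrightarrow> 0 < hgt (the (w j))"
  proof (rule AE_finite_allI)
    show "finite ?J" using fin by auto
    fix j assume j: "j \<in> ?J"
    have m: "Measurable.pred option_borel (\<lambda>z. z \<noteq> None \<longrightarrow> 0 < hgt (the z))"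
      by measurable
    \<comment> \<open>A nonpositive height would put y at least as far from \<open>c j\<close> as
      the diagonal is.\<close>
    have "0 < hgt y" if y: "y \<in> ball (c j) (infdist (c j) diagonal)" for y
    proof (rule ccontr)
      assume "\<not> 0 < hgt y"
      moreover have "0 < hgt (c j)" using c j by auto
      ultimately have "(hgt (c j))\<^sup>2 \<le> (hgt (c j) - hgt y)\<^sup>2" by (intro power_mono) auto
      then have "(infdist (c j) diagonal)\<^sup>2 \<le> (norm (c j - y))\<^sup>2"
        unfolding infdist_diagonal_sq norm_diff_sq by (simp add: add_increasing)
      then have "infdist (c j) diagonal \<le> norm (c j - y)" by (rule power2_le_imp_le) simp
      then show False using y by (simp add: dist_norm)
    qed
    then have "AE z in perturbation \<alpha> (c j). z \<noteq> None \<longrightarrow> 0 < hgt (the z)"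
      using m by (intro AE_perturbation[OF \<alpha>]) auto
    then show "AE w in draw_measure \<alpha> c ?J. w j \<noteq> None \<longrightarrow> 0 < hgt (the (w j))"
      using prob_space_perturbation[OF \<alpha>] j by (intro AE_PiM_component) auto
  qed
  then show ?thesis
    by (rule eventually_mono) (auto simp: above_def survivors_def pos_def)
qed

text \<open>A draw induces at most one grouping, and almost surely it induces one. Total mass 1
  makes the mean a probability measure and lets one-sided bounds suffice for the coupling.\<close>

lemma sum_prob_induces:
  assumes N: "N \<ge> 1" and \<alpha>: "\<alpha> > 0" and fin: "\<forall>i<N. finite (L i)"
    and c: "\<forall>i<N. \<forall>l\<in>L i. 0 < hgt (c (i, l))"
  defines "D \<equiv> draw_measure \<alpha> c (SIGMA i:{..<N}. L i)"
  shows "(\<Sum>G | is_grouping N L G. measure D {w \<in> space D. induces N L w G}) = 1"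
proof -
  interpret prob_space D
    unfolding D_def by (intro prob_space_PiM prob_space_perturbation[OF \<alpha>])
  have m: "{w \<in> space D. induces N L w G} \<in> sets D" for G
  proof -
    have "Measurable.pred D (\<lambda>w. induces N L w G)"
      using measurable_induces[OF N fin] measurable_cong_sets[OF sets_draw_measure refl]
      unfolding D_def by blast
    then show ?thesis by measurable
  qed
  have "(\<Sum>G | is_grouping N L G. measure D {w \<in> space D. induces N L w G})
      = measure D (\<Union>G\<in>{G. is_grouping N L G}. {w \<in> space D. induces N L w G})"
  proof (intro finite_measure_finite_Union[symmetric])
    show "disjoint_family_on (\<lambda>G. {w \<in> space D. induces N L w G}) {G. is_grouping N L G}"
      unfolding disjoint_family_on_def using induces_unique by blast
  qed (use m finite_groupings[of N L] fin in auto)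
  also have "\<dots> = 1"
  proof (intro prob_eq_1[THEN iffD2])
    show "(\<Union>G\<in>{G. is_grouping N L G}. {w \<in> space D. induces N L w G}) \<in> sets D"
      using m finite_groupings[of N L] fin by (intro sets.finite_UN) auto
    have "AE w in D. generic N (survivors L w) (pos w) \<and> above N (survivors L w) (pos w) \<and> w \<in> space D"
      using AE_generic[OF N \<alpha> fin, of c] AE_above[OF \<alpha> fin c] unfolding D_def by auto
    then show "AE w in D. w \<in> (\<Union>G\<in>{G. is_grouping N L G}. {w \<in> space D. induces N L w G})"
    proof (rule eventually_mono)
      fix w assume w: "generic N (survivors L w) (pos w) \<and> above N (survivors L w) (pos w) \<and> w \<in> space D"
      then obtain G where "induces N L w G" using ex_induces[OF N fin] by blast
      then show "w \<in> (\<Union>G\<in>{G. is_grouping N L G}. {w \<in> space D. induces N L w G})"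
        using w induces_grouping by blast
    qed
  qed
  finally show ?thesis .
qed

section \<open>Transferring groupings along a matching\<close>

text \<open>Choosing a label from each selection is injective. This bounds the number of points of a
  mean by N K.\<close>

lemma card_grouping_le:
  assumes fin: "\<forall>i<N. finite (L i)" and G: "is_grouping N L G"
  shows "card G \<le> (\<Sum>i<N. card (L i))"
proof -
  have "\<exists>j. j \<in> (SIGMA i:{..<N}. L i) \<and> s (fst j) = Some (snd j)" if s: "s \<in> G" for s
  proof -
    obtain i l where "i < N" "s i = Some l" "l \<in> L i" using G s by (rule grouping_obtain)
    then show ?thesis by (intro exI[of _ "(i, l)"]) auto
  qed
  then obtain j where j: "\<And>s. s \<in> G \<Longrightarrow> j s \<in> (SIGMA i:{..<N}. L i) \<and> s (fst (j s)) = Some (snd (j s))"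
    by metis
  have "card G \<le> card (SIGMA i:{..<N}. L i)"
  proof (rule card_inj_on_le)
    show "inj_on j G"
    proof (rule inj_onI)
      fix s t assume st: "s \<in> G" "t \<in> G" "j s = j t"
      then show "s = t" using grouping_unique[OF G st(1,2)] j[OF st(1)] j[OF st(2)] by metis
    qed
    show "j ` G \<subseteq> (SIGMA i:{..<N}. L i)" using j by blast
    show "finite (SIGMA i:{..<N}. L i)" using fin by auto
  qed
  also have "\<dots> = (\<Sum>i<N. card (L i))" using fin by (intro card_SigmaI) auto
  finally show ?thesis .
qed

definition unmatched :: "nat \<Rightarrow> (nat \<Rightarrow> 'l set) \<Rightarrow> (nat \<Rightarrow> 'm set) \<Rightarrow> (nat \<Rightarrow> 'l \<Rightarrow> 'm) \<Rightarrow> (nat \<times> 'm) set" where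
  "unmatched N L L' e = (SIGMA i:{..<N}. L' i - e i ` L i)"

text \<open>\<open>L\<close> belongs to the fixed diagrams and \<open>L'\<close> to nearby ones.
  Points of \<open>L'\<close> without a partner lie near the diagonal and are likely to be dropped,
  and dropped points form trivial selections.\<close>

definition transfer :: "nat \<Rightarrow> (nat \<Rightarrow> 'l set) \<Rightarrow> (nat \<Rightarrow> 'm set) \<Rightarrow> (nat \<Rightarrow> 'l \<Rightarrow> 'm) \<Rightarrow>
    'l selection set \<Rightarrow> 'm selection set" where
  "transfer N L L' e G = relabel e ` G \<union> (\<lambda>(i, m). trivial_selection i m) ` unmatched N L L' e"

lemma relabel_not_unmatched:
  assumes "is_selection N L s" "(i, m) \<in> unmatched N L L' e"
  shows "relabel e s \<noteq> trivial_selection i m"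
proof
  assume "relabel e s = trivial_selection i m"
  then have "relabel e s i = Some m" by (simp add: trivial_selection_eq_Some)
  then obtain l where "s i = Some l" "m = e i l" by (auto simp: relabel_Some)
  then show False using selection_SomeD[OF assms(1)] assms(2) by (auto simp: unmatched_def)
qed

lemma is_grouping_transfer:
  assumes e: "\<forall>i<N. inj_on (e i) (L i)" "\<forall>i<N. e i ` L i \<subseteq> L' i" and G: "is_grouping N L G"
  shows "is_grouping N L' (transfer N L L' e G)"
proof -
  \<comment> \<open>An artificial draw whose survivors are the matched labels, so that
    \<open>is_grouping_lift\<close> adds the trivial selections; the origin is an arbitrary
    position.\<close>
  define w where "w = (\<lambda>(i, m). if m \<in> e i ` L i then Some (0 :: real, 0 :: real) else None)"
  have A: "is_grouping N (\<lambda>i. e i ` L i) (relabel e ` G)"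
    using is_grouping_relabel[OF e(1), of "\<lambda>i. e i ` L i" G] G by (auto simp: is_grouping_def)
  have B: "\<forall>i<N. e i ` L i = survivors L' w i"
    using e(2) by (auto simp: survivors_def w_def)
  have "is_grouping N (survivors L' w) (relabel e ` G)"
    by (rule iffD1[OF is_grouping_cong[OF B] A])
  from is_grouping_lift[OF this] have "is_grouping N L' (relabel e ` G \<union> dropped N L' w)" .
  moreover have "dropped N L' w = (\<lambda>(i, m). trivial_selection i m) ` unmatched N L L' e"
  proof (intro equalityI subsetI)
    fix s assume "s \<in> dropped N L' w"
    then obtain i m where "s = trivial_selection i m" "i < N" "m \<in> L' i" "w (i, m) = None"
      by (auto simp: dropped_def)
    then have "s = trivial_selection i m" "(i, m) \<in> unmatched N L L' e"
      by (auto simp: w_def unmatched_def)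
    then show "s \<in> (\<lambda>(i, m). trivial_selection i m) ` unmatched N L L' e" by force
  next
    fix s assume "s \<in> (\<lambda>(i, m). trivial_selection i m) ` unmatched N L L' e"
    then obtain i m where im: "s = trivial_selection i m" "(i, m) \<in> unmatched N L L' e" by auto
    then have "i < N" "m \<in> L' i" "w (i, m) = None" by (auto simp: w_def unmatched_def)
    then show "s \<in> dropped N L' w" using im(1) unfolding dropped_def by blast
  qed
  ultimately show ?thesis by (simp add: transfer_def)
qed

lemma inj_on_transfer:
  assumes e: "\<forall>i<N. inj_on (e i) (L i)"
  shows "inj_on (transfer N L L' e) {G. is_grouping N L G}"
proof (rule inj_onI)
  have sub: "G \<subseteq> H" if G: "is_grouping N L G" and H: "is_grouping N L H"
    and eq: "transfer N L L' e G = transfer N L L' e H" for G H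
  proof
    fix s assume s: "s \<in> G"
    then have sel: "is_selection N L s" using G by (auto simp: is_grouping_def)
    have "relabel e s \<in> transfer N L L' e H" using s eq by (auto simp: transfer_def)
    then obtain t where t: "t \<in> H" "relabel e s = relabel e t"
      using relabel_not_unmatched[OF sel] by (force simp: transfer_def)
    then have "s = t" using relabel_inj[OF e sel] H by (auto simp: is_grouping_def)
    then show "s \<in> H" using t by simp
  qed
  fix G H assume "G \<in> {G. is_grouping N L G}" "H \<in> {G. is_grouping N L G}"
    "transfer N L L' e G = transfer N L L' e H"
  then show "G = H" using sub[of G H] sub[of H G] by simp
qed

lemma relabel_trivial: "relabel e (trivial_selection i l) = trivial_selection i (e i l)"
  by (auto simp: relabel_def trivial_selection_def)

text \<open>If the unmatched points are dropped, the surviving configurations agree up to names,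
  hence so do their optimal groupings. The dropped points of \<open>w'\<close> are the images of
  those of \<open>w\<close> and the unmatched ones.\<close>

lemma induces_transfer:
  assumes e: "\<forall>i<N. inj_on (e i) (L i)" "\<forall>i<N. e i ` L i \<subseteq> L' i"
    and w: "\<forall>i<N. \<forall>l\<in>L i. w (i, l) = w' (i, e i l)" "\<forall>j\<in>unmatched N L L' e. w' j = None"
    and ind: "induces N L w G"
  shows "induces N L' w' (transfer N L L' e G)"
proof -
  obtain G0 where opt: "\<And>H. optimal_grouping N (survivors L w) (pos w) H \<longleftrightarrow> H = G0"
    and G: "G0 \<union> dropped N L w = G" and ab: "above N (survivors L w) (pos w)"
    using ind unfolding induces_def by metis
  have S: "\<forall>i<N. survivors L' w' i = e i ` survivors L w i"
  proof (intro allI impI)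
    fix i assume i: "i < N"
    have "m \<in> e i ` L i" if "m \<in> L' i" "w' (i, m) \<noteq> None" for m
      using w(2)[rule_format, of "(i, m)"] that i by (auto simp: unmatched_def)
    moreover have "w' (i, e i l) = w (i, l)" if "l \<in> L i" for l using w(1) i that by simp
    moreover have "e i ` L i \<subseteq> L' i" using e(2) i by simp
    ultimately show "survivors L' w' i = e i ` survivors L w i"
      unfolding survivors_def by fastforce
  qed
  have inj: "\<forall>i<N. inj_on (e i) (survivors L w i)"
    using e(1) by (auto simp: survivors_def intro: inj_on_subset)
  have p: "\<forall>i<N. \<forall>l\<in>survivors L w i. pos w' i (e i l) = pos w i l"
    using w(1) by (simp add: survivors_def pos_def)
  have ab': "above N (survivors L' w') (pos w')"
    using ab S p by (auto simp: above_def)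
  have sel: "\<forall>s\<in>H. is_selection N (survivors L w) s" if "is_grouping N (survivors L w) H" for H
    using that by (auto simp: is_grouping_def)
  have G0: "is_grouping N (survivors L w) G0" using opt[of G0] by (simp add: optimal_grouping_def)
  have "optimal_grouping N (survivors L' w') (pos w') H' \<longleftrightarrow> H' = relabel e ` G0" for H'
  proof
    assume H': "optimal_grouping N (survivors L' w') (pos w') H'"
    then have "is_grouping N (survivors L' w') H'" by (simp add: optimal_grouping_def)
    then obtain H where H: "is_grouping N (survivors L w) H" "H' = relabel e ` H"
      using ex_grouping_relabel[OF inj S] by blast
    then show "H' = relabel e ` G0"
      using optimal_grouping_relabel[OF inj S p sel[OF H(1)]] H' opt by simp
  next
    assume "H' = relabel e ` G0"
    then show "optimal_grouping N (survivors L' w') (pos w') H'"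
      using optimal_grouping_relabel[OF inj S p sel[OF G0]] opt by simp
  qed
  moreover have "relabel e ` G0 \<union> dropped N L' w' = transfer N L L' e G"
  proof -
    have "dropped N L' w' = relabel e ` dropped N L w
        \<union> (\<lambda>(i, m). trivial_selection i m) ` unmatched N L L' e" (is "?A = ?B \<union> ?C")
    proof (intro equalityI subsetI)
      fix s assume "s \<in> ?A"
      then obtain i m where im: "s = trivial_selection i m" "i < N" "m \<in> L' i" "w' (i, m) = None"
        by (auto simp: dropped_def)
      show "s \<in> ?B \<union> ?C"
      proof (cases "m \<in> e i ` L i")
        case True
        then obtain l where "l \<in> L i" "m = e i l" by blast
        then have "w (i, l) = None" "s = relabel e (trivial_selection i l)"
          using im w(1) by (auto simp: relabel_trivial)
        moreover from this have "trivial_selection i l \<in> dropped N L w"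
          using im(2) \<open>l \<in> L i\<close> unfolding dropped_def by blast
        ultimately have "trivial_selection i l \<in> dropped N L w" "s = relabel e (trivial_selection i l)"
          by simp_all
        then show ?thesis by blast
      next
        case False
        then have "(i, m) \<in> unmatched N L L' e" using im by (simp add: unmatched_def)
        then show ?thesis using im(1) by force
      qed
    next
      fix s assume "s \<in> ?B \<union> ?C"
      then show "s \<in> ?A"
      proof
        assume "s \<in> ?B"
        then obtain i l where il: "s = relabel e (trivial_selection i l)" "i < N" "l \<in> L i" "w (i, l) = None"
          by (auto simp: dropped_def)
        then have "s = trivial_selection i (e i l)" "e i l \<in> L' i" "w' (i, e i l) = None"
          using e(2) w(1) by (auto simp: relabel_trivial)
        then show ?thesis using il(2) unfolding dropped_def by blast
      next
        assume "s \<in> ?C"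
        then obtain i m where "(i, m) \<in> unmatched N L L' e" "s = trivial_selection i m" by auto
        then show ?thesis using w(2) unfolding dropped_def unmatched_def by blast
      qed
    qed
    then show ?thesis unfolding transfer_def G[symmetric] image_Un by blast
  qed
  ultimately show ?thesis unfolding induces_def using ab' by blast
qed

text \<open>Two sources of error. Moving the matched points from \<open>c\<close> to
  \<open>c'\<close> costs 6 \<epsilon> / \<alpha> for each of them; each unmatched point survives
  with probability at most \<epsilon>^2 / \<alpha>^2. Both are bounded through the size of
  \<open>J'\<close>, independently of \<open>G\<close>.\<close>

lemma measure_induces_le:
  fixes L :: "nat \<Rightarrow> 'l set" and L' :: "nat \<Rightarrow> 'm set"
  assumes N: "N \<ge> 1" and \<alpha>: "\<alpha> > 0" and fin: "\<forall>i<N. finite (L i)" "\<forall>i<N. finite (L' i)"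
    and e: "\<forall>i<N. inj_on (e i) (L i)" "\<forall>i<N. e i ` L i \<subseteq> L' i"
    and close: "\<forall>i<N. \<forall>l\<in>L i. norm (c (i, l) - c' (i, e i l)) \<le> \<epsilon>"
    and near: "\<forall>j\<in>unmatched N L L' e. infdist (c' j) diagonal \<le> \<epsilon>"
    and \<epsilon>: "\<epsilon> \<ge> 0"
  defines "J \<equiv> SIGMA i:{..<N}. L i" and "J' \<equiv> SIGMA i:{..<N}. L' i"
  shows "measure (draw_measure \<alpha> c J) {w \<in> space (draw_measure \<alpha> c J). induces N L w G}
    \<le> measure (draw_measure \<alpha> c' J') {w \<in> space (draw_measure \<alpha> c' J'). induces N L' w (transfer N L L' e G)}
      + card J' * (6 * \<epsilon> / \<alpha>) + card J' * (\<epsilon>\<^sup>2 / \<alpha>\<^sup>2)"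
proof -
  have finJ: "finite J" "finite J'" using fin by (auto simp: J_def J'_def)
  let ?f = "\<lambda>(i, l). (i, e i l)" and ?R = "unmatched N L L' e"
  let ?D = "draw_measure \<alpha> c J" and ?D' = "draw_measure \<alpha> c' J'" and ?D'' = "draw_measure \<alpha> (c' \<circ> ?f) J"
  let ?r = "\<lambda>w. \<lambda>j\<in>J. w (?f j)"
  have f: "inj_on ?f J" "?f \<in> J \<rightarrow> J'"
    using e(1) image_subset_iff[THEN iffD1, OF e(2)[rule_format]]
    by (auto simp: J_def J'_def inj_on_def)
  have R: "?R \<subseteq> J'" by (auto simp: unmatched_def J'_def)
  interpret D: prob_space ?D by (intro prob_space_PiM prob_space_perturbation[OF \<alpha>])
  interpret D': prob_space ?D' by (intro prob_space_PiM prob_space_perturbation[OF \<alpha>])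
  define E where "E = {w \<in> space (option_draws J). induces N L w G}"
  define E' where "E' = {w \<in> space (option_draws J'). induces N L' w (transfer N L L' e G)}"
  have E: "E \<in> sets (option_draws J)"
    using measurable_induces[OF N fin(1), of G] unfolding E_def J_def pred_def .
  have E': "E' \<in> sets (option_draws J')"
    using measurable_induces[OF N fin(2)] unfolding E'_def J'_def pred_def by blast
  have space: "space (draw_measure \<alpha> c0 I) = space (option_draws I)" for c0 and I :: "'b set"
    by (rule sets_eq_imp_space_eq[OF sets_draw_measure])
  have finR: "finite ?R" using R finJ(2) finite_subset by blast
  have mE': "E' \<in> sets ?D'" using E' sets_draw_measure by blast
  have comp: "(\<lambda>w. w j) \<in> ?D' \<rightarrow>\<^sub>M perturbation \<alpha> (c' j)" if "j \<in> ?R" for j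
    using that R by (intro measurable_component_singleton) auto
  have mR: "{w \<in> space ?D'. w j \<noteq> None} \<in> sets ?D'" if "j \<in> ?R" for j
  proof -
    have "(\<lambda>w. w j) -` {z. z \<noteq> None} \<inter> space ?D' \<in> sets ?D'"
      using sets_not_None by (intro measurable_sets[OF comp[OF that]]) simp
    moreover have "(\<lambda>w. w j) -` {z. z \<noteq> None} \<inter> space ?D' = {w \<in> space ?D'. w j \<noteq> None}" by blast
    ultimately show ?thesis by simp
  qed
  have "emeasure ?D E = (\<integral>\<^sup>+w. indicator E w \<partial>?D)"
    using E sets_draw_measure by (intro nn_integral_indicator[symmetric]) blast
  also have "\<dots> \<le> (\<integral>\<^sup>+w. indicator E w \<partial>?D'') + (\<Sum>j\<in>J. ennreal (6 * \<epsilon> / \<alpha>))"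
  proof (rule nn_integral_PiM_close[OF prob_space_perturbation[OF \<alpha>] prob_space_perturbation[OF \<alpha>] _ _ finJ(1)])
    show "indicator E \<in> borel_measurable ?D"
      using E sets_draw_measure by (intro borel_measurable_indicator) blast
    show "indicator E x \<le> (1 :: ennreal)" for x by (auto split: split_indicator)
    fix j and g :: "point option \<Rightarrow> ennreal"
    assume j: "j \<in> J" and g: "g \<in> borel_measurable (perturbation \<alpha> (c j))" "\<And>z. g z \<le> 1"
    have "g \<in> borel_measurable option_borel" using g(1) measurable_cong_sets[OF sets_perturbation refl] by blast
    moreover have "norm (c j - (c' \<circ> ?f) j) \<le> \<epsilon>" using close j by (auto simp: J_def)
    ultimately show "(\<integral>\<^sup>+z. g z \<partial>perturbation \<alpha> (c j))
        \<le> (\<integral>\<^sup>+z. g z \<partial>perturbation \<alpha> ((c' \<circ> ?f) j)) + ennreal (6 * \<epsilon> / \<alpha>)"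
      using g(2) by (intro nn_integral_perturbation_close[OF \<alpha>])
  qed simp
  also have "(\<Sum>j\<in>J. ennreal (6 * \<epsilon> / \<alpha>)) = ennreal (card J * (6 * \<epsilon> / \<alpha>))"
    using \<alpha> \<epsilon> by (subst sum_ennreal) auto
  also have "(\<integral>\<^sup>+w. indicator E w \<partial>?D'') = emeasure ?D'' E"
    using E sets_draw_measure by (intro nn_integral_indicator) blast
  \<comment> \<open>The matched coordinates of a draw from \<open>?D'\<close>, read through the
    injection, have law \<open>?D''\<close>. Both events then live on the same space
    \<open>?D'\<close>.\<close>
  also have "emeasure ?D'' E = emeasure (distr ?D' ?D'' ?r) E"
    using distr_PiM_reindex[OF prob_space_perturbation[OF \<alpha>] f, of "\<lambda>j. c' j"]
    by (simp add: comp_def case_prod_beta)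
  also have "\<dots> = emeasure ?D' (?r -` E \<inter> space ?D')"
  proof (rule emeasure_distr)
    show "?r \<in> ?D' \<rightarrow>\<^sub>M ?D''"
    proof (rule measurable_restrict)
      fix j assume "j \<in> J"
      then have "?f j \<in> J'" using f(2) by auto
      then show "(\<lambda>w. w (?f j)) \<in> ?D' \<rightarrow>\<^sub>M perturbation \<alpha> ((c' \<circ> ?f) j)"
        unfolding comp_def by (rule measurable_component_singleton)
    qed
    show "E \<in> sets ?D''" using E sets_draw_measure by blast
  qed
  also have "\<dots> \<le> emeasure ?D' (E' \<union> (\<Union>j\<in>?R. {w \<in> space ?D'. w j \<noteq> None}))"
  proof (rule emeasure_mono)
    show "?r -` E \<inter> space ?D' \<subseteq> E' \<union> (\<Union>j\<in>?R. {w \<in> space ?D'. w j \<noteq> None})"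
    proof
      fix w assume w: "w \<in> ?r -` E \<inter> space ?D'"
      show "w \<in> E' \<union> (\<Union>j\<in>?R. {w \<in> space ?D'. w j \<noteq> None})"
      proof (cases "\<forall>j\<in>?R. w j = None")
        case True
        have "induces N L (?r w) G" using w by (simp add: E_def)
        then have "induces N L' w (transfer N L L' e G)"
          by (intro induces_transfer[OF e _ True]) (auto simp: J_def)
        then show ?thesis using w by (simp add: E'_def space)
      qed (use w in blast)
    qed
    show "E' \<union> (\<Union>j\<in>?R. {w \<in> space ?D'. w j \<noteq> None}) \<in> sets ?D'"
      using mE' mR finR by (intro sets.Un sets.finite_UN)
  qed
  also have "\<dots> \<le> emeasure ?D' E' + emeasure ?D' (\<Union>j\<in>?R. {w \<in> space ?D'. w j \<noteq> None})"
    using mE' mR finR by (intro emeasure_subadditive sets.finite_UN)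
  also have "emeasure ?D' (\<Union>j\<in>?R. {w \<in> space ?D'. w j \<noteq> None})
      \<le> (\<Sum>j\<in>?R. emeasure ?D' {w \<in> space ?D'. w j \<noteq> None})"
    using mR finR by (intro emeasure_subadditive_finite) auto
  also have "\<dots> \<le> (\<Sum>j\<in>?R. ennreal (\<epsilon>\<^sup>2 / \<alpha>\<^sup>2))"
  proof (rule sum_mono)
    fix j assume j: "j \<in> ?R"
    have "emeasure ?D' {w \<in> space ?D'. w j \<noteq> None}
        = emeasure (distr ?D' (perturbation \<alpha> (c' j)) (\<lambda>w. w j)) {z. z \<noteq> None}"
      using comp[OF j] sets_not_None by (subst emeasure_distr) (auto intro: arg_cong[where f = "emeasure ?D'"])
    also have "distr ?D' (perturbation \<alpha> (c' j)) (\<lambda>w. w j) = perturbation \<alpha> (c' j)"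
      using j R prob_space_perturbation[OF \<alpha>] by (intro distr_PiM_component) auto
    also have "emeasure (perturbation \<alpha> (c' j)) {z. z \<noteq> None} \<le> ennreal ((infdist (c' j) diagonal)\<^sup>2 / \<alpha>\<^sup>2)"
      by (rule emeasure_perturbation_Some[OF \<alpha>])
    also have "\<dots> \<le> ennreal (\<epsilon>\<^sup>2 / \<alpha>\<^sup>2)"
      using near j by (intro ennreal_leI divide_right_mono power_mono) (auto simp: infdist_nonneg)
    finally show "emeasure ?D' {w \<in> space ?D'. w j \<noteq> None} \<le> ennreal (\<epsilon>\<^sup>2 / \<alpha>\<^sup>2)" .
  qed
  also have "(\<Sum>j\<in>?R. ennreal (\<epsilon>\<^sup>2 / \<alpha>\<^sup>2)) = ennreal (card ?R * (\<epsilon>\<^sup>2 / \<alpha>\<^sup>2))"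
    by (subst sum_ennreal) auto
  finally have "emeasure ?D E \<le> emeasure ?D' E' + ennreal (card ?R * (\<epsilon>\<^sup>2 / \<alpha>\<^sup>2)) + ennreal (card J * (6 * \<epsilon> / \<alpha>))"
    by (simp add: add_right_mono add_left_mono)
  also have "\<dots> = ennreal (measure ?D' E' + card ?R * (\<epsilon>\<^sup>2 / \<alpha>\<^sup>2) + card J * (6 * \<epsilon> / \<alpha>))"
    using \<alpha> \<epsilon> by (simp add: D'.emeasure_eq_measure ennreal_plus)
  finally have "ennreal (measure ?D E)
      \<le> ennreal (measure ?D' E' + card ?R * (\<epsilon>\<^sup>2 / \<alpha>\<^sup>2) + card J * (6 * \<epsilon> / \<alpha>))"
    unfolding D.emeasure_eq_measure .
  then have "measure ?D E \<le> measure ?D' E' + card ?R * (\<epsilon>\<^sup>2 / \<alpha>\<^sup>2) + card J * (6 * \<epsilon> / \<alpha>)"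
    using \<alpha> \<epsilon> by (subst (asm) ennreal_le_iff) (auto intro!: add_nonneg_nonneg)
  moreover have "card ?R * (\<epsilon>\<^sup>2 / \<alpha>\<^sup>2) \<le> card J' * (\<epsilon>\<^sup>2 / \<alpha>\<^sup>2)"
    using card_mono[OF finJ(2) R] by (intro mult_right_mono) auto
  moreover have "card J * (6 * \<epsilon> / \<alpha>) \<le> card J' * (6 * \<epsilon> / \<alpha>)"
    using card_inj_on_le[OF f(1) _ finJ(2)] f(2) \<alpha> \<epsilon> by (intro mult_right_mono) auto
  ultimately have "measure ?D E \<le> measure ?D' E' + card J' * (6 * \<epsilon> / \<alpha>) + card J' * (\<epsilon>\<^sup>2 / \<alpha>\<^sup>2)"
    by linarith
  then show ?thesis unfolding E_def E'_def space .
qed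

section \<open>Distance between the means of a grouping and of its transfer\<close>

lemma sel_sum_relabel: "sel_sum N q f (relabel e s) = sel_sum N (\<lambda>i l. q i (e i l)) f s"
  unfolding sel_sum_def relabel_def by (intro sum.cong) (auto split: option.splits)

lemma sel_card_relabel: "sel_card N (relabel e s) = sel_card N s"
  unfolding sel_card_def relabel_def by (intro sum.cong) (auto split: option.splits)

lemma mean_pt_relabel: "mean_pt N q (relabel e s) = mean_pt N (\<lambda>i l. q i (e i l)) s"
  by (simp add: mean_pt_def sel_sum_relabel sel_card_relabel)

lemma sel_sum_trivial: "i < N \<Longrightarrow> sel_sum N p f (trivial_selection i l) = f (p i l)"
  unfolding sel_sum_def by (subst sum.remove[of _ i]) (auto simp: trivial_selection_def intro!: sum.neutral)

text \<open>Each relabeled selection is matched with its original, whose mean is at squared distance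
  at most 4 \<epsilon>^2. The added trivial selections go to the diagonal: their means have 1 / N
  times the height of a point within \<epsilon> of it. Every selection thus pays at most 4
  \<epsilon>^2.\<close>

lemma W2_transfer_le:
  fixes \<epsilon> :: real
  assumes N: "N \<ge> 1" and fin: "\<forall>i<N. finite (L i)" "\<forall>i<N. finite (L' i)"
    and e: "\<forall>i<N. inj_on (e i) (L i)" "\<forall>i<N. e i ` L i \<subseteq> L' i"
    and ab: "above N L p" "above N L' q"
    and close: "\<forall>i<N. \<forall>l\<in>L i. norm (p i l - q i (e i l)) \<le> \<epsilon>"
    and near: "\<forall>(i, m)\<in>unmatched N L L' e. infdist (q i m) diagonal \<le> \<epsilon>"
    and \<epsilon>: "\<epsilon> \<ge> 0" and G: "is_grouping N L G"
  shows "(W2 (grouping_mean N q (transfer N L L' e G)) (grouping_mean N p G))\<^sup>2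
    \<le> ennreal ((\<Sum>i<N. card (L' i)) * (4 * \<epsilon>\<^sup>2))"
proof -
  let ?H = "transfer N L L' e G" and ?R = "unmatched N L L' e"
  note H = is_grouping_transfer[OF e G]
  obtain \<mu> where \<mu>: "labels (grouping_mean N q ?H) ?H \<mu> (mean_pt N q)"
    using ex_labels_grouping_mean[OF N fin(2) H ab(2)] by blast
  obtain \<nu> where \<nu>: "labels (grouping_mean N p G) G \<nu> (mean_pt N p)"
    using ex_labels_grouping_mean[OF N fin(1) G ab(1)] by blast
  let ?M = "(\<lambda>s. (relabel e s, s)) ` G"
  have sel: "is_selection N L s" if "s \<in> G" for s using G that by (auto simp: is_grouping_def)
  have injr: "inj_on (relabel e) G"
    using relabel_inj[OF e(1)] sel by (intro inj_onI) blast
  have M: "?M \<in> pmatch ?H G"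
    using injr by (auto simp: pmatch_def transfer_def inj_on_def)
  have fst: "fst ` ?M = relabel e ` G" and snd: "snd ` ?M = G" by force+
  have finH: "finite ?H" using finite_grouping[OF fin(2) H] .
  have c1: "(\<Sum>(a, b)\<in>?M. (norm (mean_pt N q a - mean_pt N p b))\<^sup>2) \<le> (\<Sum>s\<in>relabel e ` G. 4 * \<epsilon>\<^sup>2)"
  proof -
    have "(\<Sum>(a, b)\<in>?M. (norm (mean_pt N q a - mean_pt N p b))\<^sup>2)
        = (\<Sum>s\<in>G. (norm (mean_pt N q (relabel e s) - mean_pt N p s))\<^sup>2)"
      by (subst sum.reindex) (auto simp: inj_on_def)
    also have "\<dots> \<le> (\<Sum>s\<in>G. 4 * \<epsilon>\<^sup>2)"
    proof (rule sum_mono)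
      fix s assume "s \<in> G"
      have "norm (q i (e i l) - p i l) \<le> \<epsilon>" if "i < N" "s i = Some l" for i l
        using selection_SomeD[OF sel[OF \<open>s \<in> G\<close>] that(2)] close by (auto simp: norm_minus_commute)
      then show "(norm (mean_pt N q (relabel e s) - mean_pt N p s))\<^sup>2 \<le> 4 * \<epsilon>\<^sup>2"
        unfolding mean_pt_relabel using N \<epsilon> by (intro mean_pt_diff_sq_le)
    qed
    also have "\<dots> = (\<Sum>s\<in>relabel e ` G. 4 * \<epsilon>\<^sup>2)" using injr by (simp add: card_image)
    finally show ?thesis .
  qed
  have c2: "(\<Sum>a\<in>?H - fst ` ?M. (hgt (mean_pt N q a))\<^sup>2 / 2) \<le> (\<Sum>a\<in>?H - relabel e ` G. 4 * \<epsilon>\<^sup>2)"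
    unfolding fst
  proof (rule sum_mono)
    fix a assume "a \<in> ?H - relabel e ` G"
    then obtain i m where im: "(i, m) \<in> ?R" "a = trivial_selection i m" by (auto simp: transfer_def)
    then have i: "i < N" by (simp add: unmatched_def)
    have "infdist (q i m) diagonal \<le> \<epsilon>" using near im(1) by auto
    then have "(hgt (q i m))\<^sup>2 / 2 \<le> \<epsilon>\<^sup>2" using infdist_diagonal_le_iff[OF \<epsilon>] by simp
    moreover have "(hgt (mean_pt N q a))\<^sup>2 \<le> (hgt (q i m))\<^sup>2"
    proof -
      have "(hgt (mean_pt N q a))\<^sup>2 = (hgt (q i m))\<^sup>2 / (real N)\<^sup>2"
        unfolding im(2) hgt_mean_pt sel_sum_trivial[OF i] by (simp add: power_divide)
      also have "\<dots> \<le> (hgt (q i m))\<^sup>2 / 1"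
        using N by (intro divide_left_mono) auto
      finally show ?thesis by simp
    qed
    moreover have "0 \<le> \<epsilon>\<^sup>2" by simp
    ultimately show "(hgt (mean_pt N q a))\<^sup>2 / 2 \<le> 4 * \<epsilon>\<^sup>2" by linarith
  qed
  have "pm_cost ?H (mean_pt N q) G (mean_pt N p) ?M \<le> (\<Sum>a\<in>?H. 4 * \<epsilon>\<^sup>2)"
  proof -
    have "(\<Sum>a\<in>?H. 4 * \<epsilon>\<^sup>2) = (\<Sum>a\<in>?H - relabel e ` G. 4 * \<epsilon>\<^sup>2) + (\<Sum>a\<in>relabel e ` G. 4 * \<epsilon>\<^sup>2)"
      using finH by (intro sum.subset_diff) (auto simp: transfer_def)
    moreover have "pm_cost ?H (mean_pt N q) G (mean_pt N p) ?M
        = (\<Sum>(a, b)\<in>?M. (norm (mean_pt N q a - mean_pt N p b))\<^sup>2) + (\<Sum>a\<in>?H - fst ` ?M. (hgt (mean_pt N q a))\<^sup>2 / 2)"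
      unfolding pm_cost_def snd by simp
    ultimately show ?thesis using c1 c2 by linarith
  qed
  also have "\<dots> = card ?H * (4 * \<epsilon>\<^sup>2)" by simp
  also have "\<dots> \<le> (\<Sum>i<N. card (L' i)) * (4 * \<epsilon>\<^sup>2)"
    using card_grouping_le[OF fin(2) H] by (intro mult_right_mono of_nat_mono) auto
  finally have "pm_cost ?H (mean_pt N q) G (mean_pt N p) ?M \<le> (\<Sum>i<N. card (L' i)) * (4 * \<epsilon>\<^sup>2)" .
  then show ?thesis
    using W2_sq_le_pm_cost[OF \<mu> \<nu> M] by (meson ennreal_leI order_trans)
qed

section \<open>Finite couplings\<close>

lemma nn_integral_distr_le:
  assumes T: "T \<in> M \<rightarrow>\<^sub>M N"
  shows "(\<integral>\<^sup>+x. f x \<partial>distr M N T) \<le> (\<integral>\<^sup>+x. f (T x) \<partial>M)"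
  unfolding nn_integral_def[of "distr M N T"]
proof (rule SUP_least)
  fix g assume g: "g \<in> {g. simple_function (distr M N T) g \<and> g \<le> f}"
  then have m: "g \<in> borel_measurable (distr M N T)"
    by (intro borel_measurable_simple_function) simp
  have "integral\<^sup>S (distr M N T) g = (\<integral>\<^sup>+x. g x \<partial>distr M N T)"
    using g by (intro nn_integral_eq_simple_integral[symmetric]) simp
  also have "\<dots> = (\<integral>\<^sup>+x. g (T x) \<partial>M)"
    using T m by (rule nn_integral_distr)
  also have "\<dots> \<le> (\<integral>\<^sup>+x. f (T x) \<partial>M)"
    using g by (intro nn_integral_mono) (simp add: le_fun_def)
  finally show "integral\<^sup>S (distr M N T) g \<le> (\<integral>\<^sup>+x. f (T x) \<partial>M)" .
qed

text \<open>The mass \<open>min (a x) (b (\<psi> x))\<close> is kept on the graph of \<open>\<psi>\<close>; the remaining mass is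
  coupled independently.  If nothing remains, the division by zero yields \<open>0\<close>, as it should.\<close>

lemma ex_finite_coupling:
  fixes a :: "'a \<Rightarrow> real" and b :: "'b \<Rightarrow> real" and \<delta> :: real
  assumes fin: "finite A" "finite B" and nonneg: "\<And>x. x \<in> A \<Longrightarrow> 0 \<le> a x" "\<And>y. y \<in> B \<Longrightarrow> 0 \<le> b y"
    and sum: "sum a A = 1" "sum b B = 1"
    and \<psi>: "inj_on \<psi> A" "\<psi> ` A \<subseteq> B" and close: "\<And>x. x \<in> A \<Longrightarrow> a x \<le> b (\<psi> x) + \<delta>"
    and \<delta>: "\<delta> \<ge> 0"
  shows "\<exists>\<pi>. (\<forall>x\<in>A. \<forall>y\<in>B. 0 \<le> \<pi> x y) \<and> (\<forall>x\<in>A. (\<Sum>y\<in>B. \<pi> x y) = a x) \<and>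
    (\<forall>y\<in>B. (\<Sum>x\<in>A. \<pi> x y) = b y) \<and>
    (\<Sum>x\<in>A. \<Sum>y\<in>B. if y = \<psi> x then 0 else \<pi> x y) \<le> card A * \<delta>"
proof -
  define w where "w x = min (a x) (b (\<psi> x))" for x
  define v where "v y = (\<Sum>x\<in>A. if y = \<psi> x then w x else 0)" for y
  \<comment> \<open>The mass left over after the graph of \<open>\<psi>\<close> has taken its share;
    it is the same on both sides since both totals are 1.\<close>
  define r where "r = 1 - sum w A"
  define \<pi> where "\<pi> x y = (if y = \<psi> x then w x else 0) + (a x - w x) * (b y - v y) / r" for x y
  have \<psi>B: "\<psi> x \<in> B" if "x \<in> A" for x using \<psi>(2) that by auto
  have w: "0 \<le> w x" "w x \<le> a x" "w x \<le> b (\<psi> x)" if "x \<in> A" for x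
    using nonneg \<psi>B[OF that] that by (auto simp: w_def)
  have v_\<psi>: "v (\<psi> x) = w x" if "x \<in> A" for x
  proof -
    have "v (\<psi> x) = (\<Sum>x'\<in>A. if x' = x then w x' else 0)"
      unfolding v_def using \<psi>(1) that by (intro sum.cong) (auto simp: inj_on_def)
    then show ?thesis using fin that by simp
  qed
  have v_other: "v y = 0" if "y \<notin> \<psi> ` A" for y
    unfolding v_def using that by (intro sum.neutral) auto
  have vb: "v y \<le> b y" if "y \<in> B" for y
    using v_\<psi> v_other[of y] w(3) nonneg(2)[OF that] by (cases "y \<in> \<psi> ` A") auto
  have sum_v: "sum v B = sum w A"
  proof -
    have "sum v B = (\<Sum>x\<in>A. \<Sum>y\<in>B. if y = \<psi> x then w x else 0)"
      unfolding v_def by (rule sum.swap)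
    also have "\<dots> = sum w A" using fin \<psi>B by (intro sum.cong) auto
    finally show ?thesis .
  qed
  have rA: "(\<Sum>x\<in>A. a x - w x) = r" by (simp add: sum_subtractf sum r_def)
  have rB: "(\<Sum>y\<in>B. b y - v y) = r" by (simp add: sum_subtractf sum r_def sum_v)
  have r0: "0 \<le> r" unfolding rA[symmetric] using w by (intro sum_nonneg) simp
  have aw: "a x - w x = 0" if "r = 0" "x \<in> A" for x
    using sum_nonneg_eq_0_iff[OF fin(1), of "\<lambda>x. a x - w x"] w rA that by simp
  have bv: "b y - v y = 0" if "r = 0" "y \<in> B" for y
    using sum_nonneg_eq_0_iff[OF fin(2), of "\<lambda>y. b y - v y"] vb rB that by simp
  have row: "(\<Sum>y\<in>B. (a x - w x) * (b y - v y) / r) = a x - w x" if "x \<in> A" for x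
    using aw[OF _ that] by (cases "r = 0") (simp_all add: sum_divide_distrib[symmetric] sum_distrib_left[symmetric] rB)
  have col: "(\<Sum>x\<in>A. (a x - w x) * (b y - v y) / r) = b y - v y" if "y \<in> B" for y
    using bv[OF _ that] by (cases "r = 0") (simp_all add: sum_divide_distrib[symmetric] sum_distrib_right[symmetric] rA)
  have nn: "0 \<le> (a x - w x) * (b y - v y) / r" if "x \<in> A" "y \<in> B" for x y
    using w vb r0 that by (intro divide_nonneg_nonneg mult_nonneg_nonneg) auto
  \<comment> \<open>Off the graph only the independent part is present. Its total mass is the sum of
    the deficits a x - w x, each at most \<delta> by the one-sided hypothesis.\<close>
  have "(\<Sum>x\<in>A. \<Sum>y\<in>B. if y = \<psi> x then 0 else \<pi> x y) \<le> (\<Sum>x\<in>A. \<Sum>y\<in>B. (a x - w x) * (b y - v y) / r)"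
    using nn by (intro sum_mono) (auto simp: \<pi>_def)
  also have "\<dots> = (\<Sum>x\<in>A. a x - w x)" using row by (intro sum.cong) auto
  also have "\<dots> \<le> (\<Sum>x\<in>A. \<delta>)"
    using close \<delta> by (intro sum_mono) (force simp: w_def min_def)
  finally have off: "(\<Sum>x\<in>A. \<Sum>y\<in>B. if y = \<psi> x then 0 else \<pi> x y) \<le> card A * \<delta>" by simp
  show ?thesis
  proof (intro exI[of _ \<pi>] conjI ballI off)
    show "0 \<le> \<pi> x y" if "x \<in> A" "y \<in> B" for x y
      using nn[OF that] w[OF that(1)] by (simp add: \<pi>_def)
    show "(\<Sum>y\<in>B. \<pi> x y) = a x" if x: "x \<in> A" for x
      using fin \<psi>B[OF x] row[OF x] by (simp add: \<pi>_def sum.distrib)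
    show "(\<Sum>x\<in>A. \<pi> x y) = b y" if y: "y \<in> B" for y
      using col[OF y] by (simp add: \<pi>_def sum.distrib v_def)
  qed
qed


lemma distr_point_measure:
  assumes fin: "finite C" "finite A" and h: "h ` C \<subseteq> A"
    and fibres: "\<And>x. x \<in> A \<Longrightarrow> (\<Sum>z | z \<in> C \<and> h z = x. q z) = a x"
  shows "distr (point_measure C q) (point_measure A a) h = point_measure A a"
proof (rule measure_eqI)
  fix X assume "X \<in> sets (distr (point_measure C q) (point_measure A a) h)"
  then have X: "X \<subseteq> A" by (simp add: sets_point_measure)
  then have finX: "finite X" using fin(2) finite_subset by blast
  have "emeasure (distr (point_measure C q) (point_measure A a) h) X = emeasure (point_measure C q) (h -` X \<inter> C)"
    using X h by (subst emeasure_distr) (auto simp: measurable_point_measure_eq1 space_point_measure sets_point_measure)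
  also have "\<dots> = (\<Sum>z\<in>h -` X \<inter> C. q z)" using fin by (intro emeasure_point_measure_finite) auto
  also have "\<dots> = (\<Sum>x\<in>X. \<Sum>z | z \<in> h -` X \<inter> C \<and> h z = x. q z)"
    using fin finX by (intro sum.group[symmetric]) auto
  also have "\<dots> = (\<Sum>x\<in>X. \<Sum>z | z \<in> C \<and> h z = x. q z)" by (intro sum.cong) auto
  also have "\<dots> = (\<Sum>x\<in>X. a x)" using X fibres by (intro sum.cong) auto
  also have "\<dots> = emeasure (point_measure A a) X"
    using X fin by (simp add: emeasure_point_measure_finite)
  finally show "emeasure (distr (point_measure C q) (point_measure A a) h) X = emeasure (point_measure A a) X" .
qed simp

text \<open>The coupling is built on the finite index sets and then pushed forward to pairs of
  diagrams. Measurability is trivial on the discrete side, and several indices may yield the same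
  diagram.\<close>

lemma WW2_le_finite_coupling:
  fixes f :: "'a \<Rightarrow> diagram" and g :: "'b \<Rightarrow> diagram" and \<pi> :: "'a \<Rightarrow> 'b \<Rightarrow> real"
  assumes fin: "finite A" "finite B" and f: "f \<in> A \<rightarrow> space S" and g: "g \<in> B \<rightarrow> space S"
    and \<pi>: "\<And>x y. x \<in> A \<Longrightarrow> y \<in> B \<Longrightarrow> 0 \<le> \<pi> x y"
    and rows: "\<And>x. x \<in> A \<Longrightarrow> (\<Sum>y\<in>B. \<pi> x y) = a x"
    and cols: "\<And>y. y \<in> B \<Longrightarrow> (\<Sum>x\<in>A. \<pi> x y) = b y"
  defines "\<nu> \<equiv> distr (point_measure B (\<lambda>y. ennreal (b y))) S g"
    and "\<eta> \<equiv> distr (point_measure A (\<lambda>x. ennreal (a x))) S f"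
  shows "WW2 \<nu> \<eta> \<le> esqrt (\<Sum>x\<in>A. \<Sum>y\<in>B. ennreal (\<pi> x y) * (W2 (g y) (f x))\<^sup>2)"
proof -
  let ?Q = "point_measure (A \<times> B) (\<lambda>(x, y). ennreal (\<pi> x y))"
  let ?T = "\<lambda>(x, y). (g y, f x)"
  have finAB: "finite (A \<times> B)" using fin by simp
  have Qfst: "distr ?Q (point_measure A (\<lambda>x. ennreal (a x))) fst = point_measure A (\<lambda>x. ennreal (a x))"
  proof (rule distr_point_measure[OF finAB fin(1)])
    show "(\<Sum>z | z \<in> A \<times> B \<and> fst z = x. case z of (x, y) \<Rightarrow> ennreal (\<pi> x y)) = ennreal (a x)" if "x \<in> A" for x
    proof -
      have "{z. z \<in> A \<times> B \<and> fst z = x} = {x} \<times> B" using that by auto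
      then show ?thesis using \<pi> that rows by (simp add: sum.cartesian_product[symmetric] sum_ennreal)
    qed
  qed auto
  have Qsnd: "distr ?Q (point_measure B (\<lambda>y. ennreal (b y))) snd = point_measure B (\<lambda>y. ennreal (b y))"
  proof (rule distr_point_measure[OF finAB fin(2)])
    show "(\<Sum>z | z \<in> A \<times> B \<and> snd z = y. case z of (x, y) \<Rightarrow> ennreal (\<pi> x y)) = ennreal (b y)" if "y \<in> B" for y
    proof -
      have "{z. z \<in> A \<times> B \<and> snd z = y} = A \<times> {y}" using that by auto
      then show ?thesis using \<pi> that cols by (simp add: sum.cartesian_product[symmetric] sum_ennreal)
    qed
  qed auto
  have sets_\<nu>: "sets \<nu> = sets S" and sets_\<eta>: "sets \<eta> = sets S" by (simp_all add: \<nu>_def \<eta>_def)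
  have sp: "space \<nu> = space S" "space \<eta> = space S" by (simp_all add: \<nu>_def \<eta>_def)
  have mf: "f \<in> point_measure A (\<lambda>x. ennreal (a x)) \<rightarrow>\<^sub>M \<eta>"
    using f by (simp add: measurable_point_measure_eq1 sp)
  have mg: "g \<in> point_measure B (\<lambda>y. ennreal (b y)) \<rightarrow>\<^sub>M \<nu>"
    using g by (simp add: measurable_point_measure_eq1 sp)
  have mT: "?T \<in> ?Q \<rightarrow>\<^sub>M \<nu> \<Otimes>\<^sub>M \<eta>"
    using f g by (auto simp: measurable_point_measure_eq1 space_pair_measure sp)
  have m1: "fst \<in> ?Q \<rightarrow>\<^sub>M point_measure A (\<lambda>x. ennreal (a x))"
    and m2: "snd \<in> ?Q \<rightarrow>\<^sub>M point_measure B (\<lambda>y. ennreal (b y))"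
    by (auto simp: measurable_point_measure_eq1 space_point_measure)
  define \<rho> where "\<rho> = distr ?Q (\<nu> \<Otimes>\<^sub>M \<eta>) ?T"
  have "distr \<rho> \<nu> fst = distr ?Q \<nu> (g \<circ> snd)"
    unfolding \<rho>_def by (subst distr_distr[OF measurable_fst mT]) (simp add: comp_def case_prod_beta)
  also have "\<dots> = distr (point_measure B (\<lambda>y. ennreal (b y))) \<nu> g"
    by (simp only: distr_distr[OF mg m2, symmetric] Qsnd)
  also have "\<dots> = distr (point_measure B (\<lambda>y. ennreal (b y))) S g"
    by (rule distr_cong[OF refl sets_\<nu> refl])
  also have "\<dots> = \<nu>" unfolding \<nu>_def ..
  finally have 1: "distr \<rho> \<nu> fst = \<nu>" .
  have "distr \<rho> \<eta> snd = distr ?Q \<eta> (f \<circ> fst)"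
    unfolding \<rho>_def by (subst distr_distr[OF measurable_snd mT]) (simp add: comp_def case_prod_beta)
  also have "\<dots> = distr (point_measure A (\<lambda>x. ennreal (a x))) \<eta> f"
    by (simp only: distr_distr[OF mf m1, symmetric] Qfst)
  also have "\<dots> = distr (point_measure A (\<lambda>x. ennreal (a x))) S f"
    by (rule distr_cong[OF refl sets_\<eta> refl])
  also have "\<dots> = \<eta>" unfolding \<eta>_def ..
  finally have 2: "distr \<rho> \<eta> snd = \<eta>" .
  have "\<rho> \<in> couplings \<nu> \<eta>"
    unfolding couplings_def using 1 2 by (simp add: \<rho>_def)
  moreover have "(\<integral>\<^sup>+(U, V). (W2 U V)\<^sup>2 \<partial>\<rho>) \<le> (\<Sum>x\<in>A. \<Sum>y\<in>B. ennreal (\<pi> x y) * (W2 (g y) (f x))\<^sup>2)"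
  proof -
    have "(\<integral>\<^sup>+(U, V). (W2 U V)\<^sup>2 \<partial>\<rho>) \<le> (\<integral>\<^sup>+z. (case ?T z of (U, V) \<Rightarrow> (W2 U V)\<^sup>2) \<partial>?Q)"
      unfolding \<rho>_def by (rule nn_integral_distr_le[OF mT])
    also have "\<dots> = (\<Sum>z\<in>A \<times> B. (case z of (x, y) \<Rightarrow> ennreal (\<pi> x y)) * (case ?T z of (U, V) \<Rightarrow> (W2 U V)\<^sup>2))"
      using finAB by (subst nn_integral_point_measure_finite) (auto simp: mult.commute)
    also have "\<dots> = (\<Sum>(x, y)\<in>A \<times> B. ennreal (\<pi> x y) * (W2 (g y) (f x))\<^sup>2)"
      by (intro sum.cong) auto
    also have "\<dots> = (\<Sum>x\<in>A. \<Sum>y\<in>B. ennreal (\<pi> x y) * (W2 (g y) (f x))\<^sup>2)"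
      by (rule sum.cartesian_product[symmetric])
    finally show ?thesis .
  qed
  ultimately show ?thesis
    unfolding WW2_def by (intro esqrt_mono INF_lower2)
qed

text \<open>Mass at most 1 travels along \<open>\<psi>\<close> at squared cost c1; the rest, at most
  card A times \<delta>, travels at the crude cost c2.\<close>

lemma WW2_le_close:
  fixes f :: "'a \<Rightarrow> diagram" and g :: "'b \<Rightarrow> diagram" and \<delta> c1 c2 :: real
  assumes fin: "finite A" "finite B" and f: "f \<in> A \<rightarrow> space S" and g: "g \<in> B \<rightarrow> space S"
    and nonneg: "\<And>x. x \<in> A \<Longrightarrow> 0 \<le> a x" "\<And>y. y \<in> B \<Longrightarrow> 0 \<le> b y"
    and sum: "sum a A = 1" "sum b B = 1"
    and \<psi>: "inj_on \<psi> A" "\<psi> ` A \<subseteq> B" and close: "\<And>x. x \<in> A \<Longrightarrow> a x \<le> b (\<psi> x) + \<delta>"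
    and \<delta>: "0 \<le> \<delta>" "0 \<le> c1" "0 \<le> c2"
    and c1: "\<And>x. x \<in> A \<Longrightarrow> (W2 (g (\<psi> x)) (f x))\<^sup>2 \<le> ennreal c1"
    and c2: "\<And>x y. x \<in> A \<Longrightarrow> y \<in> B \<Longrightarrow> (W2 (g y) (f x))\<^sup>2 \<le> ennreal c2"
  shows "WW2 (distr (point_measure B (\<lambda>y. ennreal (b y))) S g) (distr (point_measure A (\<lambda>x. ennreal (a x))) S f)
    \<le> esqrt (ennreal (c1 + card A * \<delta> * c2))"
proof -
  obtain \<pi> where \<pi>: "\<forall>x\<in>A. \<forall>y\<in>B. 0 \<le> \<pi> x y" "\<forall>x\<in>A. (\<Sum>y\<in>B. \<pi> x y) = a x" "\<forall>y\<in>B. (\<Sum>x\<in>A. \<pi> x y) = b y"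
    "(\<Sum>x\<in>A. \<Sum>y\<in>B. if y = \<psi> x then 0 else \<pi> x y) \<le> card A * \<delta>"
    using ex_finite_coupling[of A B a b \<psi> \<delta>] fin nonneg sum \<psi> close \<delta>(1) by blast
  have "(\<Sum>x\<in>A. \<Sum>y\<in>B. ennreal (\<pi> x y) * (W2 (g y) (f x))\<^sup>2)
      \<le> (\<Sum>x\<in>A. \<Sum>y\<in>B. ennreal (\<pi> x y * c1 + (if y = \<psi> x then 0 else \<pi> x y) * c2))"
  proof (intro sum_mono)
    fix x y assume xy: "x \<in> A" "y \<in> B"
    have p: "0 \<le> \<pi> x y" using \<pi>(1) xy by simp
    show "ennreal (\<pi> x y) * (W2 (g y) (f x))\<^sup>2 \<le> ennreal (\<pi> x y * c1 + (if y = \<psi> x then 0 else \<pi> x y) * c2)"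
    proof (cases "y = \<psi> x")
      case True
      have "ennreal (\<pi> x y) * (W2 (g y) (f x))\<^sup>2 \<le> ennreal (\<pi> x y) * ennreal c1"
        using c1[OF xy(1)] True by (intro mult_left_mono) auto
      then show ?thesis using True p \<delta> by (simp add: ennreal_mult)
    next
      case False
      have "ennreal (\<pi> x y) * (W2 (g y) (f x))\<^sup>2 \<le> ennreal (\<pi> x y) * ennreal c2"
        using c2[OF xy] by (intro mult_left_mono) auto
      also have "\<dots> = ennreal (\<pi> x y * c2)" using p \<delta> by (simp add: ennreal_mult)
      also have "\<dots> \<le> ennreal (\<pi> x y * c1 + \<pi> x y * c2)" using p \<delta> by (intro ennreal_leI) simp
      finally show ?thesis using False by simp
    qed
  qed
  also have "\<dots> = ennreal (\<Sum>x\<in>A. \<Sum>y\<in>B. \<pi> x y * c1 + (if y = \<psi> x then 0 else \<pi> x y) * c2)"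
  proof -
    have nn: "0 \<le> \<pi> x y * c1 + (if y = \<psi> x then 0 else \<pi> x y) * c2" if "x \<in> A" "y \<in> B" for x y
      using \<pi>(1) \<delta> that by auto
    have "(\<Sum>x\<in>A. \<Sum>y\<in>B. ennreal (\<pi> x y * c1 + (if y = \<psi> x then 0 else \<pi> x y) * c2))
        = (\<Sum>x\<in>A. ennreal (\<Sum>y\<in>B. \<pi> x y * c1 + (if y = \<psi> x then 0 else \<pi> x y) * c2))"
      using nn by (intro sum.cong refl sum_ennreal)
    also have "\<dots> = ennreal (\<Sum>x\<in>A. \<Sum>y\<in>B. \<pi> x y * c1 + (if y = \<psi> x then 0 else \<pi> x y) * c2)"
      using nn by (intro sum_ennreal sum_nonneg)
    finally show ?thesis .
  qed
  also have "\<dots> \<le> ennreal (c1 + card A * \<delta> * c2)"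
  proof (rule ennreal_leI)
    have "(\<Sum>x\<in>A. \<Sum>y\<in>B. \<pi> x y * c1 + (if y = \<psi> x then 0 else \<pi> x y) * c2)
        = (\<Sum>x\<in>A. \<Sum>y\<in>B. \<pi> x y) * c1 + (\<Sum>x\<in>A. \<Sum>y\<in>B. if y = \<psi> x then 0 else \<pi> x y) * c2"
      by (simp only: sum.distrib sum_distrib_right)
    also have "(\<Sum>x\<in>A. \<Sum>y\<in>B. \<pi> x y) = 1" using \<pi>(2) sum(1) by simp
    also have "1 * c1 + (\<Sum>x\<in>A. \<Sum>y\<in>B. if y = \<psi> x then 0 else \<pi> x y) * c2 \<le> c1 + card A * \<delta> * c2"
      using mult_right_mono[OF \<pi>(4) \<delta>(3)] by simp
    finally show "(\<Sum>x\<in>A. \<Sum>y\<in>B. \<pi> x y * c1 + (if y = \<psi> x then 0 else \<pi> x y) * c2) \<le> c1 + card A * \<delta> * c2" .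
  qed
  finally have "esqrt (\<Sum>x\<in>A. \<Sum>y\<in>B. ennreal (\<pi> x y) * (W2 (g y) (f x))\<^sup>2) \<le> esqrt (ennreal (c1 + card A * \<delta> * c2))"
    by (rule esqrt_mono)
  moreover have "WW2 (distr (point_measure B (\<lambda>y. ennreal (b y))) S g) (distr (point_measure A (\<lambda>x. ennreal (a x))) S f)
      \<le> esqrt (\<Sum>x\<in>A. \<Sum>y\<in>B. ennreal (\<pi> x y) * (W2 (g y) (f x))\<^sup>2)"
    using \<pi> by (intro WW2_le_finite_coupling fin f g) auto
  ultimately show ?thesis by (rule order_trans[rotated])
qed

section \<open>Diagrams in a bounded region\<close>

lemma hgt_off_point_pos:
  assumes "D \<in> diagrams" "l \<in> off_points D"
  shows "0 < hgt (fst l)"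
proof -
  obtain b d k where l: "l = ((b, d), k)" by (metis prod.exhaust)
  have "enat k < D (b, d)" "(b, d) \<notin> diagonal" using assms(2) l by (auto simp: off_points_def points_def)
  moreover from this have "D (b, d) \<noteq> 0" by auto
  ultimately show ?thesis using assms(1) l
    by (cases b d rule: linorder_cases) (auto simp: diagrams_def hgt_def mem_diagonal_iff)
qed

lemma diagram_spaceD:
  assumes "D \<in> diagram_space M K"
  shows "finite (off_points D)" "card (off_points D) \<le> K" "D \<in> diagrams"
    "\<And>l. l \<in> off_points D \<Longrightarrow> 0 \<le> fst (fst l) \<and> fst (fst l) \<le> M \<and> 0 \<le> snd (fst l) \<and> snd (fst l) \<le> M"
  using assms by (auto simp: diagram_space_def)

text \<open>Sending everything to the diagonal costs at most M^2 / 2 for each of at most 2 K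
  points.\<close>

lemma W2_sq_le_diagram_space:
  assumes "D \<in> diagram_space M K" "E \<in> diagram_space M K"
  shows "(W2 D E)\<^sup>2 \<le> ennreal (K * M\<^sup>2)"
proof -
  have "(\<Sum>l\<in>off_points D. (hgt (fst l))\<^sup>2 / 2) \<le> K * (M\<^sup>2 / 2)" if D: "D \<in> diagram_space M K" for D
  proof -
    have "(hgt (fst l))\<^sup>2 / 2 \<le> M\<^sup>2 / 2" if "l \<in> off_points D" for l
    proof -
      have "\<bar>hgt (fst l)\<bar> \<le> M" using diagram_spaceD(4)[OF D that] by (auto simp: hgt_def)
      then have "\<bar>hgt (fst l)\<bar>\<^sup>2 \<le> M\<^sup>2" by (rule power_mono) simp
      then show ?thesis by simp
    qed
    then have "(\<Sum>l\<in>off_points D. (hgt (fst l))\<^sup>2 / 2) \<le> (\<Sum>l\<in>off_points D. M\<^sup>2 / 2)" by (rule sum_mono)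
    also have "\<dots> = card (off_points D) * (M\<^sup>2 / 2)" by simp
    also have "\<dots> \<le> K * (M\<^sup>2 / 2)"
      using diagram_spaceD(2)[OF D] by (intro mult_right_mono) auto
    finally show ?thesis .
  qed
  from add_mono[OF this[OF assms(1)] this[OF assms(2)]]
  have "(\<Sum>l\<in>off_points D. (hgt (fst l))\<^sup>2 / 2) + (\<Sum>l\<in>off_points E. (hgt (fst l))\<^sup>2 / 2) \<le> K * M\<^sup>2"
    by (simp add: field_simps)
  then show ?thesis
    using W2_sq_le_hgt[OF labels_diagram_space[OF assms(1)] labels_diagram_space[OF assms(2)]]
    by (meson ennreal_leI order_trans)
qed

lemma empty_diagram_space: "empty_diagram \<in> diagram_space M K"
proof -
  have "off_points empty_diagram = {}" by (simp add: empty_diagram_def off_points_diagram_of_mset)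
  moreover have "empty_diagram \<in> diagrams"
    by (auto simp: diagrams_def empty_diagram_def diagram_of_mset_def mem_diagonal_iff hgt_def zero_enat_def)
  ultimately show ?thesis by (simp add: diagram_space_def)
qed

text \<open>Averaging \<open>adv\<close> and \<open>hgt\<close> over different numbers of entries
  could a priori leave the square. In the original coordinates, however, the mean is a combination
  of the coordinate sums with nonnegative weights u and v, where u + v = 1 /
  \<open>sel_card\<close>.\<close>

lemma mean_pt_box:
  assumes N: "N \<ge> 1" and s: "i < N" "s i \<noteq> None"
    and box: "\<And>i l. i < N \<Longrightarrow> s i = Some l \<Longrightarrow> 0 \<le> fst (p i l) \<and> fst (p i l) \<le> M \<and> 0 \<le> snd (p i l) \<and> snd (p i l) \<le> M"
  shows "0 \<le> fst (mean_pt N p s)" "fst (mean_pt N p s) \<le> M" "0 \<le> snd (mean_pt N p s)" "snd (mean_pt N p s) \<le> M"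
proof -
  let ?k = "sel_card N s" and ?f = "sel_sum N p fst s" and ?g = "sel_sum N p snd s"
  have k: "0 < ?k" "?k \<le> N" using sel_card_pos[of i N s] s sel_card_le[of N s] by auto
  have "0 \<le> ?f" "0 \<le> ?g"
    unfolding sel_sum_def using box by (auto intro!: sum_nonneg split: option.splits)
  have le: "?f \<le> ?k * M" "?g \<le> ?k * M"
    unfolding sel_sum_def sel_card_def sum_distrib_right using box
    by (auto intro!: sum_mono split: option.splits)
  have adv: "sel_sum N p adv s = ?f + ?g"
    unfolding sel_sum_def adv_def sum.distrib[symmetric] by (intro sum.cong) (auto split: option.splits)
  have hgt: "sel_sum N p hgt s = ?g - ?f"
    unfolding sel_sum_def hgt_def sum_subtractf[symmetric] by (intro sum.cong) (auto split: option.splits)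
  \<comment> \<open>Nonnegativity of v is the inequality \<open>sel_card\<close> \<le> N.\<close>
  define u v where "u = (1 / ?k + 1 / N) / 2" and "v = (1 / ?k - 1 / N) / 2"
  have "1 / real N \<le> 1 / ?k" using k by (intro divide_left_mono) auto
  then have uv: "0 \<le> u" "0 \<le> v" using k by (auto simp: u_def v_def)
  have "(a + b) / 2 + (a - b) / 2 = a" for a b :: real by (simp add: field_simps)
  then have uvk: "u + v = 1 / ?k" unfolding u_def v_def .
  have split: "((f + g) * i - (g - f) * j) / 2 = (i + j) / 2 * f + (i - j) / 2 * g"
    "((f + g) * i + (g - f) * j) / 2 = (i - j) / 2 * f + (i + j) / 2 * g" for f g i j :: real
    by (simp_all add: field_simps)
  have "fst (mean_pt N p s) = ((?f + ?g) * (1 / ?k) - (?g - ?f) * (1 / N)) / 2"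
    "snd (mean_pt N p s) = ((?f + ?g) * (1 / ?k) + (?g - ?f) * (1 / N)) / 2"
    by (simp_all add: mean_pt_def Let_def adv hgt)
  then have fst: "fst (mean_pt N p s) = u * ?f + v * ?g" and snd: "snd (mean_pt N p s) = v * ?f + u * ?g"
    unfolding split u_def v_def .
  show "0 \<le> fst (mean_pt N p s)" "0 \<le> snd (mean_pt N p s)"
    unfolding fst snd using uv \<open>0 \<le> ?f\<close> \<open>0 \<le> ?g\<close> by auto
  have M: "u * (?k * M) + v * (?k * M) = M" "v * (?k * M) + u * (?k * M) = M"
  proof -
    have "(u + v) * (?k * M) = M" unfolding uvk using k by simp
    then show "u * (?k * M) + v * (?k * M) = M" "v * (?k * M) + u * (?k * M) = M"
      by (simp_all add: algebra_simps)
  qed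
  show "fst (mean_pt N p s) \<le> M"
    unfolding fst using add_mono[OF mult_left_mono[OF le(1) uv(1)] mult_left_mono[OF le(2) uv(2)]] M by simp
  show "snd (mean_pt N p s) \<le> M"
    unfolding snd using add_mono[OF mult_left_mono[OF le(1) uv(2)] mult_left_mono[OF le(2) uv(1)]] M by simp
qed

lemma above_off_points:
  "\<forall>i<N. X i \<in> diagram_space M K \<Longrightarrow> above N (\<lambda>i. off_points (X i)) (\<lambda>i l. fst l)"
  using hgt_off_point_pos diagram_spaceD(3) unfolding above_def by blast

lemma grouping_mean_diagram_space:
  assumes N: "N \<ge> 1" and X: "\<forall>i<N. X i \<in> diagram_space M K"
    and G: "is_grouping N (\<lambda>i. off_points (X i)) G"
  shows "grouping_mean N (\<lambda>i l. fst l) G \<in> diagram_space M (N * K)"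
proof -
  let ?L = "\<lambda>i. off_points (X i)" and ?p = "\<lambda>i l. fst l :: point"
  let ?Z = "grouping_mean N ?p G"
  have fin: "\<forall>i<N. finite (?L i)" using X diagram_spaceD(1) by blast
  note ab = above_off_points[OF X]
  obtain \<mu> where \<mu>: "labels ?Z G \<mu> (mean_pt N ?p)" using ex_labels_grouping_mean[OF N fin G ab] by blast
  then have bij: "bij_betw \<mu> G (off_points ?Z)" and finG: "finite G"
    and fst_\<mu>: "\<And>s. s \<in> G \<Longrightarrow> fst (\<mu> s) = mean_pt N ?p s" by (auto simp: labels_def)
  have "card (off_points ?Z) = card G" using bij by (simp add: bij_betw_same_card)
  also have "\<dots> \<le> (\<Sum>i<N. card (?L i))" using card_grouping_le[OF fin G] .
  also have "\<dots> \<le> (\<Sum>i<N. K)" using X diagram_spaceD(2) by (intro sum_mono) auto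
  finally have card: "card (off_points ?Z) \<le> N * K" by simp
  have box: "0 \<le> fst (fst l) \<and> fst (fst l) \<le> M \<and> 0 \<le> snd (fst l) \<and> snd (fst l) \<le> M"
    if "l \<in> off_points ?Z" for l
  proof -
    obtain s where s: "s \<in> G" "l = \<mu> s" using bij \<open>l \<in> off_points ?Z\<close> by (auto simp: bij_betw_def)
    obtain i m where im: "i < N" "s i = Some m" using G s(1) by (rule grouping_obtain)
    have "0 \<le> fst (fst l') \<and> fst (fst l') \<le> M \<and> 0 \<le> snd (fst l') \<and> snd (fst l') \<le> M"
      if "i < N" "s i = Some l'" for i l'
    proof -
      have "l' \<in> ?L i" using selection_SomeD[of N ?L s i l'] G s(1) that by (auto simp: is_grouping_def)
      then show ?thesis using diagram_spaceD(4) X that(1) by blast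
    qed
    from mean_pt_box[of N i s ?p M, OF N im(1) _ this] show ?thesis
      unfolding s(2) fst_\<mu>[OF s(1)] using im(2) by simp
  qed
  have "finite (off_points ?Z)" using bij finG bij_betw_finite by blast
  then show ?thesis
    unfolding diagram_space_def
    using grouping_mean_diagrams[OF N fin G ab] card box by auto
qed

lemma space_borel_diagrams: "space (borel_diagrams M K) = diagram_space M K"
  unfolding borel_diagrams_def by (rule space_measure_of) auto

section \<open>The probabilistic Frechet mean as a finite distribution\<close>

abbreviation pfm_groupings :: "nat \<Rightarrow> (nat \<Rightarrow> diagram) \<Rightarrow> (point \<times> nat) selection set set" where
  "pfm_groupings N X \<equiv> {G. is_grouping N (\<lambda>i. off_points (X i)) G}"

text \<open>As for \<open>perturbation\<close>, the identification with an image measure shows that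
  the function given to \<open>measure_of\<close> is additive. Groupings with equal means contribute
  to the same atom.\<close>

lemma pfm_eq_distr:
  assumes N: "N \<ge> 1" and X: "\<forall>i<N. X i \<in> diagram_space M K"
  shows "pfm \<alpha> N M K X = distr (point_measure (pfm_groupings N X) (\<lambda>G. ennreal (grouping_prob \<alpha> N X G)))
    (borel_diagrams M (N * K)) (grouping_mean N (\<lambda>i l. fst l))" (is "_ = ?D")
proof -
  let ?\<G> = "pfm_groupings N X" and ?m = "grouping_mean N (\<lambda>i l. fst l) :: (point \<times> nat) selection set \<Rightarrow> diagram"
  let ?S = "borel_diagrams M (N * K)"
  have fin: "finite ?\<G>"
    using X diagram_spaceD(1) by (intro finite_groupings) auto
  have m: "?m \<in> ?\<G> \<rightarrow> space ?S"
    using grouping_mean_diagram_space[OF N X] by (auto simp: space_borel_diagrams)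
  have sp: "sets ?S \<subseteq> Pow (diagram_space M (N * K))" using sets.space_closed[of ?S] by (simp add: space_borel_diagrams)
  have "emeasure ?D A = (\<Sum>G\<in>?\<G>. ennreal (grouping_prob \<alpha> N X G) * indicator A (?m G))"
    if A: "A \<in> sets ?S" for A
  proof -
    have "emeasure ?D A = emeasure (point_measure ?\<G> (\<lambda>G. ennreal (grouping_prob \<alpha> N X G))) (?m -` A \<inter> ?\<G>)"
      using A m by (subst emeasure_distr) (simp_all add: measurable_point_measure_eq1 space_point_measure)
    also have "\<dots> = (\<Sum>G\<in>?m -` A \<inter> ?\<G>. ennreal (grouping_prob \<alpha> N X G))"
      using fin by (intro emeasure_point_measure_finite) auto
    also have "\<dots> = (\<Sum>G\<in>?\<G>. ennreal (grouping_prob \<alpha> N X G) * indicator A (?m G))"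
      using fin by (intro sum.mono_neutral_cong_left) (auto split: split_indicator)
    finally show ?thesis .
  qed
  then have "pfm \<alpha> N M K X = measure_of (diagram_space M (N * K)) (sets ?S) (emeasure ?D)"
    unfolding pfm_def using sp
    by (intro measure_of_eq) (simp_all add: sets.sigma_sets_eq[of ?S, unfolded space_borel_diagrams])
  also have "\<dots> = ?D"
    using measure_of_of_measure[of ?D] by (simp add: space_borel_diagrams)
  finally show ?thesis .
qed

lemma draws_eq: "draws \<alpha> N X = draw_measure \<alpha> (\<lambda>j. fst (snd j)) (SIGMA i:{..<N}. off_points (X i))"
  unfolding draws_def by (simp add: case_prod_beta')

lemma sum_grouping_prob:
  assumes "N \<ge> 1" "\<alpha> > 0" "\<forall>i<N. X i \<in> diagram_space M K"
  shows "(\<Sum>G\<in>pfm_groupings N X. grouping_prob \<alpha> N X G) = 1"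
  unfolding grouping_prob_eq draws_eq
proof (rule sum_prob_induces[OF assms(1,2)])
  show "\<forall>i<N. finite (off_points (X i))" using assms(3) diagram_spaceD(1) by blast
  show "\<forall>i<N. \<forall>l\<in>off_points (X i). 0 < hgt (fst (snd (i, l)))"
    using above_off_points[OF assms(3)] by (simp add: above_def)
qed

lemma grouping_prob_nonneg: "0 \<le> grouping_prob \<alpha> N X G"
  by (simp add: grouping_prob_def)

lemma pfm_in_prob_diagrams:
  assumes N: "N \<ge> 1" and \<alpha>: "\<alpha> > 0" and X: "\<forall>i<N. X i \<in> diagram_space M K"
  shows "pfm \<alpha> N M K X \<in> prob_diagrams M (N * K)"
proof -
  let ?\<G> = "pfm_groupings N X" and ?m = "grouping_mean N (\<lambda>i l. fst l) :: (point \<times> nat) selection set \<Rightarrow> diagram"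
  let ?Q = "point_measure ?\<G> (\<lambda>G. ennreal (grouping_prob \<alpha> N X G))" and ?S = "borel_diagrams M (N * K)"
  have fin: "finite ?\<G>"
    using X diagram_spaceD(1) by (intro finite_groupings) auto
  have m: "?m \<in> ?Q \<rightarrow>\<^sub>M ?S"
    using grouping_mean_diagram_space[OF N X] by (auto simp: measurable_point_measure_eq1 space_borel_diagrams)
  have "emeasure ?Q (space ?Q) = ennreal (\<Sum>G\<in>?\<G>. grouping_prob \<alpha> N X G)"
    using fin grouping_prob_nonneg
    by (simp add: space_point_measure emeasure_point_measure_finite sum_ennreal)
  then have Q: "prob_space ?Q"
    using sum_grouping_prob[OF N \<alpha> X] by (intro prob_spaceI) simp
  have "(\<integral>\<^sup>+Z. (W2 Z empty_diagram)\<^sup>2 \<partial>pfm \<alpha> N M K X) \<le> (\<integral>\<^sup>+G. (W2 (?m G) empty_diagram)\<^sup>2 \<partial>?Q)"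
    unfolding pfm_eq_distr[OF N X] by (rule nn_integral_distr_le[OF m])
  also have "\<dots> \<le> (\<integral>\<^sup>+G. ennreal (real (N * K) * M\<^sup>2) \<partial>?Q)"
  proof (rule nn_integral_mono)
    fix G assume "G \<in> space ?Q"
    then have "is_grouping N (\<lambda>i. off_points (X i)) G" by (simp add: space_point_measure)
    from W2_sq_le_diagram_space[OF grouping_mean_diagram_space[OF N X this] empty_diagram_space]
    show "(W2 (?m G) empty_diagram)\<^sup>2 \<le> ennreal (real (N * K) * M\<^sup>2)" .
  qed
  also have "\<dots> < \<infinity>"
    using prob_space.emeasure_space_1[OF Q] by (simp add: ennreal_mult_less_top less_top)
  finally show ?thesis
    unfolding prob_diagrams_def
    using prob_space.prob_space_distr[OF Q m] by (simp add: pfm_eq_distr[OF N X])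
qed

section \<open>Continuity\<close>

text \<open>A matching of squared cost below \<epsilon>^2 moves every single point by less than
  \<epsilon>. Points of \<open>X\<close> are at least \<epsilon> from the diagonal, so none of them
  can be matched with it, and the inverse matching restricts to an injection of off-diagonal points.
  Any other point of \<open>Y\<close> is matched with the diagonal.\<close>

lemma ex_matching_of_W2_less:
  assumes X: "X \<in> diagram_space M K" and Y: "Y \<in> diagram_space M K"
    and W: "W2 Y X < ennreal \<epsilon>" and \<epsilon>: "\<epsilon> > 0"
    and far: "\<forall>l\<in>off_points X. \<epsilon> \<le> infdist (fst l) diagonal"
  shows "\<exists>e. inj_on e (off_points X) \<and> e ` off_points X \<subseteq> off_points Y \<and>
    (\<forall>l\<in>off_points X. norm (fst l - fst (e l)) \<le> \<epsilon>) \<and>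
    (\<forall>m\<in>off_points Y - e ` off_points X. infdist (fst m) diagonal \<le> \<epsilon>)"
proof -
  have diag: "\<forall>x\<in>diagonal. X x = \<infinity>" "\<forall>x\<in>diagonal. Y x = \<infinity>"
    using diagram_spaceD(3)[OF X] diagram_spaceD(3)[OF Y] by (auto simp: diagrams_def)
  have "(W2 Y X)\<^sup>2 < (ennreal \<epsilon>)\<^sup>2"
  proof -
    obtain r where r: "W2 Y X = ennreal r" "0 \<le> r" using W by (cases "W2 Y X") auto
    then have "r < \<epsilon>" using W by (simp add: ennreal_less_iff)
    then have "r\<^sup>2 < \<epsilon>\<^sup>2" using r(2) by (intro power_strict_mono) auto
    then show ?thesis using r \<epsilon> by (simp add: ennreal_power ennreal_less_iff)
  qed
  then obtain \<phi> where \<phi>: "\<phi> \<in> matchings Y X" "match_cost \<phi> (points Y) < (ennreal \<epsilon>)\<^sup>2"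
    by (rule W2_sq_less_obtain)
  have bij: "bij_betw \<phi> (points Y) (points X)" using \<phi>(1) by (simp add: matchings_def)
  have close: "norm (fst z - fst (\<phi> z)) < \<epsilon>" if z: "z \<in> points Y" for z
  proof -
    have "ennreal ((norm (fst z - fst (\<phi> z)))\<^sup>2) \<le> match_cost \<phi> (points Y)"
      using sum_le_match_cost[of "{z}" "points Y" \<phi>] z by simp
    also note \<phi>(2)
    also have "(ennreal \<epsilon>)\<^sup>2 = ennreal (\<epsilon>\<^sup>2)" using \<epsilon> by (simp add: ennreal_power)
    finally have "(norm (fst z - fst (\<phi> z)))\<^sup>2 < \<epsilon>\<^sup>2" by (simp add: ennreal_less_iff)
    then show ?thesis by (rule power2_less_imp_less) (use \<epsilon> in simp)
  qed
  have near: "infdist (fst z) diagonal < \<epsilon>" if "z \<in> points Y" "fst (\<phi> z) \<in> diagonal" for z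
    using infdist_le[OF that(2), of "fst z"] close[OF that(1)] by (simp add: dist_norm)
  define e where "e = inv_into (points Y) \<phi>"
  have e: "e l \<in> points Y" "\<phi> (e l) = l" if "l \<in> points X" for l
    using that bij unfolding e_def
    by (simp_all add: bij_betw_def inv_into_into f_inv_into_f)
  have ptX: "l \<in> points X" if "l \<in> off_points X" for l
    using that by (auto simp: off_points_def)
  have off: "e l \<in> off_points Y" if l: "l \<in> off_points X" for l
  proof (rule ccontr)
    assume "e l \<notin> off_points Y"
    then have "fst (e l) \<in> diagonal"
      using e(1)[OF ptX[OF l]] by (auto simp: points_eq[OF diag(2)])
    then have "infdist (fst l) diagonal \<le> norm (fst (e l) - fst l)"
      using infdist_le[of "fst (e l)" diagonal "fst l"] by (simp add: dist_norm norm_minus_commute)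
    then show False using close[OF e(1)[OF ptX[OF l]]] e(2)[OF ptX[OF l]] far l by force
  qed
  have inj: "inj_on e (off_points X)"
    using e(2) ptX by (intro inj_onI) metis
  have cl: "norm (fst l - fst (e l)) \<le> \<epsilon>" if "l \<in> off_points X" for l
    using close[OF e(1)[OF ptX[OF that]]] e(2)[OF ptX[OF that]] by (simp add: norm_minus_commute)
  have rest: "infdist (fst m) diagonal \<le> \<epsilon>" if m: "m \<in> off_points Y - e ` off_points X" for m
  proof -
    have mY: "m \<in> points Y" using m by (auto simp: off_points_def)
    have "e (\<phi> m) = m" unfolding e_def using bij mY by (simp add: bij_betw_inv_into_left)
    then have "\<phi> m \<notin> off_points X" using m by force
    then have "fst (\<phi> m) \<in> diagonal"
      using bij_betw_apply[OF bij mY] unfolding points_eq[OF diag(1)] by auto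
    then show ?thesis using near[OF mY] by simp
  qed
  show ?thesis using inj off cl rest by blast
qed

text \<open>The bound involves \<open>X\<close> only through its number of groupings and does not
  involve \<open>Y\<close>. With \<open>X\<close> fixed it tends to 0 with \<epsilon>; this dictates
  the asymmetry in which only \<open>X\<close> has to keep away from the diagonal.\<close>

lemma WW2_pfm_le:
  assumes N: "N \<ge> 1" and \<alpha>: "\<alpha> > 0" and \<epsilon>: "\<epsilon> > 0"
    and X: "\<forall>i<N. X i \<in> diagram_space M K" and Y: "\<forall>i<N. Y i \<in> diagram_space M K"
    and W: "\<forall>i<N. W2 (Y i) (X i) < ennreal \<epsilon>"
    and far: "\<forall>i<N. \<forall>l\<in>off_points (X i). \<epsilon> \<le> infdist (fst l) diagonal"
  shows "WW2 (pfm \<alpha> N M K Y) (pfm \<alpha> N M K X) \<le> esqrt (ennreal (real (N * K) * (4 * \<epsilon>\<^sup>2) +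
    card (pfm_groupings N X) * (real (N * K) * (6 * \<epsilon> / \<alpha>) + real (N * K) * (\<epsilon>\<^sup>2 / \<alpha>\<^sup>2)) * (real (N * K) * M\<^sup>2)))"
proof -
  let ?L = "\<lambda>i. off_points (X i)" and ?L' = "\<lambda>i. off_points (Y i)"
  have "\<exists>e. inj_on e (?L i) \<and> e ` ?L i \<subseteq> ?L' i \<and> (\<forall>l\<in>?L i. norm (fst l - fst (e l)) \<le> \<epsilon>) \<and>
      (\<forall>m\<in>?L' i - e ` ?L i. infdist (fst m) diagonal \<le> \<epsilon>)" if "i < N" for i
    using that X Y W far by (intro ex_matching_of_W2_less[OF _ _ _ \<epsilon>]) auto
  then obtain e where e: "\<forall>i<N. inj_on (e i) (?L i)" "\<forall>i<N. e i ` ?L i \<subseteq> ?L' i"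
    "\<forall>i<N. \<forall>l\<in>?L i. norm (fst l - fst (e i l)) \<le> \<epsilon>"
    "\<forall>i<N. \<forall>m\<in>?L' i - e i ` ?L i. infdist (fst m) diagonal \<le> \<epsilon>"
    by metis
  let ?m = "grouping_mean N (\<lambda>i l. fst l) :: (point \<times> nat) selection set \<Rightarrow> diagram"
  let ?\<psi> = "transfer N ?L ?L' e"
  have finX: "\<forall>i<N. finite (?L i)" and finY: "\<forall>i<N. finite (?L' i)"
    using X Y diagram_spaceD(1) by blast+
  have cardY: "(\<Sum>i<N. card (?L' i)) \<le> N * K"
  proof -
    have "(\<Sum>i<N. card (?L' i)) \<le> (\<Sum>i<N. K)" using Y diagram_spaceD(2) by (intro sum_mono) auto
    then show ?thesis by simp
  qed
  have cardJ: "card (SIGMA i:{..<N}. ?L' i) \<le> N * K"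
    using cardY finY by (subst card_SigmaI) auto
  have near: "\<forall>j\<in>unmatched N ?L ?L' e. infdist (fst (snd j)) diagonal \<le> \<epsilon>"
    "\<forall>(i, m)\<in>unmatched N ?L ?L' e. infdist (fst m) diagonal \<le> \<epsilon>"
    using e(4) by (auto simp: unmatched_def)
  have close: "\<forall>i<N. \<forall>l\<in>?L i. norm (fst (snd (i, l)) - fst (snd (i, e i l))) \<le> \<epsilon>"
    using e(3) by simp
  show ?thesis
    unfolding pfm_eq_distr[OF N X] pfm_eq_distr[OF N Y]
  proof (rule WW2_le_close)
    show "finite (pfm_groupings N X)" using finX by (intro finite_groupings) simp
    show "finite (pfm_groupings N Y)" using finY by (intro finite_groupings) simp
    show "?m \<in> pfm_groupings N X \<rightarrow> space (borel_diagrams M (N * K))"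
      "?m \<in> pfm_groupings N Y \<rightarrow> space (borel_diagrams M (N * K))"
      using grouping_mean_diagram_space[OF N X] grouping_mean_diagram_space[OF N Y]
      by (auto simp: space_borel_diagrams)
    show "sum (grouping_prob \<alpha> N X) (pfm_groupings N X) = 1" "sum (grouping_prob \<alpha> N Y) (pfm_groupings N Y) = 1"
      using sum_grouping_prob[OF N \<alpha> X] sum_grouping_prob[OF N \<alpha> Y] .
    show "inj_on ?\<psi> (pfm_groupings N X)" by (rule inj_on_transfer[OF e(1)])
    show "?\<psi> ` pfm_groupings N X \<subseteq> pfm_groupings N Y" using is_grouping_transfer[OF e(1,2)] by blast
    show "0 \<le> real (N * K) * (6 * \<epsilon> / \<alpha>) + real (N * K) * (\<epsilon>\<^sup>2 / \<alpha>\<^sup>2)" using \<alpha> \<epsilon> by simp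
    fix G assume G: "G \<in> pfm_groupings N X"
    have "grouping_prob \<alpha> N X G \<le> grouping_prob \<alpha> N Y (?\<psi> G)
        + card (SIGMA i:{..<N}. ?L' i) * (6 * \<epsilon> / \<alpha>) + card (SIGMA i:{..<N}. ?L' i) * (\<epsilon>\<^sup>2 / \<alpha>\<^sup>2)"
      using measure_induces_le[where c = "\<lambda>j. fst (snd j)" and c' = "\<lambda>j. fst (snd j)",
          OF N \<alpha> finX finY e(1,2) close near(1) order.strict_implies_order[OF \<epsilon>], of G]
      unfolding grouping_prob_eq draws_eq .
    also have "\<dots> \<le> grouping_prob \<alpha> N Y (?\<psi> G) + real (N * K) * (6 * \<epsilon> / \<alpha>) + real (N * K) * (\<epsilon>\<^sup>2 / \<alpha>\<^sup>2)"
      using cardJ \<alpha> \<epsilon> by (intro add_mono mult_right_mono of_nat_mono) auto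
    finally show "grouping_prob \<alpha> N X G
        \<le> grouping_prob \<alpha> N Y (?\<psi> G) + (real (N * K) * (6 * \<epsilon> / \<alpha>) + real (N * K) * (\<epsilon>\<^sup>2 / \<alpha>\<^sup>2))"
      by simp
    have "(W2 (?m (?\<psi> G)) (?m G))\<^sup>2 \<le> ennreal ((\<Sum>i<N. card (?L' i)) * (4 * \<epsilon>\<^sup>2))"
      using e(3) \<epsilon> near(2) G
      by (intro W2_transfer_le N finX finY e(1,2) above_off_points[OF X] above_off_points[OF Y]) auto
    also have "\<dots> \<le> ennreal (real (N * K) * (4 * \<epsilon>\<^sup>2))"
      using cardY by (intro ennreal_leI mult_right_mono of_nat_mono) auto
    finally show "(W2 (?m (?\<psi> G)) (?m G))\<^sup>2 \<le> ennreal (real (N * K) * (4 * \<epsilon>\<^sup>2))" .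
    fix H assume H: "H \<in> pfm_groupings N Y"
    show "(W2 (?m H) (?m G))\<^sup>2 \<le> ennreal (real (N * K) * M\<^sup>2)"
      using G H grouping_mean_diagram_space[OF N X] grouping_mean_diagram_space[OF N Y]
      by (intro W2_sq_le_diagram_space) auto
  qed (auto simp: grouping_prob_nonneg)
qed

theorem corollary5p5:
  fixes N K :: nat and M \<alpha> :: real and \<gamma> :: "nat \<Rightarrow> real \<Rightarrow> diagram"
  assumes "N \<ge> 1" and "K \<ge> 1" and "M > 0" and "\<alpha> > 0"
    and "\<And>i. i < N \<Longrightarrow> vineyard M K (\<gamma> i)"
  shows "(\<forall>t\<in>{0..1}. pfm \<alpha> N M K (\<lambda>i. \<gamma> i t) \<in> prob_diagrams M (N * K)) \<and>
         continuous_wrt WW2 {0..1} (\<lambda>t. pfm \<alpha> N M K (\<lambda>i. \<gamma> i t))"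
proof
  have D: "\<forall>i<N. \<gamma> i t \<in> diagram_space M K" if "t \<in> {0..1}" for t
    using assms(5) that by (auto simp: vineyard_def)
  show "\<forall>t\<in>{0..1}. pfm \<alpha> N M K (\<lambda>i. \<gamma> i t) \<in> prob_diagrams M (N * K)"
    using D by (intro ballI pfm_in_prob_diagrams assms(1,4))
  show "continuous_wrt WW2 {0..1} (\<lambda>t. pfm \<alpha> N M K (\<lambda>i. \<gamma> i t))"
    unfolding continuous_wrt_def
  proof (intro ballI order_tendstoI)
    fix t :: real assume t: "t \<in> {0..1}"
    fix a :: ennreal assume a: "0 < a"
    let ?X = "\<lambda>s i. \<gamma> i s"
    \<comment> \<open>The bound of \<open>WW2_pfm_le\<close> with the diagrams at time t in the role
      of \<open>X\<close>. It is continuous in \<epsilon> and vanishes at 0.\<close>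
    let ?B = "\<lambda>\<epsilon>. real (N * K) * (4 * \<epsilon>\<^sup>2) + card (pfm_groupings N (?X t)) *
      (real (N * K) * (6 * \<epsilon> / \<alpha>) + real (N * K) * (\<epsilon>\<^sup>2 / \<alpha>\<^sup>2)) * (real (N * K) * M\<^sup>2)"
    have B0: "0 \<le> ?B \<epsilon>" if "\<epsilon> \<ge> 0" for \<epsilon> using that assms(4) by simp
    have "((\<lambda>\<epsilon>. ennreal (sqrt (?B \<epsilon>))) \<longlongrightarrow> ennreal (sqrt (?B 0))) (at_right 0)"
      by (intro tendsto_intros tendsto_ennrealI) (use assms(4) in auto)
    then have "eventually (\<lambda>\<epsilon>. ennreal (sqrt (?B \<epsilon>)) < a) (at_right 0)"
      using a by (intro order_tendstoD) auto
    \<comment> \<open>The finitely many off-diagonal points at time t have positive distances to the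
      diagonal, so every small \<epsilon> lies below all of them.\<close>
    moreover have "eventually (\<lambda>\<epsilon>. \<forall>j\<in>(SIGMA i:{..<N}. off_points (\<gamma> i t)). \<epsilon> \<le> infdist (fst (snd j)) diagonal) (at_right 0)"
    proof (intro eventually_ball_finite ballI)
      show "finite (SIGMA i:{..<N}. off_points (\<gamma> i t))" using D[OF t] diagram_spaceD(1) by (intro finite_SigmaI) blast+
      fix j assume "j \<in> (SIGMA i:{..<N}. off_points (\<gamma> i t))"
      then obtain i l where "j = (i, l)" "i < N" "l \<in> off_points (\<gamma> i t)" by blast
      then have "0 < hgt (fst (snd j))" using above_off_points[OF D[OF t]] by (simp add: above_def)
      then have "0 < (infdist (fst (snd j)) diagonal)\<^sup>2" by (simp add: infdist_diagonal_sq)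
      then have "infdist (fst (snd j)) diagonal \<noteq> 0" by auto
      then have "0 < infdist (fst (snd j)) diagonal"
        using infdist_nonneg[of "fst (snd j)" diagonal] by linarith
      then show "eventually (\<lambda>\<epsilon>. \<epsilon> \<le> infdist (fst (snd j)) diagonal) (at_right 0)"
        by (metis (mono_tags, lifting) eventually_at_right_field less_imp_le)
    qed
    moreover have "eventually (\<lambda>\<epsilon> :: real. 0 < \<epsilon>) (at_right 0)"
      by (rule eventually_at_right_less)
    ultimately have "eventually (\<lambda>\<epsilon>. ennreal (sqrt (?B \<epsilon>)) < a \<and>
        (\<forall>j\<in>(SIGMA i:{..<N}. off_points (\<gamma> i t)). \<epsilon> \<le> infdist (fst (snd j)) diagonal) \<and> 0 < \<epsilon>) (at_right 0)"
      by eventually_elim simp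
    \<comment> \<open>\<epsilon> depends on t and the target a only; the neighbourhood of t for s is
      chosen afterwards from the continuity of the vineyards.\<close>
    then obtain \<epsilon> where \<epsilon>: "ennreal (sqrt (?B \<epsilon>)) < a" "0 < \<epsilon>"
      "\<forall>j\<in>(SIGMA i:{..<N}. off_points (\<gamma> i t)). \<epsilon> \<le> infdist (fst (snd j)) diagonal"
      using eventually_happens'[OF trivial_limit_at_right_real] by blast
    have "eventually (\<lambda>s. \<forall>i\<in>{..<N}. W2 (\<gamma> i s) (\<gamma> i t) < ennreal \<epsilon>) (at t within {0..1})"
    proof (intro eventually_ball_finite ballI)
      fix i assume "i \<in> {..<N}"
      then have "((\<lambda>s. W2 (\<gamma> i s) (\<gamma> i t)) \<longlongrightarrow> 0) (at t within {0..1})"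
        using assms(5) t by (auto simp: vineyard_def continuous_wrt_def)
      then show "eventually (\<lambda>s. W2 (\<gamma> i s) (\<gamma> i t) < ennreal \<epsilon>) (at t within {0..1})"
        using \<epsilon>(2) by (intro order_tendstoD) auto
    qed simp
    moreover have "eventually (\<lambda>s. s \<in> {0..1}) (at t within {0..1})"
      by (simp add: eventually_at_filter)
    ultimately show "eventually (\<lambda>s. WW2 (pfm \<alpha> N M K (?X s)) (pfm \<alpha> N M K (?X t)) < a) (at t within {0..1})"
    proof eventually_elim
      case (elim s)
      have "WW2 (pfm \<alpha> N M K (?X s)) (pfm \<alpha> N M K (?X t)) \<le> esqrt (ennreal (?B \<epsilon>))"
        using elim(1) \<epsilon>(3) by (intro WW2_pfm_le assms(1,4) \<epsilon>(2) D[OF t] D[OF elim(2)]) auto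
      also have "\<dots> = ennreal (sqrt (?B \<epsilon>))" using B0 \<epsilon>(2) by (intro esqrt_ennreal) simp
      also note \<epsilon>(1)
      finally show ?case .
    qed
  qed simp
qed

end
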